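(* Let $S\in L^1_{loc}[0,\infty)$, $a\in\mathbb{R}$, and let $\{\varphi_\lambda\}_{\lambda\in J}$ be a family with $\varphi_\lambda\in A_c(\mathbb{R})$ for each $\lambda\in J$, such that for every $t\in\mathbb{R}$ there is $\lambda_t\in J$ with $\varphi_{\lambda_t}(t)\neq0$, and such that for $t=0$ the corresponding $\varphi_{\lambda_0}$ additionally has non-negative Fourier transform. Then $S(x)\sim ae^{x}$ as $x\to\infty$ if and only if $S$ is log-linearly slowly decreasing, the Laplace transform $\mathcal{L}\{S;s\}=\int_0^\infty e^{-sx}S(x)\,\mathrm{d}x$ converges for $\Re s>1$, and the analytic function $\mathcal{L}\{S;s\}-\frac{a}{s-1}$ has pseudofunction boundary behavior on $\Re s=1$ with respect to every $\varphi_\lambda$, $\lambda\in J$.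
   Context: Fourier transform: $\hat\varphi(x)=\int e^{-ixt}\varphi(t)\,\mathrm{d}t$. $A(\mathbb{R})=\mathcal{F}(L^1(\mathbb{R}))$ is the Wiener algebra and $A_c(\mathbb{R})$ its subspace of compactly supported functions. $S$ is log-linearly slowly decreasing if for each $\varepsilon>0$ there exist $\delta>0$ and $x_0$ such that $(S(x+h)-S(x))e^{-x}\ge-\varepsilon$ for all $0\le h\le\delta$, $x\ge x_0$. An analytic $G$ on $\Re s>\alpha$ has pseudofunction boundary behavior on $\Re s=\alpha$ with respect to $\varphi\in A_c(\mathbb{R})$ if there is $N>0$ such that $I_\varphi(h)=\lim_{\sigma\to\alpha^+}\int_{-\infty}^\infty G(\sigma+it)e^{iht}\varphi(t)\,\mathrm{d}t$ exists for every $h\ge N$ and $I_\varphi(h)\to0$ as $h\to\infty$. *)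

theory Defs
  imports "HOL-Analysis.Analysis"
begin

definition fourier :: "(real \<Rightarrow> complex) \<Rightarrow> real \<Rightarrow> complex" where
  "fourier f x = (LINT t|lebesgue. exp (- (\<i> * of_real (x * t))) * f t)"

definition wiener_algebra :: "(real \<Rightarrow> complex) set" where
  "wiener_algebra = fourier ` {f. integrable lebesgue f}"

definition wiener_algebra_c :: "(real \<Rightarrow> complex) set" where
  "wiener_algebra_c = {\<phi> \<in> wiener_algebra. compact (closure {t. \<phi> t \<noteq> 0})}"

text \<open>
  A function on \<open>[0, \<infinity>)\<close> is represented by a total function on \<open>real\<close>; nothing below depends
  on its values at negative arguments.
\<close>

definition locally_integrable_halfline :: "(real \<Rightarrow> real) \<Rightarrow> bool" where
  "locally_integrable_halfline S \<longleftrightarrow> (\<forall>b\<ge>0. S absolutely_integrable_on {0..b})"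

definition log_linearly_slowly_decreasing :: "(real \<Rightarrow> real) \<Rightarrow> bool" where
  "log_linearly_slowly_decreasing S \<longleftrightarrow>
     (\<forall>\<epsilon>>0. \<exists>\<delta>>0. \<exists>x0\<ge>0. \<forall>h x. 0 \<le> h \<and> h \<le> \<delta> \<and> x \<ge> x0 \<longrightarrow>
        (S (x + h) - S x) * exp (- x) \<ge> - \<epsilon>)"

text \<open>
  The Laplace integral is the improper integral \<open>lim\<^bsub>T \<rightarrow> \<infinity>\<^esub> \<integral>\<^sub>0\<^sup>T\<close>; conditional
  convergence is allowed.
\<close>

definition laplace_partial :: "(real \<Rightarrow> real) \<Rightarrow> complex \<Rightarrow> real \<Rightarrow> complex" where
  "laplace_partial S s T = (LINT x:{0..T}|lebesgue. exp (- (s * of_real x)) * of_real (S x))"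

definition laplace_converges :: "(real \<Rightarrow> real) \<Rightarrow> complex \<Rightarrow> bool" where
  "laplace_converges S s \<longleftrightarrow> (\<exists>L. (laplace_partial S s \<longlongrightarrow> L) at_top)"

definition laplace :: "(real \<Rightarrow> real) \<Rightarrow> complex \<Rightarrow> complex" where
  "laplace S s = Lim at_top (laplace_partial S s)"

text \<open>The function \<open>I\<close> is only constrained on \<open>[N, \<infinity>)\<close>, where it equals \<open>I\<^sub>\<phi>\<close>.\<close>

definition pseudofunction_boundary_behavior ::
    "(complex \<Rightarrow> complex) \<Rightarrow> real \<Rightarrow> (real \<Rightarrow> complex) \<Rightarrow> bool" where
  "pseudofunction_boundary_behavior G \<alpha> \<phi> \<longleftrightarrow>
     G holomorphic_on {s. Re s > \<alpha>} \<and>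
     (\<exists>N>0. \<exists>I :: real \<Rightarrow> complex.
        (\<forall>h\<ge>N. ((\<lambda>\<sigma>. LINT t|lebesgue. G (Complex \<sigma> t) * exp (\<i> * of_real (h * t)) * \<phi> t)
                  \<longlongrightarrow> I h) (at_right \<alpha>)) \<and>
        (I \<longlongrightarrow> 0) at_top)"

end

(*
  With f(x) = S(x) exp(-x) - a on the half-line, Fubini identifies I_phi(h) with the correlation of f and the
  (integrable) transform of phi at lag h, so for bounded f pseudofunction boundary behaviour with respect
  to phi says exactly that this correlation tends to 0. Slow decrease bounds S(x) exp(-x) from below, which
  makes the Laplace integrals absolutely convergent, and the non-negative transform of phi_0 turns a bound
  on the correlation into a bound on local averages, hence on S(x) exp(-x) from above. For bounded f, Wiener's
  localisation (dividing by phi near a point where it does not vanish, in the norm of the algebra) and a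
  partition of unity extend the vanishing of the correlation from the given phi to every compactly
  supported function with integrable transform. Fejer kernels and slow decrease then give f -> 0.
*)

theory Submission
  imports Defs "HOL-Probability.Probability" "HOL-Real_Asymp.Real_Asymp"
begin

section \<open>Fourier transforms of integrable functions\<close>

text \<open>Two difficulties shape the proof. First, a bound on \<open>S(x) exp (- x)\<close> is
  available only from some \<open>x1\<close> on, while below \<open>x1\<close> the function is
  merely integrable. So the excess is split into a bounded tail, on which the localisation argument
  runs, and an integrable head, whose correlation dies by the Riemann-Lebesgue lemma. Second, before
  an upper bound is known the limit \<sigma> -> 1 cannot be taken under the integral; the averages
  are therefore estimated at each \<sigma> > 1 with an explicit weight, and the limit is taken in
  the inequality. There the non-vanishing at 0 enters through inversion: it says that the
  non-negative transform is not identically 0, hence is bounded below by a positive constant on some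
  interval. Slow decrease speaks of every point and the integrals only of almost every point, so a
  Borel function equal to \<open>S\<close> almost everywhere serves in the integrals, while
  pointwise bounds stay with \<open>S\<close>. Membership in A_c is used in a dual form: continuous,
  compactly supported, with integrable transform.\<close>

lemma borel_measurable_cis [measurable (raw)]:
  "f \<in> borel_measurable M \<Longrightarrow> (\<lambda>x. cis (f x)) \<in> borel_measurable M"
  by (rule borel_measurable_continuous_on[OF _ , where f=cis]) (auto intro!: continuous_intros)

text \<open>The definition integrates over the completed measure; on Borel integrands
  \<open>lborel\<close> gives the same value, and there Fubini and affine substitution
  apply.\<close>

lemma fourier_cis:
  assumes [measurable]: "f \<in> borel_measurable borel"
  shows "fourier f x = (LINT t|lborel. cis (-(x * t)) * f t)"
proof -
  have "fourier f x = (LINT t|lebesgue. cis (-(x * t)) * f t)"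
    unfolding fourier_def by (simp add: cis_conv_exp)
  also have "\<dots> = (LINT t|lborel. cis (-(x * t)) * f t)"
    by (rule integral_completion) simp
  finally show ?thesis .
qed

lemma integrable_cis_mult:
  assumes "integrable M f" and [measurable]: "g \<in> borel_measurable M"
  shows "integrable M (\<lambda>t. cis (g t) * f t)"
  using assms(1) by (rule Bochner_Integration.integrable_bound) (use assms in \<open>auto simp: norm_mult\<close>)

lemma integrable_lborel_translate:
  fixes f :: "real \<Rightarrow> 'a :: {banach, second_countable_topology}"
  shows "integrable lborel (\<lambda>x. f (x + t)) \<longleftrightarrow> integrable lborel f"
  using lborel_integrable_real_affine_iff[of 1 f t] by (simp add: add.commute)

lemma integral_lborel_translate:
  fixes f :: "real \<Rightarrow> 'a :: {banach, second_countable_topology}"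
  shows "(LINT x|lborel. f (x + t)) = (LINT x|lborel. f x)"
  using lborel_integral_real_affine[of 1 f t] by (simp add: add.commute)

lemma norm_fourier_le:
  assumes "f \<in> borel_measurable borel"
  shows "norm (fourier f x) \<le> (LINT t|lborel. norm (f t))"
proof -
  have "norm (fourier f x) \<le> (LINT t|lborel. norm (cis (-(x * t)) * f t))"
    unfolding fourier_cis[OF assms] by (rule integral_norm_bound)
  then show ?thesis by (simp add: norm_mult)
qed

lemma continuous_fourier:
  assumes "integrable lborel f"
  shows "continuous_on UNIV (fourier f)"
proof -
  have [measurable]: "f \<in> borel_measurable borel" using assms by auto
  have "continuous_on UNIV (\<lambda>x. LINT t|lborel. cis (-(x * t)) * f t)"
    unfolding continuous_on_sequentially comp_def
  proof (intro ballI allI impI)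
    fix X :: "nat \<Rightarrow> real" and a assume X: "(\<forall>n. X n \<in> UNIV) \<and> X \<longlonglongrightarrow> a"
    show "(\<lambda>n. LINT t|lborel. cis (-(X n * t)) * f t) \<longlonglongrightarrow> (LINT t|lborel. cis (-(a * t)) * f t)"
    proof (rule integral_dominated_convergence[where w="\<lambda>t. norm (f t)"])
      have "(\<lambda>n. cis (-(X n * t)) * f t) \<longlonglongrightarrow> cis (-(a * t)) * f t" for t
        unfolding cis_conv_exp by (intro tendsto_intros) (use X in auto)
      then show "AE x in lborel. (\<lambda>n. cis (-(X n * x)) * f x) \<longlonglongrightarrow> cis (-(a * x)) * f x" by simp
    qed (use assms in \<open>auto simp: norm_mult\<close>)
  qed
  then show ?thesis by (simp add: fourier_cis)
qed

lemma borel_measurable_fourier [measurable]: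
  "integrable lborel f \<Longrightarrow> fourier f \<in> borel_measurable borel"
  by (intro borel_measurable_continuous_onI continuous_fourier)

lemma integrable_prod_mult:
  fixes f g :: "real \<Rightarrow> 'a :: {real_normed_field, banach, second_countable_topology}"
  assumes "integrable lborel f" "integrable lborel g"
  shows "integrable (lborel \<Otimes>\<^sub>M lborel) (\<lambda>(x, y). f x * g y)"
proof (rule lborel_pair.Fubini_integrable)
  have [measurable]: "f \<in> borel_measurable borel" "g \<in> borel_measurable borel" using assms by auto
  show "(\<lambda>(x, y). f x * g y) \<in> borel_measurable (lborel \<Otimes>\<^sub>M lborel)" by measurable
  show "integrable lborel (\<lambda>x. LINT y|lborel. norm (case (x, y) of (x, y) \<Rightarrow> f x * g y))"
    using assms by (simp add: norm_mult)
qed (use assms in auto)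

lemma integrable_prod_translate:
  fixes f K :: "real \<Rightarrow> 'a :: {real_normed_field, banach, second_countable_topology}"
  assumes "integrable lborel f" "integrable lborel K"
  shows "integrable (lborel \<Otimes>\<^sub>M lborel) (\<lambda>(s, y). f s * K (y + s))"
proof (rule lborel_pair.Fubini_integrable)
  have [measurable]: "f \<in> borel_measurable borel" "K \<in> borel_measurable borel" using assms by auto
  show "(\<lambda>(s, y). f s * K (y + s)) \<in> borel_measurable (lborel \<Otimes>\<^sub>M lborel)" by measurable
  show "integrable lborel (\<lambda>x. LINT y|lborel. norm (case (x, y) of (s, y) \<Rightarrow> f s * K (y + s)))"
    using assms by (simp add: norm_mult integral_lborel_translate[of "\<lambda>y. norm (K y)"])
  show "AE x in lborel. integrable lborel (\<lambda>y. case (x, y) of (s, y) \<Rightarrow> f s * K (y + s))"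
    using assms by (simp add: integrable_lborel_translate)
qed

text \<open>The multiplication formula. The exponential has modulus 1, so the double integral
  converges absolutely and Fubini applies. Inversion, convolution and the boundary integrals all
  reduce to it.\<close>

lemma integral_fourier_mult:
  assumes "integrable lborel f" "integrable lborel g"
  shows "(LINT x|lborel. fourier f x * g x) = (LINT x|lborel. f x * fourier g x)"
proof -
  have [measurable]: "f \<in> borel_measurable borel" "g \<in> borel_measurable borel" using assms by auto
  have int: "integrable (lborel \<Otimes>\<^sub>M lborel) (\<lambda>(x, y). cis (- (x * y)) * (f x * g y))"
    using integrable_prod_mult[OF assms]
    by (rule Bochner_Integration.integrable_bound) (auto simp: norm_mult)
  have "(LINT y|lborel. fourier f y * g y) = (LINT y|lborel. LINT x|lborel. cis (- (x * y)) * (f x * g y))"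
  proof -
    have "fourier f y * g y = (LINT x|lborel. cis (- (x * y)) * (f x * g y))" for y
      unfolding fourier_cis[OF \<open>f \<in> borel_measurable borel\<close>] integral_mult_left_zero[symmetric]
      by (simp add: ac_simps)
    then show ?thesis by simp
  qed
  also have "\<dots> = (LINT x|lborel. LINT y|lborel. cis (- (x * y)) * (f x * g y))"
    using lborel_pair.Fubini_integral[OF int] by simp
  also have "\<dots> = (LINT x|lborel. f x * fourier g x)"
  proof -
    have "f x * fourier g x = (LINT y|lborel. cis (- (x * y)) * (f x * g y))" for x
      unfolding fourier_cis[OF \<open>g \<in> borel_measurable borel\<close>] integral_mult_right_zero[symmetric]
      by (simp add: ac_simps)
    then show ?thesis by simp
  qed
  finally show ?thesis .
qed

lemma fourier_cis_mult:
  assumes [measurable]: "v \<in> borel_measurable borel"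
  shows "fourier (\<lambda>t. cis (-(y * t)) * v t) s = fourier v (s + y)"
proof -
  have "cis (-(s * t)) * (cis (-(y * t)) * v t) = cis (-((s + y) * t)) * v t" for t
    by (simp add: cis_mult ring_distribs flip: mult.assoc)
  moreover have "(\<lambda>t. cis (-(y * t)) * v t) \<in> borel_measurable borel" by measurable
  ultimately show ?thesis by (simp only: fourier_cis[OF assms] fourier_cis)
qed

lemma fourier_affine:
  assumes [measurable]: "u \<in> borel_measurable borel" and d: "d > 0"
  shows "fourier (\<lambda>t. u ((t - b) / d)) x = of_real d * cis (-(x * b)) * fourier u (d * x)"
proof -
  have "fourier (\<lambda>t. u ((t - b) / d)) x = (LINT t|lborel. cis (-(x * t)) * u ((t - b) / d))"
    by (subst fourier_cis) auto
  also have "\<dots> = d *\<^sub>R (LINT t|lborel. cis (-(x * (b + d * t))) * u ((b + d * t - b) / d))"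
    using d by (subst lborel_integral_real_affine[where c=d and t=b]) auto
  also have "\<dots> = d *\<^sub>R (LINT t|lborel. cis (-(x*b)) * (cis (-(d * x * t)) * u t))"
  proof -
    have "cis (-(x * (b + d * t))) = cis (-(x*b)) * cis (-(d * x * t))" for t
      by (simp add: cis_mult algebra_simps)
    then show ?thesis using d by (simp add: mult.assoc)
  qed
  also have "\<dots> = of_real d * cis (-(x * b)) * fourier u (d * x)"
    by (simp add: fourier_cis scaleR_conv_of_real)
  finally show ?thesis .
qed

section \<open>Gaussian multipliers and their transforms, an approximate identity\<close>

definition gauss :: "nat \<Rightarrow> real \<Rightarrow> complex" where
  "gauss n t = of_real (exp (- (t / real (Suc n))\<^sup>2 / 2))"

text \<open>The transform of \<open>gauss n\<close>, written through the normal density so that its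
  total mass 2 pi is visible; it concentrates at 0 as \<open>n\<close> grows.\<close>

definition gauss_hat :: "nat \<Rightarrow> real \<Rightarrow> real" where
  "gauss_hat n x = 2 * pi * (real (Suc n) * std_normal_density (real (Suc n) * x))"

lemma gauss_measurable [measurable]: "gauss n \<in> borel_measurable borel"
  unfolding gauss_def by measurable

lemma gauss_hat_measurable [measurable]: "gauss_hat n \<in> borel_measurable borel"
  unfolding gauss_hat_def by measurable

lemma gauss_hat_nonneg: "gauss_hat n x \<ge> 0"
  unfolding gauss_hat_def by simp

lemma integrable_std_normal_density: "integrable lborel std_normal_density"
  using integrable_std_normal_moment[of 0] by simp

lemma integral_std_normal_density: "integral\<^sup>L lborel std_normal_density = 1"
  using integral_std_normal_moment_even[of 0] by simp

lemma integrable_gauss_hat: "integrable lborel (gauss_hat n)"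
  unfolding gauss_hat_def
  using lborel_integrable_real_affine[OF integrable_std_normal_density, of "Suc n" 0] by simp

text \<open>The substitution leaves a fixed density and moves the index into the argument of
  \<open>f\<close>, so for bounded \<open>f\<close> one dominating function serves for all
  \<open>n\<close>.\<close>

lemma integral_gauss_hat_mult:
  fixes f :: "real \<Rightarrow> 'a :: {banach, second_countable_topology}"
  shows "(LINT x|lborel. gauss_hat n x *\<^sub>R f x) =
         (2 * pi) *\<^sub>R (LINT x|lborel. std_normal_density x *\<^sub>R f (x / Suc n))"
proof -
  have "(LINT x|lborel. std_normal_density x *\<^sub>R f (x / Suc n)) =
      Suc n *\<^sub>R (LINT x|lborel. std_normal_density (Suc n * x) *\<^sub>R f x)"
    using lborel_integral_real_affine[where c="Suc n" and t=0 and f="\<lambda>x. std_normal_density x *\<^sub>R f (x / Suc n)"]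
    by (simp del: of_nat_Suc)
  then show ?thesis
    by (simp add: gauss_hat_def mult.assoc flip: scaleR_scaleR del: of_nat_Suc)
qed

lemma integral_gauss_hat: "(LINT x|lborel. gauss_hat n x) = 2 * pi"
  using integral_gauss_hat_mult[of n "\<lambda>_. 1::real"] integral_std_normal_density by simp

lemma integrable_gauss: "integrable lborel (gauss n)"
proof -
  have "gauss n t = of_real (sqrt (2 * pi) * std_normal_density (0 + 1 / Suc n * t))" for t
    by (simp add: gauss_def std_normal_density_def power_divide)
  moreover have "integrable lborel (\<lambda>t. complex_of_real (sqrt (2 * pi) * std_normal_density (0 + 1 / Suc n * t)))"
    by (intro integrable_of_real integrable_mult_right
        lborel_integrable_real_affine[OF integrable_std_normal_density]) auto
  ultimately show ?thesis by presburger
qed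

text \<open>After rescaling by the width \<open>c\<close>, the integral is the characteristic
  function of the standard normal law at \<open>- (c * x)\<close>.\<close>

lemma fourier_gauss: "fourier (gauss n) x = of_real (gauss_hat n x)"
proof -
  define c where "c = real (Suc n)"
  have c: "c > 0" by (simp add: c_def)
  have "char std_normal_distribution y = (LINT t|lborel. std_normal_density t *\<^sub>R cis (y * t))" for y
    unfolding char_def by (subst integral_density) (auto simp: cis_conv_exp)
  then have *: "(LINT t|lborel. std_normal_density t *\<^sub>R cis (y * t)) = of_real (exp (- (y\<^sup>2) / 2))" for y
    by (simp add: char_std_normal_distribution)
  have "fourier (gauss n) x = c *\<^sub>R (LINT t|lborel. cis (-(x * (0 + c * t))) * gauss n (0 + c * t))"
    using c by (subst fourier_cis, simp, subst lborel_integral_real_affine[where c=c and t=0]) auto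
  also have "(\<lambda>t. cis (-(x * (0 + c * t))) * gauss n (0 + c * t)) =
      (\<lambda>t. of_real (sqrt (2 * pi)) * (std_normal_density t *\<^sub>R cis ((- (c * x)) * t)))"
    using c by (auto simp: gauss_def std_normal_density_def scaleR_conv_of_real c_def[symmetric] fun_eq_iff mult_ac
        simp del: of_nat_Suc)
  also have "c *\<^sub>R (LINT t|lborel. \<dots> t) = of_real (c * sqrt (2 * pi) * exp (- (c * x)\<^sup>2 / 2))"
    by (subst integral_mult_right_zero, subst *) (simp add: scaleR_conv_of_real exp_of_real)
  also have "c * sqrt (2 * pi) * exp (- (c * x)\<^sup>2 / 2) = gauss_hat n x"
    by (simp add: gauss_hat_def std_normal_density_def c_def[symmetric] real_div_sqrt field_simps del: of_nat_Suc)
  finally show ?thesis .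
qed

lemma tendsto_gauss: "(\<lambda>n. gauss n t) \<longlonglongrightarrow> 1"
proof -
  have "(\<lambda>n. t / Suc n) \<longlonglongrightarrow> 0" by real_asymp
  then have "(\<lambda>n. of_real (exp (- (t / Suc n)\<^sup>2 / 2)) :: complex) \<longlonglongrightarrow> of_real (exp (- 0\<^sup>2 / 2))"
    by (intro tendsto_intros) auto
  then show ?thesis by (simp add: gauss_def)
qed

lemma norm_gauss_le: "norm (gauss n t) \<le> 1"
  by (simp add: gauss_def)

text \<open>Gaussian summability: against a Gaussian the multiplication formula moves the Fourier
  transform onto an approximate identity.\<close>

lemma fourier_inversion:
  assumes u: "integrable lborel u" "continuous_on UNIV u" "\<And>t. norm (u t) \<le> B"
    and "integrable lborel (fourier u)"
  shows "of_real (2 * pi) * u t = (LINT x|lborel. fourier u x * cis (x * t))"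
proof (rule LIMSEQ_unique)
  have [measurable]: "u \<in> borel_measurable borel" "fourier u \<in> borel_measurable borel"
    using u by auto
  define F where "F n = (LINT x|lborel. fourier u x * (cis (x * t) * gauss n x))" for n
  show "F \<longlonglongrightarrow> (LINT x|lborel. fourier u x * cis (x * t))" unfolding F_def
  proof (rule integral_dominated_convergence[where w="\<lambda>x. norm (fourier u x)"])
    have "(\<lambda>n. fourier u x * (cis (x * t) * gauss n x)) \<longlonglongrightarrow> fourier u x * (cis (x * t) * 1)" for x
      by (intro tendsto_intros tendsto_gauss)
    then show "AE x in lborel. (\<lambda>n. fourier u x * (cis (x * t) * gauss n x)) \<longlonglongrightarrow> fourier u x * cis (x * t)"
      by simp
    show "AE x in lborel. norm (fourier u x * (cis (x * t) * gauss n x)) \<le> norm (fourier u x)" for n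
      using norm_gauss_le[of n] by (auto simp: norm_mult intro!: mult_left_le)
  qed (use assms in auto)
  have F: "F n = of_real (2 * pi) * (LINT x|lborel. std_normal_density x *\<^sub>R u (x / Suc n + t))" for n
  proof -
    have "F n = (LINT x|lborel. u x * fourier (\<lambda>x. cis (x * t) * gauss n x) x)"
      unfolding F_def using assms
      by (intro integral_fourier_mult integrable_cis_mult integrable_gauss) auto
    also have "(\<lambda>x. fourier (\<lambda>x. cis (x * t) * gauss n x) x) = (\<lambda>x. gauss_hat n (x - t))"
      using fourier_cis_mult[of "gauss n" "-t"] by (simp add: fourier_gauss mult.commute fun_eq_iff)
    then have "fourier (\<lambda>x. cis (x * t) * gauss n x) = (\<lambda>x. gauss_hat n (x - t))" by simp
    then have "(LINT x|lborel. u x * fourier (\<lambda>x. cis (x * t) * gauss n x) x)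
        = (LINT x|lborel. gauss_hat n (x - t) *\<^sub>R u x)"
      by (simp add: scaleR_conv_of_real mult.commute)
    also have "\<dots> = (LINT x|lborel. gauss_hat n x *\<^sub>R u (x + t))"
      using integral_lborel_translate[of "\<lambda>x. gauss_hat n (x - t) *\<^sub>R u x" t] by simp
    also have "\<dots> = (2 * pi) *\<^sub>R (LINT x|lborel. std_normal_density x *\<^sub>R u (x / Suc n + t))"
      by (rule integral_gauss_hat_mult)
    finally show ?thesis
      by (simp add: scaleR_conv_of_real)
  qed
  have "(\<lambda>n. LINT x|lborel. std_normal_density x *\<^sub>R u (x / Suc n + t)) \<longlonglongrightarrow>
      (LINT x|lborel. std_normal_density x *\<^sub>R u t)"
  proof (rule integral_dominated_convergence[where w="\<lambda>x. std_normal_density x * B"])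
    have "(\<lambda>n. std_normal_density x *\<^sub>R u (x / Suc n + t)) \<longlonglongrightarrow> std_normal_density x *\<^sub>R u t" for x
    proof -
      have "(\<lambda>n. x / Suc n + t) \<longlonglongrightarrow> t" by real_asymp
      moreover have "isCont u t" using u(2) by (simp add: continuous_on_eq_continuous_at)
      ultimately show ?thesis by (intro tendsto_intros) (rule isCont_tendsto_compose)
    qed
    then show "AE x in lborel. (\<lambda>n. std_normal_density x *\<^sub>R u (x / Suc n + t)) \<longlonglongrightarrow> std_normal_density x *\<^sub>R u t"
      by simp
    show "AE x in lborel. norm (std_normal_density x *\<^sub>R u (x / Suc n + t)) \<le> std_normal_density x * B" for n
      using u(3) by (auto intro!: mult_left_mono)
  qed (use integrable_std_normal_density in auto)
  also have "(LINT x|lborel. std_normal_density x *\<^sub>R u t) = u t"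
    using integrable_std_normal_density by (simp add: integral_std_normal_density)
  finally show "F \<longlonglongrightarrow> of_real (2 * pi) * u t"
    unfolding F by (intro tendsto_intros)
qed

text \<open>This is the multiplication formula for \<open>g\<close> and the modulated function
  \<open>cis (- (y * t)) * v t\<close>, whose transform is a translate of
  \<open>fourier v\<close>.\<close>

lemma fourier_mult_fourier:
  assumes "integrable lborel g" "integrable lborel v"
  shows "fourier (\<lambda>t. fourier g t * v t) y = (LINT s|lborel. g s * fourier v (y + s))"
proof -
  have [measurable]: "g \<in> borel_measurable borel" "v \<in> borel_measurable borel" using assms by auto
  have "fourier (\<lambda>t. fourier g t * v t) y = (LINT t|lborel. fourier g t * (cis (- (y * t)) * v t))"
    using assms by (subst fourier_cis) (auto simp: ac_simps)
  also have "\<dots> = (LINT s|lborel. g s * fourier (\<lambda>t. cis (- (y * t)) * v t) s)"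
    using assms by (intro integral_fourier_mult integrable_cis_mult) auto
  finally show ?thesis by (simp add: fourier_cis_mult add.commute)
qed

text \<open>\<open>\<integral> f s * K (y + s) ds\<close> is the convolution of \<open>K\<close> with the reflection of \<open>f\<close>.\<close>

lemma integrable_convolution:
  fixes f K :: "real \<Rightarrow> complex"
  assumes "integrable lborel f" "integrable lborel K"
  shows "integrable lborel (\<lambda>y. LINT s|lborel. f s * K (y + s))"
    and "(LINT y|lborel. norm (LINT s|lborel. f s * K (y + s)))
         \<le> (LINT s|lborel. norm (f s)) * (LINT y|lborel. norm (K y))"
proof -
  have [measurable]: "f \<in> borel_measurable borel" "K \<in> borel_measurable borel" using assms by auto
  note i = integrable_prod_translate[OF assms]
  show *: "integrable lborel (\<lambda>y. LINT s|lborel. f s * K (y + s))"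
    using lborel_pair.integrable_snd[OF i] .
  have i2: "integrable (lborel \<Otimes>\<^sub>M lborel) (\<lambda>(s, y). norm (f s) * norm (K (y + s)))"
    by (intro integrable_prod_translate integrable_norm assms)
  have "(LINT y|lborel. norm (LINT s|lborel. f s * K (y + s)))
      \<le> (LINT y|lborel. LINT s|lborel. norm (f s) * norm (K (y + s)))"
  proof (rule integral_mono)
    show "integrable lborel (\<lambda>y. LINT s|lborel. norm (f s) * norm (K (y + s)))"
      using lborel_pair.integrable_snd[OF i2] .
    show "norm (LINT s|lborel. f s * K (y + s)) \<le> (LINT s|lborel. norm (f s) * norm (K (y + s)))" for y
      by (rule order_trans[OF integral_norm_bound]) (simp add: norm_mult)
  qed (use * in auto)
  also have "\<dots> = (LINT s|lborel. LINT y|lborel. norm (f s) * norm (K (y + s)))"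
    by (rule lborel_pair.Fubini_integral[OF i2])
  also have "\<dots> = (LINT s|lborel. norm (f s)) * (LINT y|lborel. norm (K y))"
    by (simp add: integral_lborel_translate[of "\<lambda>y. norm (K y)"])
  finally show "(LINT y|lborel. norm (LINT s|lborel. f s * K (y + s)))
         \<le> (LINT s|lborel. norm (f s)) * (LINT y|lborel. norm (K y))" .
qed

text \<open>As an L1 class the double transform is a reflected multiple of \<open>g\<close>, but
  \<open>g\<close> need be neither continuous nor bounded, so \<open>fourier_inversion\<close>
  cannot be applied to it. The Gaussian means \<open>F n\<close> are convolutions of
  \<open>g\<close> with \<open>gauss_hat n\<close>, so their L1 norms stay below \<open>B\<close>;
  they converge pointwise to the double transform, and Fatou's lemma carries the bound over.\<close>

lemma integrable_fourier_fourier: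
  assumes g: "integrable lborel g" and i: "integrable lborel (fourier g)"
  shows "integrable lborel (fourier (fourier g))"
proof (rule integrableI_bounded)
  have [measurable]: "g \<in> borel_measurable borel" "fourier g \<in> borel_measurable borel"
    using assms by auto
  show "fourier (fourier g) \<in> borel_measurable lborel" using i by auto
  define F where "F n y = (LINT s|lborel. g s * of_real (gauss_hat n (y + s)))" for n y
  define B where "B = (LINT s|lborel. norm (g s)) * (2 * pi)"
  have F: "F n y = fourier (\<lambda>t. fourier g t * gauss n t) y" for n y
    unfolding F_def using fourier_mult_fourier[OF g integrable_gauss, of n y]
    by (simp add: fourier_gauss)
  have ig: "integrable lborel (\<lambda>y. complex_of_real (gauss_hat n y))" for n
    by (intro integrable_of_real integrable_gauss_hat)
  have int: "integrable lborel (F n)" and le: "(LINT y|lborel. norm (F n y)) \<le> B" for n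
    using integrable_convolution[OF g ig, of n] gauss_hat_nonneg[of n]
    unfolding F_def B_def by (auto simp: integral_gauss_hat)
  have nn: "(\<integral>\<^sup>+y. norm (F n y) \<partial>lborel) \<le> ennreal B" for n
    using int[of n] le[of n] by (subst nn_integral_eq_integral) (auto intro: ennreal_leI)
  have [measurable]: "F n \<in> borel_measurable borel" for n using int[of n] by auto
  have lim: "(\<lambda>n. F n y) \<longlonglongrightarrow> fourier (fourier g) y" for y
  proof -
    have "(\<lambda>n. LINT t|lborel. cis (-(y * t)) * (fourier g t * gauss n t)) \<longlonglongrightarrow>
        (LINT t|lborel. cis (-(y * t)) * fourier g t)"
    proof (rule integral_dominated_convergence[where w="\<lambda>x. norm (fourier g x)"])
      have "(\<lambda>n. cis (-(y * x)) * (fourier g x * gauss n x)) \<longlonglongrightarrow> cis (-(y * x)) * (fourier g x * 1)" for x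
        by (intro tendsto_intros tendsto_gauss)
      then show "AE x in lborel. (\<lambda>n. cis (-(y * x)) * (fourier g x * gauss n x)) \<longlonglongrightarrow> cis (-(y * x)) * fourier g x"
        by simp
      show "AE x in lborel. norm (cis (-(y * x)) * (fourier g x * gauss n x)) \<le> norm (fourier g x)" for n
        using norm_gauss_le[of n] by (auto simp: norm_mult intro!: mult_left_le)
    qed (use i in auto)
    then show ?thesis unfolding F by (simp add: fourier_cis)
  qed
  have "(\<integral>\<^sup>+y. norm (fourier (fourier g) y) \<partial>lborel) = (\<integral>\<^sup>+y. liminf (\<lambda>n. ennreal (norm (F n y))) \<partial>lborel)"
    by (intro nn_integral_cong lim_imp_Liminf[symmetric] tendsto_intros lim) auto
  also have "\<dots> \<le> liminf (\<lambda>n. \<integral>\<^sup>+y. norm (F n y) \<partial>lborel)"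
    by (rule nn_integral_liminf) auto
  also have "\<dots> \<le> ennreal B"
    using nn by (intro Liminf_le always_eventually allI) auto
  finally show "(\<integral>\<^sup>+y. norm (fourier (fourier g) y) \<partial>lborel) < \<infinity>"
    by (rule le_less_trans) simp
qed

text \<open>Continuity of \<open>f\<close> gives pointwise convergence of the translates and
  translation invariance gives equal norms, so Scheffe's lemma yields convergence in L1.\<close>

lemma tendsto_L1_translate:
  fixes f :: "real \<Rightarrow> complex"
  assumes f: "integrable lborel f" "continuous_on UNIV f"
  shows "((\<lambda>z. LINT x|lborel. norm (f (x + z) - f x)) \<longlongrightarrow> 0) (at 0)"
proof (subst tendsto_at_iff_sequentially, intro allI impI)
  fix Z :: "nat \<Rightarrow> real" assume "Z \<longlonglongrightarrow> 0"
  have [measurable]: "f \<in> borel_measurable borel" using f by auto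
  have int: "integrable lborel (\<lambda>x. f (x + z))" for z by (simp add: integrable_lborel_translate f)
  have "(\<lambda>n. \<integral>\<^sup>+x. norm (f (x + Z n) - f x) \<partial>lborel) \<longlonglongrightarrow> 0"
  proof (rule Scheffe_lemma2)
    have "(\<lambda>n. f (x + Z n)) \<longlonglongrightarrow> f (x + 0)" for x
      by (rule isCont_tendsto_compose[of _ f])
         (use f in \<open>auto intro!: tendsto_add[OF tendsto_const \<open>Z \<longlonglongrightarrow> 0\<close>, of x, simplified]
           simp: continuous_on_eq_continuous_at\<close>)
    then show "AE x in lborel. (\<lambda>n. f (x + Z n)) \<longlonglongrightarrow> f x" by simp
    show "(\<integral>\<^sup>+ x. ennreal (norm (f (x + Z n))) \<partial>lborel) \<le> (\<integral>\<^sup>+ x. ennreal (norm (f x)) \<partial>lborel)" for n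
      using f int[of "Z n"]
      by (subst (1 2) nn_integral_eq_integral) (auto simp: integral_lborel_translate[of "\<lambda>y. norm (f y)"])
  qed (use f in auto)
  moreover have "(\<integral>\<^sup>+x. norm (f (x + z) - f x) \<partial>lborel) = ennreal (LINT x|lborel. norm (f (x + z) - f x))" for z
    using f int[of z] by (intro nn_integral_eq_integral) auto
  ultimately have "(\<lambda>n. ennreal (LINT x|lborel. norm (f (x + Z n) - f x))) \<longlonglongrightarrow> ennreal 0" by simp
  then show "((\<lambda>z. LINT x|lborel. norm (f (x + z) - f x)) \<circ> Z) \<longlonglongrightarrow> 0"
    unfolding comp_def by (subst (asm) tendsto_ennreal_iff) auto
qed

text \<open>Riemann--Lebesgue: translating the variable by \<open>\<pi> / x\<close> flips the sign of \<open>exp (- i x t)\<close>.\<close>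

lemma fourier_tendsto_0_at_bot:
  assumes f: "integrable lborel f" "continuous_on UNIV f"
  shows "(fourier f \<longlongrightarrow> 0) at_bot"
proof -
  have [measurable]: "f \<in> borel_measurable borel" using f by auto
  have int: "integrable lborel (\<lambda>x. f (x + z))" for z by (simp add: integrable_lborel_translate f)
  have le: "norm (fourier f x) \<le> (LINT t|lborel. norm (f (t + pi / x) - f t))" if "x < 0" for x
  proof -
    have "fourier f x = (LINT t|lborel. cis (-(x * (t + pi / x))) * f (t + pi / x))"
      using integral_lborel_translate[of "\<lambda>t. cis (-(x * t)) * f t" "pi / x"] by (simp add: fourier_cis)
    also have "\<dots> = - (LINT t|lborel. cis (-(x * t)) * f (t + pi / x))"
    proof -
      have "cis (-(x * (t + pi / x))) = - cis (-(x * t))" for t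
      proof -
        have "-(x * (t + pi / x)) = -(x * t) + - pi" using that by (simp add: field_simps)
        moreover have "cis (-(x * t) + - pi) = cis (-(x * t)) * cis (- pi)" by (rule cis_mult[symmetric])
        moreover have "cis (- pi) = -1" by (simp add: complex_eq_iff)
        ultimately show ?thesis by simp
      qed
      then show ?thesis by simp
    qed
    finally have "2 * fourier f x = (LINT t|lborel. cis (-(x * t)) * f t) - (LINT t|lborel. cis (-(x * t)) * f (t + pi / x))"
      by (simp add: fourier_cis)
    also have "\<dots> = (LINT t|lborel. cis (-(x * t)) * (f t - f (t + pi / x)))"
      using f(1) int[of "pi / x"]
      by (subst Bochner_Integration.integral_diff[symmetric])
         (auto intro!: integrable_cis_mult simp: right_diff_distrib)
    finally have "norm (2 * fourier f x) \<le> (LINT t|lborel. norm (f (t + pi / x) - f t))"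
      by (metis (no_types, lifting) integral_norm_bound norm_mult norm_cis mult_1 norm_minus_commute Bochner_Integration.integral_cong)
    then show ?thesis using norm_ge_zero[of "fourier f x"] unfolding norm_mult norm_numeral by linarith
  qed
  have "((\<lambda>x. LINT t|lborel. norm (f (t + pi / x) - f t)) \<longlongrightarrow> 0) at_bot"
  proof (rule filterlim_compose[OF tendsto_L1_translate[OF f]])
    show "LIM x at_bot. pi / x :> at 0" by real_asymp
  qed
  then show ?thesis
    by (rule Lim_null_comparison[rotated]) (use le eventually_gt_at_bot in \<open>auto simp: eventually_at_bot_linorder intro!: exI[of _ "-1"]\<close>)
qed

section \<open>Compactly supported functions with integrable transform\<close>

text \<open>Compactly supported members of the Wiener algebra, described by their own transform
  instead of a preimage. Inversion recovers the preimage, and \<open>wiener_algebra_c_subset\<close>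
  shows that every member of A_c has this form.\<close>

definition window_class :: "(real \<Rightarrow> complex) set" where
  "window_class = {u. continuous_on UNIV u \<and> (\<exists>B. \<forall>t. B < \<bar>t\<bar> \<longrightarrow> u t = 0) \<and>
     integrable lborel (fourier u)}"

text \<open>2 pi times the norm of \<open>u\<close> in the Wiener algebra, that is, the L1 norm of
  the preimage.\<close>

definition mass :: "(real \<Rightarrow> complex) \<Rightarrow> real" where
  "mass u = (LINT x|lborel. norm (fourier u x))"

lemma mass_nonneg: "mass u \<ge> 0"
  unfolding mass_def by simp

lemma window_classD:
  assumes "u \<in> window_class"
  shows "continuous_on UNIV u" "integrable lborel (fourier u)" "u \<in> borel_measurable borel"
    "integrable lborel u" "\<exists>C. \<forall>t. norm (u t) \<le> C" "\<exists>B\<ge>0. \<forall>t. B < \<bar>t\<bar> \<longrightarrow> u t = 0"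
proof -
  show c: "continuous_on UNIV u" and "integrable lborel (fourier u)"
    using assms by (auto simp: window_class_def)
  show "u \<in> borel_measurable borel" using c by (rule borel_measurable_continuous_onI)
  obtain B where B: "\<And>t. B < \<bar>t\<bar> \<Longrightarrow> u t = 0" using assms by (auto simp: window_class_def)
  show "\<exists>B\<ge>0. \<forall>t. B < \<bar>t\<bar> \<longrightarrow> u t = 0" using B by (intro exI[of _ "max B 0"]) auto
  have "set_integrable lborel {-B..B} u"
    by (rule borel_integrable_atLeastAtMost') (use c in \<open>auto intro: continuous_on_subset\<close>)
  moreover have "(\<lambda>x. indicator {-B..B} x *\<^sub>R u x) = u" using B by (fastforce simp: indicator_def)
  ultimately show "integrable lborel u" unfolding set_integrable_def by simp
  have "compact (u ` {-B..B})" by (rule compact_continuous_image) (use c in \<open>auto intro: continuous_on_subset\<close>)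
  then obtain C where "\<And>t. t \<in> {-B..B} \<Longrightarrow> norm (u t) \<le> C"
    using compact_imp_bounded bounded_iff by (metis (no_types, lifting) imageI)
  then show "\<exists>C. \<forall>t. norm (u t) \<le> C"
    using B by (intro exI[of _ "max C 0"]) (metis abs_le_iff atLeastAtMost_iff max.cobounded1 max.cobounded2 minus_le_iff norm_zero not_le order_trans)
qed

lemma fourier_add:
  assumes "integrable lborel u" "integrable lborel v"
  shows "fourier (\<lambda>t. u t + v t) x = fourier u x + fourier v x"
proof -
  have [measurable]: "u \<in> borel_measurable borel" "v \<in> borel_measurable borel" using assms by auto
  show ?thesis using assms by (simp add: fourier_cis ring_distribs integrable_cis_mult)
qed

lemma fourier_cmult:
  assumes [measurable]: "u \<in> borel_measurable borel"
  shows "fourier (\<lambda>t. c * u t) x = c * fourier u x"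
proof -
  have "cis (-(x * t)) * (c * u t) = c * (cis (-(x * t)) * u t)" for t by simp
  then show ?thesis by (simp only: fourier_cis assms borel_measurable_times borel_measurable_const
        integral_mult_right_zero)
qed

lemma window_class_add:
  assumes "u \<in> window_class" "v \<in> window_class"
  shows "(\<lambda>t. u t + v t) \<in> window_class"
proof -
  obtain B C where "\<And>t. B < \<bar>t\<bar> \<Longrightarrow> u t = 0" "\<And>t. C < \<bar>t\<bar> \<Longrightarrow> v t = 0"
    using assms by (auto simp: window_class_def)
  then have "\<exists>B. \<forall>t. B < \<bar>t\<bar> \<longrightarrow> u t + v t = 0" by (intro exI[of _ "max B C"]) auto
  moreover have "fourier (\<lambda>t. u t + v t) = (\<lambda>x. fourier u x + fourier v x)"
    using fourier_add window_classD(4) assms by blast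
  ultimately show ?thesis using assms by (auto simp: window_class_def intro!: continuous_intros)
qed

lemma window_class_cmult:
  assumes "u \<in> window_class"
  shows "(\<lambda>t. c * u t) \<in> window_class"
proof -
  have "fourier (\<lambda>t. c * u t) = (\<lambda>x. c * fourier u x)"
    using fourier_cmult window_classD(3) assms by blast
  then show ?thesis using assms by (auto simp: window_class_def intro!: continuous_intros)
qed

lemma window_class_zero: "(\<lambda>_. 0) \<in> window_class"
proof -
  have "fourier (\<lambda>_. 0) = (\<lambda>_. 0)" by (simp add: fourier_def fun_eq_iff)
  then show ?thesis by (auto simp: window_class_def)
qed

lemma window_class_sum:
  assumes "\<And>i. i \<in> I \<Longrightarrow> u i \<in> window_class"
  shows "(\<lambda>t. \<Sum>i\<in>I. u i t) \<in> window_class"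
  using assms by (induction I rule: infinite_finite_induct) (auto intro!: window_class_zero window_class_add)

lemma window_class_affine:
  assumes u: "u \<in> window_class" and d: "d > 0"
  shows "(\<lambda>t. u ((t - b) / d)) \<in> window_class"
proof -
  note D = window_classD[OF u]
  obtain B where B: "\<And>t. B < \<bar>t\<bar> \<Longrightarrow> u t = 0" using u by (auto simp: window_class_def)
  have "\<forall>t. d * B + \<bar>b\<bar> < \<bar>t\<bar> \<longrightarrow> u ((t - b) / d) = 0"
  proof (intro allI impI B)
    fix t :: real assume "d * B + \<bar>b\<bar> < \<bar>t\<bar>"
    then have "d * B < \<bar>t - b\<bar>" by linarith
    then show "B < \<bar>(t - b) / d\<bar>" using d by (simp add: abs_divide pos_less_divide_eq mult.commute)
  qed
  moreover have "continuous_on UNIV (\<lambda>t. u ((t - b) / d))"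
    using d by (intro continuous_on_compose2[OF D(1)] continuous_intros) auto
  moreover have "integrable lborel (fourier (\<lambda>t. u ((t - b) / d)))"
  proof -
    have "integrable lborel (\<lambda>x. cis (-(x * b)) * fourier u (0 + d * x))"
      using d by (intro integrable_cis_mult lborel_integrable_real_affine D(2)) auto
    then have "integrable lborel (\<lambda>x. of_real d * (cis (-(x * b)) * fourier u (0 + d * x)))"
      by (rule integrable_mult_right)
    moreover have "fourier (\<lambda>t. u ((t - b) / d)) = (\<lambda>x. of_real d * (cis (-(x * b)) * fourier u (0 + d * x)))"
      using fourier_affine[OF D(3) d, of b] by (auto simp: mult.assoc)
    ultimately show ?thesis by simp
  qed
  ultimately show ?thesis by (auto simp: window_class_def)
qed

text \<open>By inversion the reflected transform divided by 2 pi is a preimage.\<close>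

lemma window_class_imp_fourier:
  assumes u: "u \<in> window_class"
  obtains g where "integrable lborel g" "u = fourier g" "(LINT s|lborel. norm (g s)) = mass u / (2 * pi)"
proof
  note D = window_classD[OF u]
  let ?g = "\<lambda>x. fourier u (0 + - 1 * x) / of_real (2 * pi)"
  have [measurable]: "fourier u \<in> borel_measurable borel" using D(2) by auto
  show i: "integrable lborel ?g"
    by (intro integrable_divide lborel_integrable_real_affine D(2)) auto
  show "(LINT s|lborel. norm (?g s)) = mass u / (2 * pi)"
    unfolding mass_def
    by (subst lborel_integral_real_affine[where c="-1" and t=0]) (auto simp: norm_divide)
  show "u = fourier ?g"
  proof
    fix t
    obtain C where C: "\<And>t. norm (u t) \<le> C" using D(5) by blast
    have "fourier ?g t = (LINT x|lborel. cis (- (t * x)) * ?g x)" by (rule fourier_cis) simp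
    also have "\<dots> = (LINT x|lborel. fourier u x * cis (x * t) / of_real (2 * pi))"
      by (subst lborel_integral_real_affine[where c="-1" and t=0]) (auto simp: ac_simps)
    also have "\<dots> = (LINT x|lborel. fourier u x * cis (x * t)) / of_real (2 * pi)"
      by (rule integral_divide_zero)
    also have "\<dots> = u t"
      by (subst fourier_inversion[OF D(4) D(1) C D(2), symmetric]) auto
    finally show "u t = fourier ?g t" by simp
  qed
qed

text \<open>The preimage in the definition of the algebra is only Lebesgue measurable. Changing its
  real and imaginary parts on a null set makes it Borel and leaves the transform unchanged at every
  point.\<close>

lemma wiener_algebraE:
  assumes "\<phi> \<in> wiener_algebra"
  obtains g where "integrable lborel g" "\<phi> = fourier g"
proof -
  obtain f where f: "integrable lebesgue f" "\<phi> = fourier f" using assms by (auto simp: wiener_algebra_def)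
  have [measurable]: "f \<in> borel_measurable lebesgue" using f by auto
  have "(\<lambda>x. Re (f x)) \<in> borel_measurable lebesgue" "(\<lambda>x. Im (f x)) \<in> borel_measurable lebesgue"
    by measurable
  then obtain p q where [measurable]: "p \<in> borel_measurable borel" "q \<in> borel_measurable borel"
    and pq: "AE x in lborel. Re (f x) = p x" "AE x in lborel. Im (f x) = q x"
    using completion_ex_borel_measurable_real[of "\<lambda>x. Re (f x)" lborel]
      completion_ex_borel_measurable_real[of "\<lambda>x. Im (f x)" lborel] by auto
  define g where "g x = Complex (p x) (q x)" for x
  have g: "g = (\<lambda>x. of_real (p x) + \<i> * of_real (q x))" by (auto simp: g_def complex_eq_iff)
  have [measurable]: "g \<in> borel_measurable borel" unfolding g by measurable
  have "AE x in lborel. f x = g x" using pq by eventually_elim (simp add: g_def complex_eq_iff)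
  then have ae: "AE x in lebesgue. f x = g x" by (rule AE_completion)
  have [measurable]: "g \<in> borel_measurable lebesgue" by (rule measurable_completion) simp
  have "integrable lebesgue g" using f(1) by (rule integrable_cong_AE_imp) (use ae in auto)
  then have "integrable lborel g" by (subst (asm) integrable_completion) auto
  moreover have "fourier f x = fourier g x" for x
  proof -
    have [measurable]: "(\<lambda>t. exp (- (\<i> * of_real (x * t)))) \<in> borel_measurable lebesgue"
      by (rule measurable_completion) simp
    show ?thesis
      unfolding fourier_def
    proof (rule integral_cong_AE)
      show "AE t in lebesgue. exp (- (\<i> * of_real (x * t))) * f t = exp (- (\<i> * of_real (x * t))) * g t"
        using ae by eventually_elim simp
    qed measurable
  qed
  then have "fourier f = fourier g" by (rule ext)
  ultimately show thesis using that f by simp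
qed

text \<open>Together with continuity, compact support makes \<phi> itself integrable; then
  \<open>integrable_fourier_fourier\<close> applies to its preimage.\<close>

lemma wiener_algebra_c_subset: "wiener_algebra_c \<subseteq> window_class"
proof
  fix \<phi> assume \<phi>: "\<phi> \<in> wiener_algebra_c"
  then obtain g where g: "integrable lborel g" "\<phi> = fourier g"
    using wiener_algebraE by (auto simp: wiener_algebra_c_def)
  have "bounded {t. \<phi> t \<noteq> 0}"
    using \<phi> compact_imp_bounded bounded_subset closure_subset by (fastforce simp: wiener_algebra_c_def)
  then obtain B where B: "\<And>t. \<phi> t \<noteq> 0 \<Longrightarrow> \<bar>t\<bar> \<le> B" by (auto simp: bounded_iff)
  have c: "continuous_on UNIV \<phi>" using g continuous_fourier by simp
  have "set_integrable lborel {-B..B} \<phi>"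
    by (rule borel_integrable_atLeastAtMost') (use c in \<open>auto intro: continuous_on_subset\<close>)
  moreover have "(\<lambda>x. indicator {-B..B} x *\<^sub>R \<phi> x) = \<phi>" using B by (fastforce simp: indicator_def)
  ultimately have "integrable lborel \<phi>" unfolding set_integrable_def by simp
  then have "integrable lborel (fourier \<phi>)" using integrable_fourier_fourier g by simp
  moreover have "\<exists>B. \<forall>t. B < \<bar>t\<bar> \<longrightarrow> \<phi> t = 0" using B not_le by blast
  ultimately show "\<phi> \<in> window_class" using c unfolding window_class_def by simp
qed

text \<open>On the transform side the product is a convolution, so the bound is Young's inequality
  in L1.\<close>

lemma window_class_mult_fourier:
  assumes g: "integrable lborel g" and u: "u \<in> window_class"
  shows "(\<lambda>t. fourier g t * u t) \<in> window_class"
    and "mass (\<lambda>t. fourier g t * u t) \<le> (LINT s|lborel. norm (g s)) * mass u"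
proof -
  note D = window_classD[OF u]
  have eq: "fourier (\<lambda>t. fourier g t * u t) = (\<lambda>y. LINT s|lborel. g s * fourier u (y + s))"
    using fourier_mult_fourier[OF g D(4)] by blast
  obtain B where B: "\<And>t. B < \<bar>t\<bar> \<Longrightarrow> u t = 0" using u by (auto simp: window_class_def)
  show "(\<lambda>t. fourier g t * u t) \<in> window_class"
    unfolding window_class_def using B integrable_convolution(1)[OF g D(2)]
    by (auto simp: eq intro!: continuous_intros continuous_fourier g D(1))
  show "mass (\<lambda>t. fourier g t * u t) \<le> (LINT s|lborel. norm (g s)) * mass u"
    using integrable_convolution(2)[OF g D(2)] by (simp add: mass_def eq)
qed

text \<open>Inversion turns the first factor into a transform, which brings in the 1 / (2 pi); with
  mass divided by 2 pi this is submultiplicativity of the algebra norm.\<close>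

lemma window_class_mult:
  assumes "u \<in> window_class" "v \<in> window_class"
  shows "(\<lambda>t. u t * v t) \<in> window_class" "mass (\<lambda>t. u t * v t) \<le> mass u / (2 * pi) * mass v"
  using window_class_imp_fourier[OF assms(1)] window_class_mult_fourier[OF _ assms(2)] by metis+

section \<open>The triangle function: non-negative transform, partitions of unity, plateaus\<close>

definition triangle :: "real \<Rightarrow> complex" where
  "triangle t = of_real (max 0 (1 - \<bar>t\<bar>))"

lemma triangle_eq_0: "\<bar>t\<bar> \<ge> 1 \<Longrightarrow> triangle t = 0"
  by (simp add: triangle_def)

lemma continuous_triangle: "continuous_on A triangle"
  unfolding triangle_def by (intro continuous_intros)

lemma integrable_triangle: "integrable lborel triangle"
proof -
  have "set_integrable lborel {-1..1} triangle"
    by (rule borel_integrable_atLeastAtMost') (rule continuous_triangle)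
  moreover have "(\<lambda>x. indicator {-1..1} x *\<^sub>R triangle x) = triangle"
    by (auto simp: triangle_def fun_eq_iff indicator_def)
  ultimately show ?thesis unfolding set_integrable_def by simp
qed

lemma fourier_triangle:
  assumes "x \<noteq> 0"
  shows "fourier triangle x = of_real (2 * (1 - cos x) / x\<^sup>2)"
proof -
  have [measurable]: "triangle \<in> borel_measurable borel" using integrable_triangle by auto
  define f where "f t = cis (-(x * t)) * triangle t" for t
  define E where "E z = exp (- (\<i> * of_real x * z))" for z :: complex
  have E: "E (of_real t) = cis (-(x * t))" for t by (simp add: E_def cis_conv_exp mult.assoc)
  have E': "(E has_field_derivative - (\<i> * of_real x) * E z) (at z within A)" for z A
    unfolding E_def by (auto intro!: derivative_eq_intros)
  \<comment> \<open>One primitive serves both halves: the triangle is 1 - s t with s = 1 on [0, 1]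
    and s = -1 on [-1, 0], and integration by parts gives \<open>G s\<close>.\<close>
  define G where "G s z = (1 - of_real s * z) * E z * \<i> / of_real x - of_real s * E z / (of_real x)\<^sup>2" for s z
  have G: "(G s has_field_derivative ((1 - of_real s * z) * E z)) (at z within A)" for s z A
    unfolding G_def using assms
    by (auto intro!: derivative_eq_intros E' simp: field_simps power2_eq_square)
  define F where "F s t = (1 - s * t) * cis (-(x * t)) * \<i> / x - s * cis (-(x * t)) / x\<^sup>2" for s t :: real
  have F: "(F s has_vector_derivative ((1 - s * t) * cis (-(x * t)))) (at t within A)" for s t A
    using has_vector_derivative_real_field[OF G, of s t A] by (simp add: F_def[abs_def] G_def E)
  have 1: "has_bochner_integral lborel (\<lambda>t. indicator {0..1} t *\<^sub>R ((1 - 1 * t) * cis (-(x * t)))) (F 1 1 - F 1 0)"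
    by (rule has_bochner_integral_FTC_Icc) (use F[of 1] in \<open>auto intro!: continuous_intros\<close>)
  have 2: "has_bochner_integral lborel (\<lambda>t. indicator {-1..0} t *\<^sub>R ((1 - (-1) * t) * cis (-(x * t)))) (F (-1) 0 - F (-1) (-1))"
    by (rule has_bochner_integral_FTC_Icc) (use F[of "-1"] in \<open>auto intro!: continuous_intros\<close>)
  \<comment> \<open>The point 0 lies in both closed intervals, so the two pieces add up to
    \<open>f\<close> only off this null set.\<close>
  have "AE t in lborel. t \<noteq> (0::real)" by (rule AE_lborel_singleton)
  then have ae: "AE t in lborel. f t = indicator {0..1} t *\<^sub>R ((1 - 1 * t) * cis (-(x * t))) + indicator {-1..0} t *\<^sub>R ((1 - (-1) * t) * cis (-(x * t)))"
    by eventually_elim (auto simp: f_def indicator_def triangle_def max_def)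
  have "fourier triangle x = (LINT t|lborel. f t)" by (simp add: fourier_cis f_def)
  also have "\<dots> = (F 1 1 - F 1 0) + (F (-1) 0 - F (-1) (-1))"
  proof -
    have "f \<in> borel_measurable borel" unfolding f_def by measurable
    then show ?thesis
      using has_bochner_integral_integral_eq[OF has_bochner_integral_add[OF 1 2]]
      by (subst integral_cong_AE[OF _ _ ae]) simp_all
  qed
  also have "\<dots> = of_real (2 * (1 - cos x) / x\<^sup>2)"
    using assms
    by (simp add: F_def complex_eq_iff Re_divide_of_real Im_divide_of_real power2_eq_square field_simps)
  finally show ?thesis .
qed

lemma fourier_triangle_nonneg: "fourier triangle x = of_real (Re (fourier triangle x))" "Re (fourier triangle x) \<ge> 0"
proof -
  have [measurable]: "triangle \<in> borel_measurable borel" using integrable_triangle by auto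
  \<comment> \<open>At 0 the closed formula divides by 0, so the value is taken from the integral
    itself.\<close>
  have "fourier triangle 0 = of_real (LINT t|lborel. max 0 (1 - \<bar>t\<bar>))"
    by (simp add: fourier_cis) (simp add: triangle_def)
  then have "fourier triangle 0 = of_real (Re (fourier triangle 0)) \<and> Re (fourier triangle 0) \<ge> 0"
    by simp
  then show "fourier triangle x = of_real (Re (fourier triangle x))" "Re (fourier triangle x) \<ge> 0"
    using fourier_triangle[of x] by (cases "x = 0"; simp)+
qed

lemma triangle_window: "triangle \<in> window_class"
proof -
  have [measurable]: "fourier triangle \<in> borel_measurable borel" "triangle \<in> borel_measurable borel"
    using integrable_triangle by auto
  define C where "C = (LINT t|lborel. norm (triangle t))"
  have C: "norm (fourier triangle x) \<le> C" for x unfolding C_def by (rule norm_fourier_le) simp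
  have "C \<ge> 0" by (simp add: C_def)
  \<comment> \<open>The 2 C dominates on [-1, 1], where 1 + x^2 is at most 2; the 8 dominates
    outside, where 4 / x^2 is at most 8 / (1 + x^2).\<close>
  have i: "integrable lborel (\<lambda>x::real. (2 * C + 8) * inverse (1 + x\<^sup>2))"
    using integrable_inverse_1_plus_square by (intro integrable_mult_right) (simp add: set_integrable_def)
  have "integrable lborel (fourier triangle)"
  proof (rule Bochner_Integration.integrable_bound[OF i])
    have "norm (fourier triangle x) \<le> (2 * C + 8) * inverse (1 + x\<^sup>2)" for x
    proof (cases "\<bar>x\<bar> \<le> 1")
      case True
      then have "x\<^sup>2 \<le> 1" by (simp add: abs_square_le_1)
      then have "C * (1 + x\<^sup>2) \<le> C * 2" using \<open>C \<ge> 0\<close> by (intro mult_left_mono) auto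
      then have "C \<le> (2 * C + 8) * inverse (1 + x\<^sup>2)"
        by (simp add: field_simps add_pos_nonneg)
      then show ?thesis using C[of x] by linarith
    next
      case False
      then have x: "x \<noteq> 0" "x\<^sup>2 \<ge> 1" by (auto simp: not_le abs_square_le_1[symmetric] intro: less_imp_le)
      have "norm (fourier triangle x) = \<bar>2 * (1 - cos x) / x\<^sup>2\<bar>"
        unfolding fourier_triangle[OF x(1)] by (rule norm_of_real)
      also have "\<dots> = 2 * (1 - cos x) / x\<^sup>2" by simp
      also have "\<dots> \<le> 4 / x\<^sup>2"
      proof (rule divide_right_mono)
        have "1 - cos x \<le> 2" using cos_ge_minus_one[of x] by linarith
        then have "2 * (1 - cos x) \<le> 2 * (2::real)" by (rule mult_left_mono) simp
        also have "2 * 2 = (4::real)" by simp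
        finally show "2 * (1 - cos x) \<le> 4" .
      qed simp
      also have "\<dots> \<le> 8 * inverse (1 + x\<^sup>2)" using x by (simp add: field_simps add_pos_nonneg)
      also have "\<dots> \<le> (2 * C + 8) * inverse (1 + x\<^sup>2)"
        using \<open>C \<ge> 0\<close> by (intro mult_right_mono) (auto simp: add_nonneg_nonneg)
      finally show ?thesis .
    qed
    then show "AE x in lborel. norm (fourier triangle x) \<le> norm ((2 * C + 8) * inverse (1 + x\<^sup>2))"
      by (auto intro: order_trans[OF _ abs_ge_self])
  qed simp
  then show ?thesis
    using continuous_triangle triangle_eq_0 unfolding window_class_def by (auto intro!: exI[of _ 1])
qed

text \<open>Only k = floor x and k + 1 contribute, with values 1 - (x - k) and x - k. The upper
  index goes to n + 1 because k may equal n.\<close>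

lemma sum_triangle:
  assumes "\<bar>x\<bar> \<le> real n"
  shows "(\<Sum>j\<in>{-int n-1..int n+1}. triangle (x - of_int j)) = 1"
proof -
  define k where "k = \<lfloor>x\<rfloor>"
  have k: "of_int k \<le> x" "x < of_int k + 1" by (auto simp: k_def)
  have "(\<Sum>j\<in>{-int n-1..int n+1}. triangle (x - of_int j)) = (\<Sum>j\<in>{k, k+1}. triangle (x - of_int j))"
  proof (rule sum.mono_neutral_right)
    have "k \<le> int n" "- int n \<le> k" unfolding k_def using assms by (auto simp: floor_le_iff le_floor_iff)
    then show "{k, k+1} \<subseteq> {-int n-1..int n+1}" by auto
    show "\<forall>j\<in>{-int n-1..int n+1} - {k, k+1}. triangle (x - of_int j) = 0"
    proof
      fix j assume "j \<in> {-int n-1..int n+1} - {k, k+1}"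
      then have "j \<le> k - 1 \<or> j \<ge> k + 2" by auto
      then have "real_of_int j \<le> of_int k - 1 \<or> real_of_int j \<ge> of_int k + 2" by linarith
      then show "triangle (x - of_int j) = 0" using k by (intro triangle_eq_0) linarith
    qed
  qed simp
  also have "\<dots> = 1" using k by (auto simp: triangle_def max_def simp flip: of_real_add)
  finally show ?thesis .
qed

lemma plateau_exists:
  obtains \<tau> where "\<tau> \<in> window_class" "\<And>t. \<bar>t\<bar> \<le> 1 \<Longrightarrow> \<tau> t = 1"
proof
  \<comment> \<open>Five unit translates of the triangle, the partition of unity for n = 1; the
    division by 1 gives the shape that \<open>window_class_affine\<close> expects.\<close>
  let ?\<tau> = "\<lambda>x. \<Sum>j\<in>{-int 1-1..int 1+1}. triangle ((x - of_int j) / 1)"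
  show "?\<tau> \<in> window_class" by (intro window_class_sum window_class_affine triangle_window) auto
  show "?\<tau> t = 1" if "\<bar>t\<bar> \<le> 1" for t using sum_triangle[of t 1] that by simp
qed

text \<open>Minkowski's integral inequality for a transform that is a superposition of the functions
  \<open>F s\<close>.\<close>

lemma mass_integral_le:
  assumes F: "integrable (lborel \<Otimes>\<^sub>M lborel) (\<lambda>(s, y). F s y :: complex)"
    and u: "\<And>y. fourier u y = (LINT s|lborel. F s y)"
  shows "mass u \<le> (LINT s|lborel. LINT y|lborel. norm (F s y))"
proof -
  have i: "integrable (lborel \<Otimes>\<^sub>M lborel) (\<lambda>(s, y). norm (F s y))"
    using integrable_norm[OF F] by (simp add: case_prod_unfold)
  have "mass u = (LINT y|lborel. norm (LINT s|lborel. F s y))" by (simp add: mass_def u)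
  also have "\<dots> \<le> (LINT y|lborel. LINT s|lborel. norm (F s y))"
    by (intro integral_mono integral_norm_bound integrable_norm lborel_pair.integrable_snd[OF F] lborel_pair.integrable_snd[OF i])
  also have "\<dots> = (LINT s|lborel. LINT y|lborel. norm (F s y))"
    by (rule lborel_pair.Fubini_integral[OF i])
  finally show ?thesis .
qed

text \<open>Wiener's localisation: in the algebra norm, a member of the algebra is nearly constant on
  short intervals.\<close>

lemma mass_localised_small:
  assumes g: "integrable lborel g" and \<tau>: "\<tau> \<in> window_class" and e: "e > 0"
  shows "\<exists>d>0. (\<lambda>t. (fourier g t - fourier g b) * \<tau> ((t - b) / d)) \<in> window_class \<and>
     mass (\<lambda>t. (fourier g t - fourier g b) * \<tau> ((t - b) / d)) < e"
proof -
  note D = window_classD[OF \<tau>]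
  define k where "k = fourier \<tau>"
  have k: "integrable lborel k" "continuous_on UNIV k" using D continuous_fourier by (auto simp: k_def)
  have [measurable]: "k \<in> borel_measurable borel" "g \<in> borel_measurable borel" using k g by auto
  have kt: "integrable lborel (\<lambda>x. k (x + z))" for z by (simp add: integrable_lborel_translate k)
  \<comment> \<open>The L1 modulus of continuity of the transform of \<tau>. It is bounded by twice
    the L1 norm and tends to 0 at 0, the two facts that dominated convergence will use.\<close>
  define \<omega> where "\<omega> z = (LINT x|lborel. norm (k (x + z) - k x))" for z
  have [measurable]: "\<omega> \<in> borel_measurable borel" unfolding \<omega>_def by measurable
  have \<omega>_nonneg: "\<omega> z \<ge> 0" for z by (simp add: \<omega>_def)
  have \<omega>_le: "\<omega> z \<le> 2 * (LINT x|lborel. norm (k x))" for z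
  proof -
    have "\<omega> z \<le> (LINT x|lborel. norm (k (x + z)) + norm (k x))"
      unfolding \<omega>_def using k kt by (intro integral_mono norm_triangle_ineq4) auto
    also have "\<dots> = 2 * (LINT x|lborel. norm (k x))"
      using k kt integral_lborel_translate[of "\<lambda>x. norm (k x)"] by simp
    finally show ?thesis .
  qed
  define v where "v d t = (fourier g t - fourier g b) * \<tau> ((t - b) / d)" for d t
  have v: "v d \<in> window_class \<and> mass (v d) \<le> (LINT s|lborel. norm (g s) * \<omega> (d * s))" if d: "d > 0" for d
  proof
    define \<tau>d where "\<tau>d t = \<tau> ((t - b) / d)" for t
    have \<tau>d: "\<tau>d \<in> window_class" unfolding \<tau>d_def using \<tau> d by (rule window_class_affine)
    note Dd = window_classD[OF \<tau>d]
    have veq: "v d = (\<lambda>t. fourier g t * \<tau>d t + - fourier g b * \<tau>d t)"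
      by (auto simp: v_def \<tau>d_def algebra_simps)
    note w = window_class_mult_fourier(1)[OF g \<tau>d] window_class_cmult[OF \<tau>d, of "- fourier g b"]
    show "v d \<in> window_class" unfolding veq by (intro window_class_add w)
    define kd where "kd = fourier \<tau>d"
    have kd: "integrable lborel kd" using Dd by (simp add: kd_def)
    have kd_eq: "kd y = of_real d * cis (-(y * b)) * k (d * y)" for y
      unfolding kd_def \<tau>d_def k_def by (rule fourier_affine[OF D(3) d])
    \<comment> \<open>The difference fourier g t - fourier g b is the integral of g s (cis (- (t s))
      - cis (- (b s))), so each \<open>s\<close> contributes a translate of \<open>kd\<close> minus
      a phase times \<open>kd\<close>.\<close>
    define F where "F s y = g s * kd (y + s) - (cis (-(b * s)) * g s) * kd y" for s y
    obtain C where C: "\<And>x. norm (k x) \<le> C"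
      using norm_fourier_le[OF D(3)] by (auto simp: k_def)
    have gi: "integrable lborel (\<lambda>s. g s * kd (y + s))" for y
    proof -
      have "integrable lborel (\<lambda>s. g s * (of_real d * cis (-((y + s) * b)) * k (d * (y + s))))"
      proof (rule Bochner_Integration.integrable_bound)
        show "AE s in lborel. norm (g s * (of_real d * cis (-((y + s) * b)) * k (d * (y + s)))) \<le> norm (g s * of_real (d * C))"
          using d C order_trans[OF norm_ge_zero C] by (auto simp: norm_mult intro!: mult_left_mono)
        show "integrable lborel (\<lambda>s. g s * of_real (d * C))" using g by (rule integrable_mult_left)
      qed auto
      then show ?thesis by (simp add: kd_eq)
    qed
    have Fi: "integrable (lborel \<Otimes>\<^sub>M lborel) (\<lambda>(s, y). F s y)"
    proof -
      have "integrable (lborel \<Otimes>\<^sub>M lborel) (\<lambda>z. (case z of (s, y) \<Rightarrow> g s * kd (y + s)) - (case z of (s, y) \<Rightarrow> (cis (-(b * s)) * g s) * kd y))"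
        using g kd by (intro Bochner_Integration.integrable_diff integrable_prod_translate integrable_prod_mult integrable_cis_mult) auto
      then show ?thesis by (simp add: F_def case_prod_unfold)
    qed
    have "fourier (v d) y = (LINT s|lborel. F s y)" for y
    proof -
      have "fourier (v d) y = (LINT s|lborel. g s * kd (y + s)) - (LINT s|lborel. cis (-(b * s)) * g s) * kd y"
      proof -
        have "fourier (v d) y = (LINT s|lborel. g s * kd (y + s)) + - fourier g b * kd y"
          unfolding veq fourier_add[OF w[THEN window_classD(4)]] fourier_mult_fourier[OF g Dd(4)]
            fourier_cmult[OF Dd(3)] kd_def ..
        then show ?thesis by (simp add: fourier_cis[of g])
      qed
      also have "\<dots> = (LINT s|lborel. F s y)"
        unfolding F_def using g gi
        by (subst Bochner_Integration.integral_diff) (auto intro!: integrable_cis_mult)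
      finally show ?thesis .
    qed
    then have "mass (v d) \<le> (LINT s|lborel. LINT y|lborel. norm (F s y))"
      by (intro mass_integral_le[OF Fi])
    \<comment> \<open>Up to a factor and a phase \<open>kd\<close> is \<open>k\<close> with its
      argument scaled by \<open>d\<close>, so translating \<open>kd\<close> by \<open>s\<close>
      translates \<open>k\<close> by d s. The phases drop out of the modulus, and for small
      \<open>d\<close> only short translations of \<open>k\<close> remain.\<close>
    moreover have "(LINT y|lborel. norm (F s y)) = norm (g s) * \<omega> (d * s)" for s
    proof -
      have "F s y = g s * (of_real d * (cis (-((y + s) * b)) * (k (d * s + d * y) - k (d * y))))" for y
      proof -
        have "cis (-((y + s) * b)) = cis (-(b * s)) * cis (-(y * b))"
          by (simp add: cis_mult algebra_simps)
        then show ?thesis by (simp add: F_def kd_eq) (simp add: algebra_simps)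
      qed
      then have "norm (F s y) = norm (g s) * (d * norm (k ((0 + d * y) + d * s) - k (0 + d * y)))" for y
        using d by (simp add: norm_mult ac_simps)
      then have "(LINT y|lborel. norm (F s y)) = norm (g s) * (d * (LINT y|lborel. norm (k ((0 + d * y) + d * s) - k (0 + d * y))))"
        by simp
      also have "d * (LINT y|lborel. norm (k ((0 + d * y) + d * s) - k (0 + d * y))) = \<omega> (d * s)"
        unfolding \<omega>_def using d by (subst (2) lborel_integral_real_affine[where c=d and t=0]) auto
      finally show ?thesis .
    qed
    ultimately show "mass (v d) \<le> (LINT s|lborel. norm (g s) * \<omega> (d * s))" by simp
  qed
  \<comment> \<open>The widths d = 1 / (n + 1) suffice: some member of this sequence already makes
    the mass smaller than e.\<close>
  have "(\<lambda>n. LINT s|lborel. norm (g s) * \<omega> (inverse (real (Suc n)) * s)) \<longlonglongrightarrow> (LINT (s::real)|lborel. 0::real)"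
  proof (rule integral_dominated_convergence[where w="\<lambda>s. norm (g s) * (2 * (LINT x|lborel. norm (k x)))"])
    have "(\<lambda>n. norm (g s) * \<omega> (inverse (real (Suc n)) * s)) \<longlonglongrightarrow> 0" for s
    proof -
      have "(\<omega> \<longlongrightarrow> \<omega> 0) (at 0)"
        using tendsto_L1_translate[OF k] unfolding \<omega>_def by simp
      then have "isCont \<omega> 0" by (simp add: isCont_def)
      moreover have "(\<lambda>n. inverse (real (Suc n)) * s) \<longlonglongrightarrow> 0"
        by (rule tendsto_mult_left_zero[OF LIMSEQ_inverse_real_of_nat])
      ultimately have "(\<lambda>n. \<omega> (inverse (real (Suc n)) * s)) \<longlonglongrightarrow> \<omega> 0" by (rule isCont_tendsto_compose)
      then have "(\<lambda>n. \<omega> (inverse (real (Suc n)) * s)) \<longlonglongrightarrow> 0" by (simp add: \<omega>_def)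
      then show ?thesis by (rule tendsto_mult_right_zero)
    qed
    then show "AE s in lborel. (\<lambda>n. norm (g s) * \<omega> (inverse (real (Suc n)) * s)) \<longlonglongrightarrow> 0" by simp
    show "AE s in lborel. norm (norm (g s) * \<omega> (inverse (real (Suc n)) * s)) \<le> norm (g s) * (2 * (LINT x|lborel. norm (k x)))" for n
      using \<omega>_le \<omega>_nonneg by (auto intro!: mult_left_mono)
  qed (use g in \<open>auto intro!: integrable_mult_left\<close>)
  then have "(\<lambda>n. LINT s|lborel. norm (g s) * \<omega> (inverse (real (Suc n)) * s)) \<longlonglongrightarrow> 0" by simp
  then have "\<forall>\<^sub>F n in sequentially. (LINT s|lborel. norm (g s) * \<omega> (inverse (real (Suc n)) * s)) < e"
    using e order_tendstoD(2) by blast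
  then obtain n where n: "(LINT s|lborel. norm (g s) * \<omega> (inverse (real (Suc n)) * s)) < e"
    using eventually_happens trivial_limit_sequentially by blast
  show ?thesis
    using v[of "inverse (real (Suc n))"] n
    by (intro exI[of _ "inverse (real (Suc n))"]) (auto simp: v_def[symmetric, abs_def])
qed

section \<open>Wiener's Tauberian argument\<close>

definition corr :: "(real \<Rightarrow> complex) \<Rightarrow> (real \<Rightarrow> complex) \<Rightarrow> real \<Rightarrow> complex" where
  "corr R u h = (LINT x|lborel. R x * fourier u (x - h))"

lemma corr_integrable:
  assumes [measurable]: "R \<in> borel_measurable borel" and R: "\<And>x. norm (R x) \<le> M" and u: "u \<in> window_class"
  shows "integrable lborel (\<lambda>x. R x * fourier u (x - h))"
proof -
  note D = window_classD[OF u]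
  have [measurable]: "fourier u \<in> borel_measurable borel" using D by auto
  have M: "M \<ge> 0" using order_trans[OF norm_ge_zero R] .
  have "integrable lborel (\<lambda>x. of_real M * fourier u (x + - h))"
    by (intro integrable_mult_right) (simp only: integrable_lborel_translate D)
  then show ?thesis
    by (rule Bochner_Integration.integrable_bound) (use R M in \<open>auto simp: norm_mult intro!: mult_right_mono\<close>)
qed

lemma norm_corr_le:
  assumes [measurable]: "R \<in> borel_measurable borel" and R: "\<And>x. norm (R x) \<le> M" and u: "u \<in> window_class"
  shows "norm (corr R u h) \<le> M * mass u"
proof -
  note D = window_classD[OF u]
  have i: "integrable lborel (\<lambda>x. fourier u (x + - h))"
    by (simp only: integrable_lborel_translate D)
  have "norm (corr R u h) \<le> (LINT x|lborel. norm (R x * fourier u (x - h)))"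
    unfolding corr_def by (rule integral_norm_bound)
  also have "\<dots> \<le> (LINT x|lborel. M * norm (fourier u (x + - h)))"
    by (intro integral_mono integrable_norm corr_integrable[OF assms] integrable_mult_right i)
       (use R in \<open>auto simp: norm_mult intro!: mult_right_mono\<close>)
  also have "\<dots> = M * mass u"
    unfolding mass_def integral_mult_right_zero
    by (subst integral_lborel_translate[of "\<lambda>x. norm (fourier u x)"]) simp
  finally show ?thesis .
qed

definition vanishes :: "(real \<Rightarrow> complex) \<Rightarrow> (real \<Rightarrow> complex) \<Rightarrow> bool" where
  "vanishes R u \<longleftrightarrow> (corr R u \<longlongrightarrow> 0) at_top"

context
  fixes R :: "real \<Rightarrow> complex" and M :: real
  assumes R_meas [measurable]: "R \<in> borel_measurable borel" and R_bound: "\<And>x. norm (R x) \<le> M"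
begin

lemmas corr_int = corr_integrable[OF R_meas R_bound] and corr_le = norm_corr_le[OF R_meas R_bound]

lemma M_nonneg: "M \<ge> 0"
  using order_trans[OF norm_ge_zero R_bound] .

lemma corr_add:
  assumes "u \<in> window_class" "v \<in> window_class"
  shows "corr R (\<lambda>t. u t + v t) h = corr R u h + corr R v h"
  unfolding corr_def
  using assms by (simp add: fourier_add window_classD ring_distribs corr_int)

lemma corr_cmult:
  assumes "u \<in> window_class"
  shows "corr R (\<lambda>t. c * u t) h = c * corr R u h"
proof -
  have "R x * fourier (\<lambda>t. c * u t) (x - h) = c * (R x * fourier u (x - h))" for x
    by (simp add: fourier_cmult window_classD assms)
  then show ?thesis unfolding corr_def by (simp only: integral_mult_right_zero)
qed

lemma vanishes_sum:
  assumes "\<And>i. i \<in> I \<Longrightarrow> u i \<in> window_class" "\<And>i. i \<in> I \<Longrightarrow> vanishes R (u i)"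
  shows "vanishes R (\<lambda>t. \<Sum>i\<in>I. u i t)"
  using assms
proof (induction I rule: infinite_finite_induct)
  case (insert i I)
  have "corr R (\<lambda>t. \<Sum>i\<in>insert i I. u i t) = (\<lambda>h. corr R (u i) h + corr R (\<lambda>t. \<Sum>i\<in>I. u i t) h)"
    using insert corr_add[of "u i" "\<lambda>t. \<Sum>i\<in>I. u i t"] by (simp add: window_class_sum fun_eq_iff)
  moreover have "((\<lambda>h. corr R (u i) h + corr R (\<lambda>t. \<Sum>i\<in>I. u i t) h) \<longlongrightarrow> 0 + 0) at_top"
    using insert by (intro tendsto_add) (auto simp: vanishes_def)
  ultimately show ?case unfolding vanishes_def by (simp only: add_0)
next
  case (infinite A)
  then show ?case by (simp add: vanishes_def corr_def[abs_def] fourier_def)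
next
  case empty
  show ?case by (simp add: vanishes_def corr_def[abs_def] fourier_def)
qed

text \<open>Inserting \<open>fourier_mult_fourier\<close> and exchanging the integrals turns
  multiplication of the window by \<open>fourier g\<close> into an average of the correlation over
  shifted lags, weighted by \<open>g\<close>.\<close>

lemma corr_mult_fourier:
  assumes g: "integrable lborel g" and u: "u \<in> window_class"
  shows "corr R (\<lambda>t. fourier g t * u t) h = (LINT s|lborel. g s * corr R u (h - s))"
    and "corr R u \<in> borel_measurable borel"
proof -
  note D = window_classD[OF u]
  have [measurable]: "fourier u \<in> borel_measurable borel" "g \<in> borel_measurable borel" using D g by auto
  show "corr R u \<in> borel_measurable borel" unfolding corr_def[abs_def] by measurable
  have i: "integrable lborel (\<lambda>x. fourier u (x + - h))"
    by (simp only: integrable_lborel_translate D)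
  have F: "integrable (lborel \<Otimes>\<^sub>M lborel) (\<lambda>(s, x). R x * (g s * fourier u (x - (h - s))))"
  proof (rule Bochner_Integration.integrable_bound)
    show "integrable (lborel \<Otimes>\<^sub>M lborel) (\<lambda>z. of_real M * (case z of (s, x) \<Rightarrow> g s * fourier u (x + s + - h)))"
      by (intro integrable_mult_right integrable_prod_translate[OF g i])
    show "AE z in lborel \<Otimes>\<^sub>M lborel. norm (case z of (s, x) \<Rightarrow> R x * (g s * fourier u (x - (h - s))))
       \<le> norm (of_real M * (case z of (s, x) \<Rightarrow> g s * fourier u (x + s + - h)))"
      using R_bound M_nonneg by (intro AE_I2) (auto simp: norm_mult algebra_simps intro!: mult_right_mono)
  qed measurable
  have "corr R (\<lambda>t. fourier g t * u t) h = (LINT x|lborel. R x * (LINT s|lborel. g s * fourier u (x - h + s)))"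
    by (simp add: corr_def fourier_mult_fourier[OF g D(4)])
  also have "\<dots> = (LINT x|lborel. LINT s|lborel. R x * (g s * fourier u (x - (h - s))))"
    unfolding integral_mult_right_zero by (simp add: algebra_simps)
  also have "\<dots> = (LINT s|lborel. LINT x|lborel. R x * (g s * fourier u (x - (h - s))))"
    by (rule lborel_pair.Fubini_integral[OF F])
  also have "\<dots> = (LINT s|lborel. g s * corr R u (h - s))"
  proof -
    have "(LINT x|lborel. R x * (g s * fourier u (x - (h - s)))) = g s * corr R u (h - s)" for s
      unfolding corr_def integral_mult_right_zero[symmetric] by (simp add: ac_simps)
    then show ?thesis by simp
  qed
  finally show "corr R (\<lambda>t. fourier g t * u t) h = (LINT s|lborel. g s * corr R u (h - s))" .
qed

text \<open>For each fixed \<open>s\<close> the lag h - s still tends to infinity, and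
  \<open>corr_le\<close> bounds the integrand uniformly in \<open>h\<close>. Combined with
  inversion, this makes the windows with vanishing correlation an ideal.\<close>

lemma vanishes_mult_fourier:
  assumes g: "integrable lborel g" and u: "u \<in> window_class" and "vanishes R u"
  shows "vanishes R (\<lambda>t. fourier g t * u t)"
proof -
  note [measurable] = corr_mult_fourier(2)[OF g u]
  have [measurable]: "g \<in> borel_measurable borel" using g by auto
  have "((\<lambda>h. LINT s|lborel. g s * corr R u (h - s)) \<longlongrightarrow> (LINT (s::real)|lborel. 0)) at_top"
  proof (rule integral_dominated_convergence_at_top[where w="\<lambda>s. norm (g s) * (M * mass u)"])
    have "((\<lambda>h. g s * corr R u (h - s)) \<longlongrightarrow> 0) at_top" for s
    proof (rule tendsto_mult_right_zero, rule filterlim_compose[of "corr R u"])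
      show "(corr R u \<longlongrightarrow> 0) at_top" using assms by (simp add: vanishes_def)
      show "LIM h at_top. h - s :> at_top" by real_asymp
    qed
    then show "AE s in lborel. ((\<lambda>h. g s * corr R u (h - s)) \<longlongrightarrow> 0) at_top" by simp
    show "\<forall>\<^sub>F h in at_top. AE s in lborel. norm (g s * corr R u (h - s)) \<le> norm (g s) * (M * mass u)"
      using corr_le[OF u] by (auto simp: norm_mult intro!: always_eventually mult_left_mono)
  qed (use g in \<open>auto intro!: integrable_mult_left\<close>)
  then show ?thesis by (simp add: vanishes_def corr_mult_fourier(1)[OF g u, abs_def])
qed

lemma vanishes_mult:
  assumes "v \<in> window_class" "u \<in> window_class" "vanishes R u"
  shows "vanishes R (\<lambda>t. v t * u t)"
  using window_class_imp_fourier[OF assms(1)] vanishes_mult_fourier[OF _ assms(2,3)] by metis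

text \<open>For \<open>u\<close> supported where \<open>\<phi>\<close> is nearly equal to \<open>c = \<phi> b \<noteq> 0\<close> we have \<open>c u = \<phi> u - r u\<close> with
  \<open>r\<close> of small norm. The first term does not contribute to the limit, so passing from \<open>u\<close> to \<open>r u\<close>
  loses nothing; iterating gives the claim.\<close>

lemma vanishes_local:
  assumes \<phi>: "\<phi> \<in> window_class" "vanishes R \<phi>" "\<phi> b \<noteq> 0"
  shows "\<exists>d>0. \<forall>u\<in>window_class. (\<forall>t. d < \<bar>t - b\<bar> \<longrightarrow> u t = 0) \<longrightarrow> vanishes R u"
proof -
  obtain g where g: "integrable lborel g" "\<phi> = fourier g" using window_class_imp_fourier[OF \<phi>(1)] by metis
  \<comment> \<open>The plateau makes \<open>r\<close> a global member of the class that agrees with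
    \<phi> - c wherever \<open>u\<close> may be non-zero.\<close>
  obtain \<tau> where \<tau>: "\<tau> \<in> window_class" "\<And>t. \<bar>t\<bar> \<le> 1 \<Longrightarrow> \<tau> t = 1" using plateau_exists by metis
  define c where "c = \<phi> b"
  have c: "norm c > 0" using \<phi> by (simp add: c_def)
  \<comment> \<open>Multiplication brings a factor 1 / (2 pi), so the threshold
    \<open>pi * norm c\<close> makes the mass of r u at most half of norm c times the mass of
    u.\<close>
  obtain d where d: "d > 0" and
    r: "(\<lambda>t. (\<phi> t - c) * \<tau> ((t - b) / d)) \<in> window_class"
       "mass (\<lambda>t. (\<phi> t - c) * \<tau> ((t - b) / d)) < pi * norm c"
    using mass_localised_small[OF g(1) \<tau>(1), of "pi * norm c" b] c by (auto simp: g(2) c_def)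
  define r where "r t = (\<phi> t - c) * \<tau> ((t - b) / d)" for t
  have r: "r \<in> window_class" "mass r < pi * norm c" using r by (simp_all add: r_def[abs_def])
  define X where "X = {u \<in> window_class. \<forall>t. d < \<bar>t - b\<bar> \<longrightarrow> u t = 0}"
  \<comment> \<open>Each round halves the main bound at the price of an error tending to 0. The
    additive \<open>e\<close>, scaled by \<open>norm c\<close>, is shared equally between the
    vanishing term \<open>u2\<close> and the induction hypothesis for \<open>u1\<close>.\<close>
  have claim: "\<forall>\<^sub>F h in at_top. norm (corr R u h) < M * mass u / 2 ^ n + e" if "u \<in> X" "e > 0" for u e n
    using that
  proof (induction n arbitrary: u e)
    case 0
    then have "norm (corr R u h) < M * mass u / 2 ^ 0 + e" for h
      using corr_le[of u h] by (simp add: X_def)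
    then show ?case by simp
  next
    case (Suc n)
    have u: "u \<in> window_class" using Suc by (simp add: X_def)
    define u1 where "u1 t = r t * u t" for t
    have u1: "u1 \<in> window_class" "mass u1 \<le> mass r / (2 * pi) * mass u"
      using window_class_mult[OF r(1) u] by (simp_all add: u1_def[abs_def])
    have u1X: "u1 \<in> X" using u1 Suc.prems by (auto simp: X_def u1_def)
    define u2 where "u2 t = u t * \<phi> t" for t
    have u2: "u2 \<in> window_class" "vanishes R u2"
      using window_class_mult(1)[OF u \<phi>(1)] vanishes_mult[OF u \<phi>(1,2)] by (simp_all add: u2_def[abs_def])
    have "c * u t = u2 t + (-1) * u1 t" for t
    proof (cases "\<bar>t - b\<bar> \<le> d")
      case True
      then have "\<tau> ((t - b) / d) = 1" using d by (intro \<tau>(2)) auto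
      then show ?thesis by (simp add: u2_def u1_def r_def algebra_simps)
    qed (use Suc in \<open>auto simp: X_def u2_def u1_def\<close>)
    then have "corr R (\<lambda>t. c * u t) h = corr R (\<lambda>t. u2 t + (-1) * u1 t) h" for h by simp
    then have eq: "c * corr R u h = corr R u2 h - corr R u1 h" for h
      unfolding corr_cmult[OF u] corr_add[OF u2(1) window_class_cmult[OF u1(1)]] corr_cmult[OF u1(1)] by simp
    have "mass r / (2 * pi) * mass u \<le> norm c / 2 * mass u"
      using r(2) by (intro mult_right_mono mass_nonneg) (simp add: field_simps)
    then have "mass u1 \<le> norm c / 2 * mass u" using u1(2) by (rule order_trans[rotated])
    then have "M * mass u1 / 2 ^ n \<le> M * (norm c / 2 * mass u) / 2 ^ n"
      by (intro divide_right_mono mult_left_mono M_nonneg) auto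
    then have m: "M * mass u1 / 2 ^ n \<le> norm c * (M * mass u / 2 ^ Suc n)" by (simp add: field_simps)
    have "norm c * e / 2 > 0" using c Suc.prems(2) by simp
    from tendstoD[OF u2(2)[unfolded vanishes_def] this]
    have "\<forall>\<^sub>F h in at_top. norm (corr R u2 h) < norm c * e / 2" by (simp only: dist_norm diff_zero)
    moreover have "\<forall>\<^sub>F h in at_top. norm (corr R u1 h) < M * mass u1 / 2 ^ n + norm c * e / 2"
      using u1X c Suc.prems(2) by (intro Suc.IH) auto
    ultimately show ?case
    proof eventually_elim
      case (elim h)
      have "norm c * norm (corr R u h) \<le> norm (corr R u2 h) + norm (corr R u1 h)"
        using norm_triangle_ineq4[of "corr R u2 h" "corr R u1 h"] by (simp add: eq flip: norm_mult)
      also have "\<dots> < norm c * (M * mass u / 2 ^ Suc n) + norm c * e" using elim m by linarith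
      finally have "norm c * norm (corr R u h) < norm c * (M * mass u / 2 ^ Suc n + e)" by (simp add: ring_distribs)
      then show ?case using c by (simp only: mult_less_cancel_left_pos)
    qed
  qed
  have "vanishes R u" if "u \<in> X" for u
    unfolding vanishes_def tendsto_iff dist_norm
  proof (intro allI impI)
    fix e :: real assume e: "e > 0"
    have "(\<lambda>n. M * mass u / 2 ^ n) \<longlonglongrightarrow> 0" by (rule LIMSEQ_divide_realpow_zero) simp
    then have "\<forall>\<^sub>F n in sequentially. M * mass u / 2 ^ n < e / 2" using e by (intro order_tendstoD) auto
    then obtain n where n: "M * mass u / 2 ^ n < e / 2"
      using eventually_happens trivial_limit_sequentially by blast
    have "\<forall>\<^sub>F h in at_top. norm (corr R u h) < M * mass u / 2 ^ n + e / 2"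
      using claim that e by simp
    then show "\<forall>\<^sub>F h in at_top. norm (corr R u h - 0) < e"
    proof eventually_elim
      case (elim h)
      then show ?case unfolding diff_zero using n by linarith
    qed
  qed
  then show ?thesis using d by (auto simp: X_def)
qed

text \<open>Compactness gives a Lebesgue number for the cover by the intervals on which
  \<open>vanishes_local\<close> works, so a triangular partition of unity with a single mesh cuts
  \<open>u\<close> into pieces that each fit into one of them.\<close>

lemma vanishes_all:
  assumes \<Phi>: "\<Phi> \<subseteq> window_class" "\<And>\<phi>. \<phi> \<in> \<Phi> \<Longrightarrow> vanishes R \<phi>" "\<And>t. \<exists>\<phi>\<in>\<Phi>. \<phi> t \<noteq> 0"
    and u: "u \<in> window_class"
  shows "vanishes R u"
proof -
  have "\<exists>d>0. \<forall>u\<in>window_class. (\<forall>t. d < \<bar>t - b\<bar> \<longrightarrow> u t = 0) \<longrightarrow> vanishes R u" for b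
    using \<Phi> vanishes_local by blast
  then obtain D where D: "\<And>b. D b > 0"
    "\<And>b u. u \<in> window_class \<Longrightarrow> (\<And>t. D b < \<bar>t - b\<bar> \<Longrightarrow> u t = 0) \<Longrightarrow> vanishes R u" by metis
  obtain B where B: "B \<ge> 0" "\<And>t. B < \<bar>t\<bar> \<Longrightarrow> u t = 0" using window_classD(6)[OF u] by auto
  have cover: "{-B..B} \<subseteq> \<Union> (range (\<lambda>b. ball b (D b)))" using D(1) centre_in_ball by blast
  obtain e where e: "e > 0" "\<And>T. T \<subseteq> {-B..B} \<Longrightarrow> diameter T < e \<Longrightarrow> \<exists>C \<in> range (\<lambda>b. ball b (D b)). T \<subseteq> C"
    by (rule Lebesgue_number_lemma[OF compact_Icc _ cover]) auto
  \<comment> \<open>A piece lives on an interval of length 2 d, which is less than the Lebesgue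
    number e.\<close>
  define d where "d = e / 3"
  have d: "d > 0" using e by (simp add: d_def)
  \<comment> \<open>Enough translates for the rescaled triangles to sum to 1 on all of
    [-B, B].\<close>
  define n where "n = nat \<lceil>B / d\<rceil>"
  have n: "B / d \<le> real n" unfolding n_def using of_nat_ceiling by blast
  define w where "w j t = triangle ((t - of_int j * d) / d) * u t" for j t
  have w: "w j \<in> window_class" for j
    unfolding w_def[abs_def] by (intro window_class_mult(1) window_class_affine triangle_window d u)
  have "vanishes R (w j)" for j
  proof -
    define T where "T = {t. w j t \<noteq> 0}"
    have T1: "T \<subseteq> {-B..B}" using B unfolding T_def w_def by (force simp: not_less abs_le_iff)
    have T2: "\<bar>t - of_int j * d\<bar> \<le> d" if "t \<in> T" for t
      using that triangle_eq_0[of "(t - of_int j * d) / d"] d by (force simp: T_def w_def field_simps)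
    have "diameter T \<le> 2 * d"
    proof (rule diameter_le)
      fix x y assume "x \<in> T" "y \<in> T"
      then show "norm (x - y) \<le> 2 * d" using T2[of x] T2[of y] unfolding real_norm_def by linarith
    qed (use d in auto)
    then have "diameter T < e" using e by (simp add: d_def)
    then obtain b where b: "T \<subseteq> ball b (D b)" using e(2)[OF T1] by auto
    show ?thesis
    proof (rule D(2)[OF w])
      fix t assume "D b < \<bar>t - b\<bar>"
      then have "t \<notin> T" using b by (force simp: dist_real_def)
      then show "w j t = 0" by (simp add: T_def)
    qed
  qed
  then have "vanishes R (\<lambda>t. \<Sum>j\<in>{-int n-1..int n+1}. w j t)" by (intro vanishes_sum w)
  moreover have "(\<Sum>j\<in>{-int n-1..int n+1}. w j t) = u t" for t
  proof (cases "\<bar>t\<bar> \<le> B")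
    case True
    then have "\<bar>t / d\<bar> \<le> B / d" using d by (simp add: divide_right_mono)
    then have *: "\<bar>t / d\<bar> \<le> real n" using n by linarith
    have "w j t = triangle (t / d - of_int j) * u t" for j using d by (simp add: w_def diff_divide_distrib)
    then have "(\<Sum>j\<in>{-int n-1..int n+1}. w j t) = (\<Sum>j\<in>{-int n-1..int n+1}. triangle (t / d - of_int j)) * u t"
      by (simp add: sum_distrib_right)
    then show ?thesis using sum_triangle[OF *] by simp
  qed (use B in \<open>auto simp: w_def\<close>)
  ultimately show ?thesis by simp
qed

end

text \<open>Near \<open>h\<close> the bound by \<open>a\<close> is assumed; elsewhere
  \<open>R\<close> falls short of \<open>a\<close> by at most M + |a|, and this deficit is weighted
  only by the tail of the kernel.\<close>

lemma kernel_lower_bound: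
  fixes R K :: "real \<Rightarrow> real"
  assumes [measurable]: "R \<in> borel_measurable borel" and R: "\<And>x. \<bar>R x\<bar> \<le> M"
    and K: "integrable lborel K" "\<And>y. K y \<ge> 0"
    and ae: "AE y in lborel. \<bar>y - h\<bar> \<le> \<eta> \<longrightarrow> a \<le> R y"
  shows "a * (LINT y|lborel. K y) \<le> (LINT y|lborel. R y * K (y - h)) +
    (M + \<bar>a\<bar>) * (LINT y|lborel. indicator {y. \<eta> < \<bar>y\<bar>} y * K y)"
proof -
  have [measurable]: "K \<in> borel_measurable borel" using K by auto
  have M: "M \<ge> 0" using order_trans[OF abs_ge_zero R] .
  have i1: "integrable lborel (\<lambda>y. K (y + - h))" by (simp only: integrable_lborel_translate K)
  have K2: "integrable lborel (\<lambda>y. indicator {y. \<eta> < \<bar>y\<bar>} y * K y)"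
    using K(1) by (rule Bochner_Integration.integrable_bound) (auto simp: indicator_def)
  have i2: "integrable lborel (\<lambda>y. indicator {y. \<eta> < \<bar>y\<bar>} (y + - h) * K (y + - h))"
    using K2 integrable_lborel_translate[of "\<lambda>y. indicator {y. \<eta> < \<bar>y\<bar>} y * K y" "-h"] by simp
  have i3: "integrable lborel (\<lambda>y. R y * K (y + - h))"
  proof (rule Bochner_Integration.integrable_bound)
    show "integrable lborel (\<lambda>y. M * K (y + - h))" using i1 by simp
  qed (use R M K(2) in \<open>auto simp: abs_mult intro!: mult_right_mono\<close>)
  have "a * (LINT y|lborel. K y) = (LINT y|lborel. a * K (y + - h))"
    using integral_lborel_translate[of K "-h"] by simp
  also have "\<dots> \<le> (LINT y|lborel. R y * K (y + - h) + (M + \<bar>a\<bar>) * (indicator {y. \<eta> < \<bar>y\<bar>} (y + - h) * K (y + - h)))"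
  proof (rule integral_mono_AE)
    show "AE y in lborel. a * K (y + - h) \<le> R y * K (y + - h) + (M + \<bar>a\<bar>) * (indicator {y. \<eta> < \<bar>y\<bar>} (y + - h) * K (y + - h))"
      using ae
    proof eventually_elim
      case (elim y)
      show ?case
      proof (cases "\<bar>y - h\<bar> \<le> \<eta>")
        case True
        then show ?thesis using elim K(2)[of "y - h"] by (simp add: mult_right_mono)
      next
        case False
        have "a \<le> R y + (M + \<bar>a\<bar>)" using R[of y] by linarith
        then have "a * K (y - h) \<le> (R y + (M + \<bar>a\<bar>)) * K (y - h)" by (intro mult_right_mono K(2))
        then show ?thesis using False by (simp add: ring_distribs)
      qed
    qed
  qed (use i1 i2 i3 in auto)
  also have "\<dots> = (LINT y|lborel. R y * K (y + - h)) + (M + \<bar>a\<bar>) * (LINT y|lborel. indicator {y. \<eta> < \<bar>y\<bar>} (y + - h) * K (y + - h))"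
    using i2 i3 by simp
  also have "(LINT y|lborel. indicator {y. \<eta> < \<bar>y\<bar>} (y + - h) * K (y + - h)) = (LINT y|lborel. indicator {y. \<eta> < \<bar>y\<bar>} y * K y)"
    by (rule integral_lborel_translate[of "\<lambda>y. indicator {y. \<eta> < \<bar>y\<bar>} y * K y"])
  finally show ?thesis by simp
qed

text \<open>The kernels are the Fejer kernels \<open>n k (n y)\<close>, \<open>k\<close> being the transform of the triangle.\<close>

lemma slowly_decreasing_tendsto_0:
  fixes R r :: "real \<Rightarrow> real"
  assumes [measurable]: "R \<in> borel_measurable borel" and R: "\<And>x. \<bar>R x\<bar> \<le> M"
    and r: "\<And>x. x \<ge> x1 \<Longrightarrow> \<bar>r x\<bar> \<le> M" and ae: "AE x in lborel. x \<ge> x1 \<longrightarrow> R x = r x"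
    and slow: "\<And>e. e > 0 \<Longrightarrow> \<exists>d>0. \<exists>x0. \<forall>x\<ge>x0. \<forall>h\<in>{0..d}. r x - e \<le> r (x + h)"
    and van: "\<And>u. u \<in> window_class \<Longrightarrow> vanishes (\<lambda>x. of_real (R x)) u"
  shows "(r \<longlongrightarrow> 0) at_top"
proof -
  have M: "M \<ge> 0" using order_trans[OF abs_ge_zero R] .
  define k where "k x = Re (fourier triangle x)" for x
  have k: "fourier triangle x = of_real (k x)" "k x \<ge> 0" for x
    unfolding k_def using fourier_triangle_nonneg by blast+
  note T = window_classD[OF triangle_window]
  have ki: "integrable lborel k" unfolding k_def[abs_def] using T(2) by auto
  then have [measurable]: "k \<in> borel_measurable borel" by auto
  have "of_real (2 * pi) * triangle 0 = (LINT x|lborel. fourier triangle x * cis (x * 0))"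
    using T(5) fourier_inversion[OF T(4,1) _ T(2)] by blast
  then have "complex_of_real (2 * pi) = of_real (LINT x|lborel. k x)" by (simp add: triangle_def k)
  then have kint: "(LINT x|lborel. k x) = 2 * pi" by (simp only: of_real_eq_iff)
  have main: "\<forall>\<^sub>F x in at_top. \<bar>r x\<bar> < e" if e: "e > 0" for e
  proof -
    obtain d where d: "d > 0" and "\<exists>x0. \<forall>x\<ge>x0. \<forall>h\<in>{0..d}. r x - e / 4 \<le> r (x + h)"
      using slow[of "e / 4"] e by auto
    then obtain x0 where x0: "\<And>x h. x \<ge> x0 \<Longrightarrow> h \<in> {0..d} \<Longrightarrow> r x - e / 4 \<le> r (x + h)"
      by blast
    \<comment> \<open>With this shift the windows of radius \<eta> about x + \<eta> and x - \<eta>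
      are exactly [x, x + d] and [x - d, x], the intervals on which slow decrease compares values
      with r x.\<close>
    define \<eta> where "\<eta> = d / 2"
    have \<eta>: "\<eta> > 0" using d by (simp add: \<eta>_def)
    have "(\<lambda>n. LINT y|lborel. indicator {y. real n * \<eta> < \<bar>y\<bar>} y * k y) \<longlonglongrightarrow> (LINT (y::real)|lborel. 0::real)"
    proof (rule integral_dominated_convergence[where w=k])
      have "(\<lambda>n. indicator {y. real n * \<eta> < \<bar>y\<bar>} y * k y) \<longlonglongrightarrow> 0" for y
      proof (rule tendsto_eventually)
        obtain N :: nat where "\<bar>y\<bar> / \<eta> \<le> real N" using real_arch_simple by blast
        then have "\<bar>y\<bar> \<le> real n * \<eta>" if "n \<ge> N" for n
          using that \<eta> by (smt (verit) of_nat_mono pos_divide_le_eq)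
        then show "\<forall>\<^sub>F n in sequentially. indicator {y. real n * \<eta> < \<bar>y\<bar>} y * k y = 0"
          by (intro eventually_sequentiallyI[of N]) (auto simp: indicator_def not_less)
      qed
      then show "AE y in lborel. (\<lambda>n. indicator {y. real n * \<eta> < \<bar>y\<bar>} y * k y) \<longlonglongrightarrow> 0" by simp
    qed (use ki k(2) in \<open>auto simp: indicator_def\<close>)
    \<comment> \<open>The tail will be multiplied by M + |a| with |a| at most M + e / 4. The
      denominator exceeds that, so the tail term is at most e.\<close>
    then have "\<forall>\<^sub>F n in sequentially. (LINT y|lborel. indicator {y. real n * \<eta> < \<bar>y\<bar>} y * k y) < e / (4 * M + e + 4)"
      using e M by (intro order_tendstoD) auto
    then have "\<forall>\<^sub>F n in sequentially. (LINT y|lborel. indicator {y. real n * \<eta> < \<bar>y\<bar>} y * k y) < e / (4 * M + e + 4) \<and> n > 0"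
      using eventually_gt_at_top by (rule eventually_conj)
    then obtain n where n: "(LINT y|lborel. indicator {y. real n * \<eta> < \<bar>y\<bar>} y * k y) < e / (4 * M + e + 4)" "n > 0"
      using eventually_happens trivial_limit_sequentially by blast
    define K where "K y = real n * k (real n * y)" for y
    have Ki: "integrable lborel K"
      unfolding K_def using n lborel_integrable_real_affine[OF ki, of "real n" 0] by simp
    have K0: "K y \<ge> 0" for y by (simp add: K_def k)
    have Kint: "(LINT y|lborel. K y) = 2 * pi"
      unfolding K_def using n kint lborel_integral_real_affine[of "real n" k 0] by simp
    have "(LINT y|lborel. indicator {y. \<eta> < \<bar>y\<bar>} y * K y) = (LINT y|lborel. indicator {y. real n * \<eta> < \<bar>y\<bar>} y * k y)"
    proof -
      have "indicator {y. \<eta> < \<bar>y\<bar>} y * K y = real n * (indicator {y. real n * \<eta> < \<bar>y\<bar>} (0 + real n * y) * k (0 + real n * y))" for y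
        using n by (simp add: indicator_def abs_mult K_def)
      then show ?thesis
        using n lborel_integral_real_affine[of "real n" "\<lambda>y. indicator {y. real n * \<eta> < \<bar>y\<bar>} y * k y" 0] by simp
    qed
    then have tail: "(LINT y|lborel. indicator {y. \<eta> < \<bar>y\<bar>} y * K y) < e / (4 * M + e + 4)" using n by simp
    have tail0: "(LINT y|lborel. indicator {y. \<eta> < \<bar>y\<bar>} y * K y) \<ge> 0"
      by (intro integral_nonneg_AE) (auto simp: K0 indicator_def)
    define c where "c h = (LINT y|lborel. R y * K (y - h))" for h
    have tl: "(M + \<bar>a\<bar>) * (LINT y|lborel. indicator {y. \<eta> < \<bar>y\<bar>} y * K y) \<le> e" if "\<bar>a\<bar> \<le> M + e / 4" for a
    proof -
      have "(M + \<bar>a\<bar>) * (LINT y|lborel. indicator {y. \<eta> < \<bar>y\<bar>} y * K y) \<le> (4 * M + e + 4) * (e / (4 * M + e + 4))"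
        using that tail tail0 M e by (intro mult_mono) auto
      also have "\<dots> = e" using M e by (simp add: field_simps)
      finally show ?thesis .
    qed
    \<comment> \<open>Stretching the triangle by \<open>n\<close> produces exactly the kernel
      \<open>K\<close>, so \<open>c\<close> is a correlation with a member of the class and tends to
      0.\<close>
    let ?u = "\<lambda>t. triangle ((t - 0) / real n)"
    have "fourier ?u y = of_real (K y)" for y
      using n by (subst fourier_affine[OF T(3)]) (auto simp: K_def k)
    then have "corr (\<lambda>x. of_real (R x)) ?u = (\<lambda>h. of_real (c h))"
      by (simp add: fun_eq_iff corr_def c_def flip: of_real_mult integral_complex_of_real del: of_real_mult)
    moreover have "vanishes (\<lambda>x. of_real (R x)) ?u"
      using n by (intro van window_class_affine triangle_window) auto
    ultimately have c: "(c \<longlongrightarrow> 0) at_top"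
      unfolding vanishes_def by (simp only: tendsto_of_real_iff[where 'a=complex, of c 0, simplified])
    have cp: "((\<lambda>x. c (x + \<eta>)) \<longlongrightarrow> 0) at_top"
      by (rule filterlim_compose[OF c]) real_asymp
    have cm: "((\<lambda>x. c (x - \<eta>)) \<longlongrightarrow> 0) at_top"
      by (rule filterlim_compose[OF c]) real_asymp
    have e1: "\<forall>\<^sub>F x in at_top. c (x + \<eta>) < e" using cp e by (intro order_tendstoD) auto
    have e2: "\<forall>\<^sub>F x in at_top. c (x - \<eta>) > - e" using cm e by (intro order_tendstoD) auto
    \<comment> \<open>The kernel has integral 2 pi, so a total error below 2 e becomes an error
      below e / 2 after division, as pi > 2.\<close>
    have half: "z < e / 2" if "z * (2 * pi) < 2 * e" for z
    proof (rule ccontr)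
      assume "\<not> z < e / 2"
      then have "e / 2 * (2 * pi) \<le> z * (2 * pi)" by (intro mult_right_mono) auto
      moreover have "e / 2 * (2 * pi) = e * pi" by simp
      moreover have "e * 2 \<le> e * pi" using pi_gt3 e by simp
      ultimately show False using that by linarith
    qed
    from e1 e2 eventually_ge_at_top[of "max x0 x1 + d"] show "\<forall>\<^sub>F x in at_top. \<bar>r x\<bar> < e"
    proof eventually_elim
      case (elim x)
      then have x: "x \<ge> x0" "x \<ge> x1" "x - d \<ge> x0" "x - d \<ge> x1" using d by auto
      have "AE y in lborel. \<bar>y - (x + \<eta>)\<bar> \<le> \<eta> \<longrightarrow> r x - e / 4 \<le> R y"
        using ae
      proof eventually_elim
        case (elim y)
        show ?case
        proof
          assume "\<bar>y - (x + \<eta>)\<bar> \<le> \<eta>"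
          then have "y - x \<in> {0..d}" unfolding \<eta>_def atLeastAtMost_iff by linarith
          then show "r x - e / 4 \<le> R y" using x0[of x "y - x"] x elim by auto
        qed
      qed
      from kernel_lower_bound[OF _ R Ki K0 this]
      have "(r x - e / 4) * (2 * pi) \<le> c (x + \<eta>) + e"
        using tl[of "r x - e / 4"] r[OF x(2)] e unfolding Kint c_def by fastforce
      then have "(r x - e / 4) * (2 * pi) < 2 * e" using elim by linarith
      from half[OF this] have 1: "r x < e" using e by linarith
      \<comment> \<open>To the left of x slow decrease bounds \<open>R\<close> from above by r x + e
        / 4, so the kernel bound is applied to - R.\<close>
      have "AE y in lborel. \<bar>y - (x - \<eta>)\<bar> \<le> \<eta> \<longrightarrow> - (r x + e / 4) \<le> - R y"
        using ae
      proof eventually_elim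
        case (elim y)
        show ?case
        proof
          assume "\<bar>y - (x - \<eta>)\<bar> \<le> \<eta>"
          then have "x - y \<in> {0..d}" unfolding \<eta>_def atLeastAtMost_iff by linarith
          then show "- (r x + e / 4) \<le> - R y" using x0[of y "x - y"] x elim by auto
        qed
      qed
      from kernel_lower_bound[OF _ _ Ki K0 this, of M]
      have "- (r x + e / 4) * (2 * pi) \<le> - c (x - \<eta>) + e"
        using tl[of "- (r x + e / 4)"] r[OF x(2)] e R unfolding Kint c_def by fastforce
      then have "- (r x + e / 4) * (2 * pi) < 2 * e" using elim by linarith
      from half[OF this] have 2: "- r x < e" using e by linarith
      show ?case using 1 2 by linarith
    qed
  qed
  show ?thesis unfolding tendsto_iff dist_norm using main by simp
qed

section \<open>Boundary behaviour of Laplace transforms\<close>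

text \<open>The cut-off in size takes care of the null set on which a bound for \<open>R\<close> may
  fail: the Tauberian lemmas want a bound at every point, and adding \<open>head_part\<close> still
  gives \<open>R\<close> almost everywhere.\<close>

definition tail_part :: "real \<Rightarrow> real \<Rightarrow> (real \<Rightarrow> real) \<Rightarrow> real \<Rightarrow> real" where
  "tail_part x1 M R x = (if x \<ge> x1 \<and> \<bar>R x\<bar> \<le> M then R x else 0)"

definition head_part :: "real \<Rightarrow> (real \<Rightarrow> real) \<Rightarrow> real \<Rightarrow> real" where
  "head_part x1 R x = indicator {..<x1} x * R x"

context
  fixes R :: "real \<Rightarrow> real" and G :: "complex \<Rightarrow> complex"
  assumes R_meas [measurable]: "R \<in> borel_measurable borel"
    and R_neg: "\<And>x. x < 0 \<Longrightarrow> R x = 0"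
    and R_int: "\<And>d. d > 0 \<Longrightarrow> integrable lborel (\<lambda>x. exp (- (d * x)) * R x)"
    and G: "\<And>s. Re s > 1 \<Longrightarrow> G s = (LINT x|lborel. exp (- ((s - 1) * of_real x)) * of_real (R x))"
begin

lemma R_int_complex:
  assumes "Re s > 1"
  shows "integrable lborel (\<lambda>x. exp (- ((s - 1) * of_real x)) * complex_of_real (R x))"
proof (rule Bochner_Integration.integrable_bound)
  show "integrable lborel (\<lambda>x. exp (- ((Re s - 1) * x)) * R x)" using assms by (intro R_int) simp
qed (auto simp: norm_mult abs_mult)

text \<open>Differentiation under the integral sign, by dominated convergence of the difference
  quotients along sequences.\<close>

lemma laplace_holomorphic: "G holomorphic_on {s. Re s > 1}"
proof (subst holomorphic_on_open, rule open_halfspace_Re_gt, intro ballI)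
  fix s :: complex assume "s \<in> {s. Re s > 1}"
  then have s: "Re s > 1" by simp
  \<comment> \<open>Half the distance from s to the boundary line, so that on \<open>H\<close> the
    kernel decays at least like exp (- (d x)) uniformly in z.\<close>
  define d where "d = (Re s - 1) / 2"
  have d: "d > 0" using s by (simp add: d_def)
  define e where "e x z = exp (- ((z - 1) * of_real x))" for x :: real and z :: complex
  have e_meas [measurable]: "(\<lambda>x. e x z) \<in> borel_measurable borel" for z
    unfolding e_def by measurable
  define G' where "G' = (LINT x|lborel. - of_real x * e x s * of_real (R x))"
  have e_deriv: "(e x has_field_derivative - of_real x * e x z) (at z within A)" for x z A
    unfolding e_def by (auto intro!: derivative_eq_intros)
  define H where "H = {z. Re z > 1 + d}"
  have H: "open H" "convex H" unfolding H_def by (rule open_halfspace_Re_gt convex_halfspace_Re_gt)+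
  have sH: "s \<in> H" using s by (simp add: H_def d_def field_simps)
  have int: "integrable lborel (\<lambda>x. e x z * of_real (R x))" if "Re z > 1" for z
    unfolding e_def using that by (rule R_int_complex)
  have bound: "norm ((e x z - e x s) / (z - s) * of_real (R x)) \<le> 2 / d * \<bar>exp (- (d / 2 * x)) * R x\<bar>"
    if z: "z \<in> H" "z \<noteq> s" for x z
  proof (cases "x < 0")
    case False
    then have x: "x \<ge> 0" by simp
    have "norm (e x z - e x s) \<le> (x * exp (- (d * x))) * norm (z - s)"
    proof (rule field_differentiable_bound[OF H(2) e_deriv])
      fix w assume "w \<in> H"
      then have "d * x \<le> (Re w - 1) * x" using x by (intro mult_right_mono) (auto simp: H_def)
      then show "norm (- of_real x * e x w) \<le> x * exp (- (d * x))"
        using x by (auto simp: norm_mult e_def intro!: mult_left_mono)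
    qed (use z sH in auto)
    then have 1: "norm ((e x z - e x s) / (z - s)) \<le> x * exp (- (d * x))"
      using z by (simp add: norm_divide field_simps)
    \<comment> \<open>The factor x produced by differentiation is absorbed by half of the
      exponential decay.\<close>
    have "d / 2 * x \<le> exp (d / 2 * x)" using exp_ge_add_one_self[of "d / 2 * x"] by linarith
    then have "x \<le> 2 / d * exp (d / 2 * x)" using d by (simp add: field_simps)
    then have "x * exp (- (d * x)) \<le> 2 / d * exp (d / 2 * x) * exp (- (d * x))"
      by (intro mult_right_mono) auto
    also have "\<dots> = 2 / d * exp (- (d / 2 * x))" by (simp add: mult.assoc flip: exp_add)
    finally have 2: "norm ((e x z - e x s) / (z - s)) \<le> 2 / d * exp (- (d / 2 * x))" using 1 by linarith
    have "norm ((e x z - e x s) / (z - s) * of_real (R x)) \<le> (2 / d * exp (- (d / 2 * x))) * \<bar>R x\<bar>"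
      unfolding norm_mult norm_of_real using 2 by (intro mult_right_mono) auto
    then show ?thesis by (simp add: abs_mult)
  qed (use R_neg in simp)
  have "((\<lambda>z. (G z - G s) / (z - s)) \<longlongrightarrow> G') (at s)"
  proof (subst tendsto_at_iff_sequentially, intro allI impI)
    fix Z :: "nat \<Rightarrow> complex" assume Z: "\<forall>i. Z i \<in> UNIV - {s}" "Z \<longlonglongrightarrow> s"
    have "\<forall>\<^sub>F n in sequentially. Z n \<in> H" using topological_tendstoD[OF Z(2) H(1) sH] .
    then obtain N where N: "\<And>n. n \<ge> N \<Longrightarrow> Z n \<in> H" by (auto simp: eventually_sequentially)
    have Q: "(G (Z (n + N)) - G s) / (Z (n + N) - s) = (LINT x|lborel. (e x (Z (n + N)) - e x s) / (Z (n + N) - s) * of_real (R x))" for n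
    proof -
      have r: "Re (Z (n + N)) > 1" using N[of "n + N"] d by (simp add: H_def)
      have "G (Z (n + N)) - G s = (LINT x|lborel. e x (Z (n + N)) * of_real (R x) - e x s * of_real (R x))"
        using int[OF r] int[OF s] G[OF r] G[OF s] by (simp add: e_def)
      then show ?thesis
        by (simp only: integral_divide_zero[symmetric]) (simp add: algebra_simps diff_divide_distrib)
    qed
    have "(\<lambda>n. LINT x|lborel. (e x (Z (n + N)) - e x s) / (Z (n + N) - s) * of_real (R x)) \<longlonglongrightarrow> G'"
      unfolding G'_def
    proof (rule integral_dominated_convergence[where w="\<lambda>x. 2 / d * \<bar>exp (- (d / 2 * x)) * R x\<bar>"])
      have "(\<lambda>n. (e x (Z (n + N)) - e x s) / (Z (n + N) - s) * of_real (R x)) \<longlonglongrightarrow> - of_real x * e x s * of_real (R x)" for x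
      proof (rule tendsto_mult_right)
        have "((\<lambda>z. (e x z - e x s) / (z - s)) \<longlongrightarrow> - of_real x * e x s) (at s)"
          using e_deriv[of x s UNIV] by (simp add: has_field_derivative_iff)
        moreover have "filterlim (\<lambda>n. Z (n + N)) (at s) sequentially"
          using Z LIMSEQ_ignore_initial_segment[OF Z(2), of N] by (auto simp: filterlim_at)
        ultimately show "(\<lambda>n. (e x (Z (n + N)) - e x s) / (Z (n + N) - s)) \<longlonglongrightarrow> - of_real x * e x s"
          by (rule filterlim_compose)
      qed
      then show "AE x in lborel. (\<lambda>n. (e x (Z (n + N)) - e x s) / (Z (n + N) - s) * of_real (R x)) \<longlonglongrightarrow> - of_real x * e x s * of_real (R x)"
        by simp
      show "integrable lborel (\<lambda>x. 2 / d * \<bar>exp (- (d / 2 * x)) * R x\<bar>)"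
        using d by (intro integrable_mult_right integrable_abs R_int) simp
      show "AE x in lborel. norm ((e x (Z (n + N)) - e x s) / (Z (n + N) - s) * of_real (R x)) \<le> 2 / d * \<bar>exp (- (d / 2 * x)) * R x\<bar>" for n
        using bound N[of "n + N"] Z by simp
    qed measurable
    then have "(\<lambda>n. (G (Z (n + N)) - G s) / (Z (n + N) - s)) \<longlonglongrightarrow> G'" by (simp add: Q)
    then show "((\<lambda>z. (G z - G s) / (z - s)) \<circ> Z) \<longlonglongrightarrow> G'"
      unfolding comp_def by (rule LIMSEQ_offset)
  qed
  then show "\<exists>f'. (G has_field_derivative f') (at s)"
    by (auto simp: has_field_derivative_iff)
qed

text \<open>On the line Re s = \<sigma>, \<open>G\<close> is the Fourier transform of the damped
  function exp (- ((\<sigma> - 1) x)) R x, so the multiplication formula applies; the factor exp (i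
  h t) becomes the shift by \<open>h\<close>.\<close>

lemma boundary_integral_eq:
  assumes \<phi>: "\<phi> \<in> window_class" and \<sigma>: "\<sigma> > 1"
  shows "(LINT t|lebesgue. G (Complex \<sigma> t) * exp (\<i> * of_real (h * t)) * \<phi> t)
    = (LINT x|lborel. of_real (exp (- ((\<sigma> - 1) * x)) * R x) * fourier \<phi> (x - h))"
proof -
  note D = window_classD[OF \<phi>]
  note [measurable] = D(3)
  define f where "f x = complex_of_real (exp (- ((\<sigma> - 1) * x)) * R x)" for x
  have f: "integrable lborel f" unfolding f_def using \<sigma> by (intro integrable_of_real R_int) simp
  then have [measurable]: "f \<in> borel_measurable borel" by auto
  have Gf: "G (Complex \<sigma> t) = fourier f t" for t
  proof -
    have "G (Complex \<sigma> t) = (LINT x|lborel. exp (- ((Complex \<sigma> t - 1) * of_real x)) * of_real (R x))"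
      using \<sigma> by (intro G) simp
    moreover have "exp (- ((Complex \<sigma> t - 1) * of_real x)) = cis (- (t * x)) * of_real (exp (- ((\<sigma> - 1) * x)))" for x
      by (simp add: exp_eq_polar complex_eq_iff)
    ultimately show ?thesis by (simp add: fourier_cis f_def ac_simps)
  qed
  have "(LINT t|lebesgue. G (Complex \<sigma> t) * exp (\<i> * of_real (h * t)) * \<phi> t) =
      (LINT t|lebesgue. fourier f t * (cis (- (- h * t)) * \<phi> t))"
    by (simp add: Gf cis_conv_exp mult.assoc)
  also have "\<dots> = (LINT t|lborel. fourier f t * (cis (- (- h * t)) * \<phi> t))"
    by (rule integral_completion) (use f in measurable)
  also have "\<dots> = (LINT x|lborel. f x * fourier (\<lambda>t. cis (- (- h * t)) * \<phi> t) x)"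
    using f D by (intro integral_fourier_mult integrable_cis_mult) auto
  also have "\<dots> = (LINT x|lborel. f x * fourier \<phi> (x - h))"
    by (subst fourier_cis_mult) auto
  finally show ?thesis by (simp add: f_def)
qed

context
  fixes x1 M :: real
  assumes x1: "x1 \<ge> 0" and M: "M \<ge> 0" and R_bound: "AE x in lborel. x \<ge> x1 \<longrightarrow> \<bar>R x\<bar> \<le> M"
begin

lemma tail_part_measurable [measurable]: "tail_part x1 M R \<in> borel_measurable borel"
  unfolding tail_part_def[abs_def] by measurable

lemma tail_part_bound: "\<bar>tail_part x1 M R x\<bar> \<le> M"
  using M by (simp add: tail_part_def)

lemma head_part_integrable: "integrable lborel (head_part x1 R)"
proof (rule Bochner_Integration.integrable_bound)
  show "integrable lborel (\<lambda>x. exp x1 * (exp (- (1 * x)) * R x))"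
    by (intro integrable_mult_right R_int) simp
  have "norm (head_part x1 R x) \<le> norm (exp x1 * (exp (- (1 * x)) * R x))" for x
  proof (cases "x < x1")
    case True
    then have "1 * \<bar>R x\<bar> \<le> exp (x1 - x) * \<bar>R x\<bar>" by (intro mult_right_mono) auto
    then show ?thesis using True by (simp add: head_part_def abs_mult mult.assoc[symmetric] exp_add[symmetric])
  qed (simp add: head_part_def)
  then show "AE x in lborel. norm (head_part x1 R x) \<le> norm (exp x1 * (exp (- (1 * x)) * R x))" by simp
qed (simp add: head_part_def[abs_def])

lemma head_tail_decomposition: "AE x in lborel. R x = head_part x1 R x + tail_part x1 M R x"
  using R_bound by eventually_elim (auto simp: head_part_def tail_part_def)

lemma R_mult_fourier_integrable:
  assumes "\<phi> \<in> window_class"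
  shows "integrable lborel (\<lambda>x. complex_of_real (head_part x1 R x) * fourier \<phi> (x - h))"
    "integrable lborel (\<lambda>x. complex_of_real (tail_part x1 M R x) * fourier \<phi> (x - h))"
    "integrable lborel (\<lambda>x. complex_of_real (R x) * fourier \<phi> (x - h))"
proof -
  note D = window_classD[OF assms]
  have [measurable]: "fourier \<phi> \<in> borel_measurable borel" using D by auto
  have [measurable]: "head_part x1 R \<in> borel_measurable borel" using head_part_integrable by auto
  show 1: "integrable lborel (\<lambda>x. complex_of_real (tail_part x1 M R x) * fourier \<phi> (x - h))"
    by (rule corr_integrable[where M=M]) (use tail_part_bound assms in auto)
  show 2: "integrable lborel (\<lambda>x. complex_of_real (head_part x1 R x) * fourier \<phi> (x - h))"
  proof (rule Bochner_Integration.integrable_bound)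
    define C where "C = (LINT t|lborel. norm (\<phi> t))"
    have C: "norm (fourier \<phi> y) \<le> C" for y unfolding C_def by (rule norm_fourier_le[OF D(3)])
    have "C \<ge> 0" by (simp add: C_def)
    show "integrable lborel (\<lambda>x. head_part x1 R x * C)" using head_part_integrable by simp
    show "AE x in lborel. norm (complex_of_real (head_part x1 R x) * fourier \<phi> (x - h)) \<le> norm (head_part x1 R x * C)"
      using C \<open>C \<ge> 0\<close> by (auto simp: norm_mult abs_mult intro!: mult_left_mono)
  qed measurable
  have "integrable lborel (\<lambda>x. complex_of_real (head_part x1 R x) * fourier \<phi> (x - h) + complex_of_real (tail_part x1 M R x) * fourier \<phi> (x - h))"
    using 1 2 by simp
  then show "integrable lborel (\<lambda>x. complex_of_real (R x) * fourier \<phi> (x - h))"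
  proof (rule integrable_cong_AE_imp)
    show "AE x in lborel. complex_of_real (head_part x1 R x) * fourier \<phi> (x - h) +
        complex_of_real (tail_part x1 M R x) * fourier \<phi> (x - h) = complex_of_real (R x) * fourier \<phi> (x - h)"
      using head_tail_decomposition by eventually_elim (simp add: ring_distribs)
  qed measurable
qed

text \<open>Since \<open>R\<close> vanishes on the negative axis, the damping factor is at most 1
  where it counts, so the undamped integrand dominates. That one is integrable because its head and
  its tail are.\<close>

lemma boundary_integral_tendsto:
  assumes \<phi>: "\<phi> \<in> window_class"
  shows "((\<lambda>\<sigma>. LINT t|lebesgue. G (Complex \<sigma> t) * exp (\<i> * of_real (h * t)) * \<phi> t) \<longlongrightarrow> corr (\<lambda>x. complex_of_real (R x)) \<phi> h) (at_right 1)"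
proof (rule tendsto_at_right_sequentially[of 1 2])
  fix Z :: "nat \<Rightarrow> real" assume Z: "\<And>n. 1 < Z n" "Z \<longlonglongrightarrow> 1"
  note D = window_classD[OF \<phi>]
  have [measurable]: "fourier \<phi> \<in> borel_measurable borel" using D by auto
  have "(\<lambda>n. LINT x|lborel. of_real (exp (- ((Z n - 1) * x)) * R x) * fourier \<phi> (x - h)) \<longlonglongrightarrow> corr (\<lambda>x. complex_of_real (R x)) \<phi> h"
    unfolding corr_def
  proof (rule integral_dominated_convergence[where w="\<lambda>x. norm (complex_of_real (R x) * fourier \<phi> (x - h))"])
    have "(\<lambda>n. of_real (exp (- ((Z n - 1) * x)) * R x) * fourier \<phi> (x - h)) \<longlonglongrightarrow>
       of_real (exp (- ((1 - 1) * x)) * R x) * fourier \<phi> (x - h)" for x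
      by (intro tendsto_intros Z)
    then show "AE x in lborel. (\<lambda>n. of_real (exp (- ((Z n - 1) * x)) * R x) * fourier \<phi> (x - h)) \<longlonglongrightarrow> of_real (R x) * fourier \<phi> (x - h)"
      by simp
    have "norm (of_real (exp (- ((Z n - 1) * x)) * R x) * fourier \<phi> (x - h)) \<le> norm (complex_of_real (R x) * fourier \<phi> (x - h))" for n x
    proof (cases "x < 0")
      case False
      then have "exp (- ((Z n - 1) * x)) * (\<bar>R x\<bar> * norm (fourier \<phi> (x - h))) \<le> 1 * (\<bar>R x\<bar> * norm (fourier \<phi> (x - h)))"
        using Z(1)[of n] by (intro mult_right_mono) auto
      then show ?thesis by (simp add: norm_mult abs_mult)
    qed (simp add: R_neg)
    then show "AE x in lborel. norm (of_real (exp (- ((Z n - 1) * x)) * R x) * fourier \<phi> (x - h)) \<le> norm (complex_of_real (R x) * fourier \<phi> (x - h))" for n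
      by simp
  qed (use R_mult_fourier_integrable[OF \<phi>] in auto)
  then show "(\<lambda>n. LINT t|lebesgue. G (Complex (Z n) t) * exp (\<i> * of_real (h * t)) * \<phi> t) \<longlonglongrightarrow> corr (\<lambda>x. complex_of_real (R x)) \<phi> h"
    using boundary_integral_eq[OF \<phi> Z(1)] by simp
qed simp

text \<open>What remains is the correlation with the integrable head. For fixed \<open>x\<close> the
  transform of the window at x - h decays by Riemann-Lebesgue, and the L1 norm of the window bounds
  it uniformly.\<close>

lemma corr_minus_tail_tendsto_0:
  assumes \<phi>: "\<phi> \<in> window_class"
  shows "((\<lambda>h. corr (\<lambda>x. complex_of_real (R x)) \<phi> h - corr (\<lambda>x. of_real (tail_part x1 M R x)) \<phi> h) \<longlongrightarrow> 0) at_top"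
proof -
  note D = window_classD[OF \<phi>]
  have [measurable]: "fourier \<phi> \<in> borel_measurable borel" using D by auto
  have [measurable]: "head_part x1 R \<in> borel_measurable borel" using head_part_integrable by auto
  have "corr (\<lambda>x. complex_of_real (R x)) \<phi> h - corr (\<lambda>x. of_real (tail_part x1 M R x)) \<phi> h = (LINT x|lborel. of_real (head_part x1 R x) * fourier \<phi> (x - h))" for h
  proof -
    have "corr (\<lambda>x. complex_of_real (R x)) \<phi> h - corr (\<lambda>x. of_real (tail_part x1 M R x)) \<phi> h =
       (LINT x|lborel. of_real (R x) * fourier \<phi> (x - h) - of_real (tail_part x1 M R x) * fourier \<phi> (x - h))"
      unfolding corr_def corr_def using R_mult_fourier_integrable[OF \<phi>] by simp
    also have "\<dots> = (LINT x|lborel. of_real (head_part x1 R x) * fourier \<phi> (x - h))"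
    proof (rule integral_cong_AE)
      show "AE x in lborel. of_real (R x) * fourier \<phi> (x - h) - of_real (tail_part x1 M R x) * fourier \<phi> (x - h)
         = of_real (head_part x1 R x) * fourier \<phi> (x - h)"
        using head_tail_decomposition by eventually_elim (simp add: ring_distribs)
    qed measurable
    finally show ?thesis .
  qed
  moreover have "((\<lambda>h. LINT x|lborel. of_real (head_part x1 R x) * fourier \<phi> (x - h)) \<longlongrightarrow> (LINT (x::real)|lborel. 0)) at_top"
  proof (rule integral_dominated_convergence_at_top[where w="\<lambda>x. norm (head_part x1 R x) * (LINT t|lborel. norm (\<phi> t))"])
    have "((\<lambda>h. complex_of_real (head_part x1 R x) * fourier \<phi> (x - h)) \<longlongrightarrow> 0) at_top" for x
    proof (rule tendsto_mult_right_zero, rule filterlim_compose[of "fourier \<phi>"])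
      show "(fourier \<phi> \<longlongrightarrow> 0) at_bot" by (rule fourier_tendsto_0_at_bot[OF D(4,1)])
      show "LIM h at_top. x - h :> at_bot" by real_asymp
    qed
    then show "AE x in lborel. ((\<lambda>h. complex_of_real (head_part x1 R x) * fourier \<phi> (x - h)) \<longlongrightarrow> 0) at_top" by simp
    show "\<forall>\<^sub>F h in at_top. AE x in lborel. norm (complex_of_real (head_part x1 R x) * fourier \<phi> (x - h)) \<le> norm (head_part x1 R x) * (LINT t|lborel. norm (\<phi> t))"
      using norm_fourier_le[OF D(3)] by (intro always_eventually allI AE_I2) (auto simp: norm_mult intro!: mult_left_mono)
  qed (use head_part_integrable in \<open>auto intro!: integrable_mult_left\<close>)
  ultimately show ?thesis by simp
qed

lemma pseudofunction_imp_vanishes: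
  assumes \<phi>: "\<phi> \<in> window_class" and P: "pseudofunction_boundary_behavior G 1 \<phi>"
  shows "vanishes (\<lambda>x. of_real (tail_part x1 M R x)) \<phi>"
proof -
  obtain N I where N: "\<And>h. h \<ge> N \<Longrightarrow> ((\<lambda>\<sigma>. LINT t|lebesgue. G (Complex \<sigma> t) * exp (\<i> * of_real (h * t)) * \<phi> t) \<longlongrightarrow> I h) (at_right 1)"
    and I: "(I \<longlongrightarrow> 0) at_top"
    using P unfolding pseudofunction_boundary_behavior_def by auto
  have "I h = corr (\<lambda>x. complex_of_real (R x)) \<phi> h" if "h \<ge> N" for h
    by (rule tendsto_unique[OF _ N[OF that] boundary_integral_tendsto[OF \<phi>]]) simp
  then have "\<forall>\<^sub>F h in at_top. I h = corr (\<lambda>x. complex_of_real (R x)) \<phi> h" by (intro eventually_at_top_linorderI[of N])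
  then have "(corr (\<lambda>x. complex_of_real (R x)) \<phi> \<longlongrightarrow> 0) at_top" using I by (simp cong: tendsto_cong)
  from tendsto_diff[OF this corr_minus_tail_tendsto_0[OF \<phi>]] show ?thesis by (simp add: vanishes_def)
qed

end

text \<open>The cut \<open>x1\<close> is chosen after the tolerance: the tail beyond it contributes
  at most its bound times \<open>mass \<phi>\<close>, and the head contributes nothing in the
  limit.\<close>

lemma tendsto_0_imp_pseudofunction:
  assumes \<phi>: "\<phi> \<in> window_class"
    and lim: "\<And>e. e > 0 \<Longrightarrow> \<exists>x1\<ge>0. AE x in lborel. x \<ge> x1 \<longrightarrow> \<bar>R x\<bar> \<le> e"
  shows "pseudofunction_boundary_behavior G 1 \<phi>"
proof -
  define J where "J = corr (\<lambda>x. complex_of_real (R x)) \<phi>"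
  have lim': "(J \<longlongrightarrow> 0) at_top" unfolding tendsto_iff dist_norm
  proof (intro allI impI)
    fix e :: real assume e: "e > 0"
    \<comment> \<open>Makes e' times the mass at most e / 2; the added 1 covers windows of mass
      0.\<close>
    define e' where "e' = e / (2 * (mass \<phi> + 1))"
    have m: "mass \<phi> \<ge> 0" by (rule mass_nonneg)
    have e': "e' > 0" using e m by (simp add: e'_def)
    obtain x1 where x1: "x1 \<ge> 0" "AE x in lborel. x \<ge> x1 \<longrightarrow> \<bar>R x\<bar> \<le> e'" using lim[OF e'] by auto
    note c = x1(1) less_imp_le[OF e'] x1(2)
    define R2 where "R2 = tail_part x1 e' R"
    have "norm (corr (\<lambda>x. of_real (R2 x)) \<phi> h) \<le> e' * mass \<phi>" for h
      unfolding R2_def using tail_part_bound[OF c] tail_part_measurable[OF c] by (intro norm_corr_le \<phi>) auto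
    moreover have "e' * mass \<phi> \<le> e / 2" using e m by (simp add: e'_def field_simps)
    moreover have "((\<lambda>h. J h - corr (\<lambda>x. of_real (R2 x)) \<phi> h) \<longlongrightarrow> 0) at_top"
      using corr_minus_tail_tendsto_0[OF c \<phi>] by (simp add: J_def R2_def)
    then have "\<forall>\<^sub>F h in at_top. norm (J h - corr (\<lambda>x. of_real (R2 x)) \<phi> h - 0) < e / 2"
      using e unfolding tendsto_iff dist_norm by (meson half_gt_zero)
    ultimately have le: "norm (corr (\<lambda>x. of_real (R2 x)) \<phi> h) \<le> e / 2"
      and ev: "\<forall>\<^sub>F h in at_top. norm (J h - corr (\<lambda>x. of_real (R2 x)) \<phi> h - 0) < e / 2" for h
      by (blast intro: order_trans)+
    from ev show "\<forall>\<^sub>F h in at_top. norm (J h - 0) < e"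
    proof eventually_elim
      case (elim h)
      then show ?case
        using norm_triangle_sub[of "J h" "corr (\<lambda>x. of_real (R2 x)) \<phi> h"] le[of h]
        unfolding diff_zero by linarith
    qed
  qed
  obtain x1 where x1: "x1 \<ge> 0" "AE x in lborel. x \<ge> x1 \<longrightarrow> \<bar>R x\<bar> \<le> 1" using lim[of 1] by auto
  have "((\<lambda>\<sigma>. LINT t|lebesgue. G (Complex \<sigma> t) * exp (\<i> * of_real (h * t)) * \<phi> t) \<longlongrightarrow> J h) (at_right 1)" for h
    unfolding J_def using boundary_integral_tendsto[OF x1(1) _ x1(2) \<phi>] by simp
  then show ?thesis
    unfolding pseudofunction_boundary_behavior_def using laplace_holomorphic lim'
    by (intro conjI exI[of _ 1] exI[of _ J]) auto
qed

end

section \<open>Exponential integrals on the half-line and Borel representatives\<close>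

lemma exp_real_neg_tendsto_0:
  assumes "d > 0"
  shows "((\<lambda>y::real. exp (- (d * y))) \<longlongrightarrow> 0) at_top"
  using assms by real_asymp

lemma integrable_exp_halfline:
  assumes d: "d > 0"
  shows "integrable lborel (\<lambda>x::real. indicator {0..} x * exp (- (d * x)))"
proof (rule integrable_monotone_convergence_at_top)
  have FTC: "has_bochner_integral lborel (\<lambda>x::real. indicator {0..y} x *\<^sub>R exp (- (d * x))) (- exp (- (d * y)) / d - - exp (- (d * 0)) / d)"
    if "y \<ge> 0" for y
    by (rule has_bochner_integral_FTC_Icc[OF that])
       (use d in \<open>auto intro!: derivative_eq_intros continuous_intros simp: has_real_derivative_iff_has_vector_derivative[symmetric]\<close>)
  have eq: "indicator {0..} x * exp (- (d * x)) * indicator {..y} x = indicator {0..y} x *\<^sub>R exp (- (d * x))" for x y :: real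
    by (auto simp: indicator_def)
  show "integrable lborel (\<lambda>x. indicator {0..} x * exp (- (d * x)) * indicator {..y} x)" for y :: real
    unfolding eq by (cases "y \<ge> 0") (rule integrable.intros[OF FTC], auto)
  have "((\<lambda>y. - exp (- (d * y)) / d - - exp (- (d * 0)) / d) \<longlongrightarrow> - 0 / d - - exp (- (d * 0)) / d) at_top"
    using d by (intro tendsto_intros exp_real_neg_tendsto_0) auto
  moreover have "\<forall>\<^sub>F y in at_top. - exp (- (d * y)) / d - - exp (- (d * 0)) / d = (LINT x|lborel. indicator {0..} x * exp (- (d * x)) * indicator {..y} x)"
    using eventually_ge_at_top[of 0]
    by eventually_elim (simp only: eq has_bochner_integral_integral_eq[OF FTC])
  ultimately show "((\<lambda>y. LINT x|lborel. indicator {0..} x * exp (- (d * x)) * indicator {..y} x) \<longlongrightarrow> - 0 / d - - exp (- (d * 0)) / d) at_top"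
    by (rule Lim_transform_eventually)
qed auto

text \<open>With z = s - 1 this writes the pole a / (s - 1) as an integral, so that subtracting the
  pole becomes subtracting \<open>a\<close> from S(x) exp (- x).\<close>

lemma integral_exp_halfline:
  assumes z: "Re z > 0"
  shows "integrable lborel (\<lambda>x. indicator {0..} x *\<^sub>R exp (- (z * of_real x)))"
    and "(LINT x|lborel. indicator {0..} x *\<^sub>R exp (- (z * of_real x))) = 1 / z"
proof -
  show i: "integrable lborel (\<lambda>x. indicator {0..} x *\<^sub>R exp (- (z * of_real x)))"
    by (rule Bochner_Integration.integrable_bound[OF integrable_exp_halfline[OF z]]) auto
  have z0: "z \<noteq> 0" using z by auto
  have der: "((\<lambda>x. - exp (- (z * of_real x)) / z) has_vector_derivative exp (- (z * of_real x))) (at x within A)" for x A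
  proof -
    have "((\<lambda>w. - exp (- (z * w)) / z) has_field_derivative exp (- (z * w))) (at w)" for w
      using z0 by (auto intro!: derivative_eq_intros)
    from has_vector_derivative_real_field[OF this] show ?thesis .
  qed
  have FTC: "has_bochner_integral lborel (\<lambda>x. indicator {0..y} x *\<^sub>R exp (- (z * of_real x))) (- exp (- (z * of_real y)) / z - - exp (- (z * of_real 0)) / z)"
    if "y \<ge> 0" for y
    by (rule has_bochner_integral_FTC_Icc[OF that der]) (auto intro!: continuous_intros)
  have eq: "indicator {..y} x *\<^sub>R (indicator {0..} x *\<^sub>R exp (- (z * of_real x))) = indicator {0..y} x *\<^sub>R exp (- (z * of_real x))" for x y :: real
    by (auto simp: indicator_def)
  have "((\<lambda>y. exp (- (z * of_real y))) \<longlongrightarrow> 0) at_top"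
    by (rule tendsto_norm_zero_cancel) (use exp_real_neg_tendsto_0[OF z] in simp)
  then have "((\<lambda>y. - exp (- (z * of_real y)) / z - - exp (- (z * of_real 0)) / z) \<longlongrightarrow> - 0 / z - - exp (- (z * of_real 0)) / z) at_top"
    using z0 by (intro tendsto_intros) auto
  moreover have "\<forall>\<^sub>F y in at_top. - exp (- (z * of_real y)) / z - - exp (- (z * of_real 0)) / z
      = (LINT x|lborel. indicator {..y} x *\<^sub>R (indicator {0..} x *\<^sub>R exp (- (z * of_real x))))"
    using eventually_ge_at_top[of 0]
    by eventually_elim (simp only: eq has_bochner_integral_integral_eq[OF FTC])
  ultimately have "((\<lambda>y. LINT x|lborel. indicator {..y} x *\<^sub>R (indicator {0..} x *\<^sub>R exp (- (z * of_real x)))) \<longlongrightarrow> - 0 / z - - exp (- (z * of_real 0)) / z) at_top"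
    by (rule Lim_transform_eventually)
  from tendsto_unique[OF _ tendsto_integral_at_top[OF _ i] this]
  show "(LINT x|lborel. indicator {0..} x *\<^sub>R exp (- (z * of_real x))) = 1 / z" by simp
qed

text \<open>\<open>S\<close> is only Lebesgue measurable and arbitrary at negative arguments; the
  representative is Borel and 0 there, so integrals can run over the whole line.\<close>

lemma locally_integrable_borel_version:
  assumes "locally_integrable_halfline S"
  obtains f where "f \<in> borel_measurable borel" "\<And>x. x < 0 \<Longrightarrow> f x = 0"
    "AE x in lborel. x \<ge> 0 \<longrightarrow> f x = S x"
    "\<And>b. integrable lborel (\<lambda>x. indicator {..b} x * f x)"
proof -
  have int: "integrable lebesgue (\<lambda>x. indicator {0..b} x * S x)" if "b \<ge> 0" for b
    using assms that by (simp add: locally_integrable_halfline_def set_integrable_def)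
  define T where "T x = indicator {0..} x * S x" for x
  \<comment> \<open>Local integrability gives measurability of the truncations only; their pointwise
    limit is measurable on the whole half-line.\<close>
  have "T \<in> borel_measurable lebesgue"
  proof (rule borel_measurable_LIMSEQ_real)
    show "(\<lambda>x. indicator {0..real n} x * S x) \<in> borel_measurable lebesgue" for n
      using int[of "real n"] by auto
    show "(\<lambda>n. indicator {0..real n} x * S x) \<longlonglongrightarrow> T x" for x
    proof (rule tendsto_eventually)
      obtain N :: nat where "x \<le> real N" using real_arch_simple by blast
      then show "\<forall>\<^sub>F n in sequentially. indicator {0..real n} x * S x = T x"
        by (intro eventually_sequentiallyI[of N]) (auto simp: indicator_def T_def)
    qed
  qed
  then obtain g where g: "g \<in> borel_measurable lborel" "AE x in lborel. T x = g x"
    using completion_ex_borel_measurable_real by blast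
  have [measurable]: "g \<in> borel_measurable borel" using g by simp
  define f where "f x = indicator {0..} x * g x" for x
  have f [measurable]: "f \<in> borel_measurable borel" unfolding f_def by measurable
  have ae: "AE x in lborel. x \<ge> 0 \<longrightarrow> f x = S x"
    using g(2) by eventually_elim (auto simp: f_def T_def indicator_def)
  have "integrable lborel (\<lambda>x. indicator {..b} x * f x)" for b
  proof -
    have m: "(\<lambda>x. indicator {..b} x * f x) \<in> borel_measurable lborel" by measurable
    have "integrable lebesgue (\<lambda>x. indicator {..b} x * f x)"
    proof (rule integrable_cong_AE_imp)
      show "integrable lebesgue (\<lambda>x. indicator {..b} x *\<^sub>R (indicator {0..max b 0} x * S x))"
        by (rule integrable_mult_indicator) (use int[of "max b 0"] in auto)
      show "(\<lambda>x. indicator {..b} x * f x) \<in> borel_measurable lebesgue"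
        using m by (rule measurable_completion)
      show "AE x in lebesgue. indicator {..b} x *\<^sub>R (indicator {0..max b 0} x * S x) = indicator {..b} x * f x"
        by (rule AE_completion, use ae in eventually_elim) (auto simp: f_def indicator_def)
    qed
    then show ?thesis by (subst (asm) integrable_completion[OF m])
  qed
  moreover have "f x = 0" if "x < 0" for x using that by (simp add: f_def)
  ultimately show thesis using that[OF f _ ae] by blast
qed

lemma laplace_partial_borel_version:
  assumes [measurable]: "f \<in> borel_measurable borel" and f0: "\<And>x. x < 0 \<Longrightarrow> f x = 0"
    and ae: "AE x in lborel. x \<ge> 0 \<longrightarrow> f x = S x"
  shows "laplace_partial S s T = (LINT x|lborel. indicator {..T} x *\<^sub>R (exp (- (s * of_real x)) * of_real (f x)))"
proof -
  let ?F = "\<lambda>x. indicator {..T} x *\<^sub>R (exp (- (s * of_real x)) * complex_of_real (f x))"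
  have m: "?F \<in> borel_measurable lborel" by measurable
  have ae': "AE x in lebesgue. indicator {0..T} x *\<^sub>R (exp (- (s * of_real x)) * complex_of_real (S x)) = ?F x"
    by (rule AE_completion, use ae in eventually_elim) (auto simp: f0 indicator_def)
  have "integral\<^sup>L lebesgue (\<lambda>x. indicator {0..T} x *\<^sub>R (exp (- (s * of_real x)) * complex_of_real (S x))) = integral\<^sup>L lebesgue ?F"
  proof (rule integral_cong_AE[OF _ _ ae'])
    show m': "?F \<in> borel_measurable lebesgue" using m by (rule measurable_completion)
    \<comment> \<open>Completeness of the measure makes the integrand with \<open>S\<close>
      measurable, as it agrees almost everywhere with the Borel one.\<close>
    have "AE x in lebesgue. ?F x = indicator {0..T} x *\<^sub>R (exp (- (s * of_real x)) * complex_of_real (S x))"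
      using ae' by eventually_elim (rule sym)
    with m' show "(\<lambda>x. indicator {0..T} x *\<^sub>R (exp (- (s * of_real x)) * complex_of_real (S x))) \<in> borel_measurable lebesgue"
      by (rule borel_measurable_AE)
  qed
  also have "\<dots> = integral\<^sup>L lborel ?F" using m by (rule integral_completion)
  finally show ?thesis by (simp add: laplace_partial_def set_lebesgue_integral_def)
qed

section \<open>Laplace transforms of slowly decreasing functions\<close>

text \<open>Here \<open>f\<close> stands for the Borel representative of \<open>S\<close>. The
  indicator removes the constant - a on the negative axis, where it would not be integrable against
  exp (- (d x)).\<close>

definition excess :: "(real \<Rightarrow> real) \<Rightarrow> real \<Rightarrow> real \<Rightarrow> real" where
  "excess f a x = indicator {0..} x * (f x * exp (- x) - a)"

lemma excess_measurable [measurable]: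
  assumes [measurable]: "f \<in> borel_measurable borel"
  shows "excess f a \<in> borel_measurable borel"
  unfolding excess_def[abs_def] by measurable

lemma excess_neg: "x < 0 \<Longrightarrow> excess f a x = 0"
  by (simp add: excess_def)

context
  fixes S f :: "real \<Rightarrow> real"
  assumes f_meas [measurable]: "f \<in> borel_measurable borel" and f_neg: "\<And>x. x < 0 \<Longrightarrow> f x = 0"
    and f_ae: "AE x in lborel. x \<ge> 0 \<longrightarrow> f x = S x"
    and f_loc: "\<And>b. integrable lborel (\<lambda>x. indicator {..b} x * f x)"
begin

lemma laplace_partial_eq:
  "laplace_partial S s = (\<lambda>T. LINT x|lborel. indicator {..T} x *\<^sub>R (exp (- (s * of_real x)) * of_real (f x)))"
  by (rule ext, rule laplace_partial_borel_version) (use f_neg f_ae in auto)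

context
  assumes f_int: "\<And>\<sigma>. \<sigma> > 1 \<Longrightarrow> integrable lborel (\<lambda>x. exp (- (\<sigma> * x)) * f x)"
begin

lemma excess_integrable:
  assumes d: "d > 0"
  shows "integrable lborel (\<lambda>x. exp (- (d * x)) * excess f a x)"
proof -
  have "exp (- (d * x)) * excess f a x = exp (- ((1 + d) * x)) * f x - a * (indicator {0..} x * exp (- (d * x)))" for x
  proof -
    have "exp (- (d * x)) * exp (- x) = exp (- ((1 + d) * x))"
      by (simp add: algebra_simps flip: exp_add)
    then have "exp (- (d * x)) * (f x * exp (- x)) = exp (- ((1 + d) * x)) * f x"
      by (metis mult.commute mult.left_commute)
    then show ?thesis using f_neg[of x] by (auto simp: excess_def indicator_def right_diff_distrib)
  qed
  then show ?thesis
    using f_int[of "1 + d"] integrable_exp_halfline[OF d] d by simp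
qed

lemma laplace_tendsto:
  assumes s: "Re s > 1"
  shows "(laplace_partial S s \<longlongrightarrow> (LINT x|lborel. exp (- (s * of_real x)) * of_real (f x))) at_top"
proof -
  have i: "integrable lborel (\<lambda>x. exp (- (s * of_real x)) * complex_of_real (f x))"
  proof (rule Bochner_Integration.integrable_bound)
    show "integrable lborel (\<lambda>x. exp (- (Re s * x)) * f x)" using s by (rule f_int)
  qed (auto simp: norm_mult abs_mult)
  from tendsto_integral_at_top[OF _ i] show ?thesis
    by (simp add: laplace_partial_eq)
qed

lemma laplace_converges_halfplane: "Re s > 1 \<Longrightarrow> laplace_converges S s"
  unfolding laplace_converges_def using laplace_tendsto by blast

lemma laplace_minus_pole:
  assumes s: "Re s > 1"
  shows "laplace S s - of_real a / (s - 1) = (LINT x|lborel. exp (- ((s - 1) * of_real x)) * of_real (excess f a x))"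
proof -
  have i: "integrable lborel (\<lambda>x. exp (- (s * of_real x)) * complex_of_real (f x))"
  proof (rule Bochner_Integration.integrable_bound)
    show "integrable lborel (\<lambda>x. exp (- (Re s * x)) * f x)" using s by (rule f_int)
  qed (auto simp: norm_mult abs_mult)
  have s1: "Re (s - 1) > 0" using s by simp
  note e = integral_exp_halfline[OF s1]
  have "laplace S s = (LINT x|lborel. exp (- (s * of_real x)) * of_real (f x))"
    unfolding laplace_def using laplace_tendsto[OF s] by (intro tendsto_Lim) auto
  then have "laplace S s - of_real a / (s - 1) =
      (LINT x|lborel. exp (- (s * of_real x)) * of_real (f x)) - (LINT x|lborel. of_real a * (indicator {0..} x *\<^sub>R exp (- ((s - 1) * of_real x))))"
    unfolding integral_mult_right_zero e(2) by simp
  also have "\<dots> = (LINT x|lborel. exp (- (s * of_real x)) * of_real (f x) - of_real a * (indicator {0..} x *\<^sub>R exp (- ((s - 1) * of_real x))))"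
    using i e(1) by (intro Bochner_Integration.integral_diff[symmetric] integrable_mult_right)
  also have "(\<lambda>x. exp (- (s * of_real x)) * of_real (f x) - of_real a * (indicator {0..} x *\<^sub>R exp (- ((s - 1) * of_real x))))
      = (\<lambda>x. exp (- ((s - 1) * of_real x)) * complex_of_real (excess f a x))"
  proof
    fix x :: real
    have "exp (- (s * of_real x)) = exp (- ((s - 1) * of_real x)) * of_real (exp (- x))"
      by (simp add: algebra_simps exp_of_real[symmetric] flip: exp_add)
    then have "exp (- ((s - 1) * of_real x)) * complex_of_real (f x * exp (- x)) = exp (- (s * of_real x)) * of_real (f x)"
      by simp
    then show "exp (- (s * of_real x)) * of_real (f x) - of_real a * (indicator {0..} x *\<^sub>R exp (- ((s - 1) * of_real x)))
      = exp (- ((s - 1) * of_real x)) * complex_of_real (excess f a x)"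
      using f_neg[of x] by (auto simp: excess_def indicator_def right_diff_distrib)
  qed
  finally show ?thesis .
qed

end

lemma f_exp_loc_integrable:
  assumes "\<sigma> \<ge> 0"
  shows "integrable lborel (\<lambda>x. indicator {..y} x * (exp (- (\<sigma> * x)) * f x))"
proof (rule Bochner_Integration.integrable_bound[OF f_loc[of y]])
  have "exp (- (\<sigma> * x)) * \<bar>f x\<bar> \<le> \<bar>f x\<bar>" for x
  proof (cases "x < 0")
    case False
    then have "exp (- (\<sigma> * x)) * \<bar>f x\<bar> \<le> 1 * \<bar>f x\<bar>" using assms by (intro mult_right_mono) auto
    then show ?thesis by simp
  qed (simp add: f_neg)
  then show "AE x in lborel. norm (indicator {..y} x * (exp (- (\<sigma> * x)) * f x)) \<le> norm (indicator {..y} x * f x)"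
    by (auto simp: abs_mult indicator_def)
qed measurable

text \<open>Adding \<open>C * E\<close> makes the integrand non-negative beyond \<open>x0\<close>,
  and for non-negative functions convergence of the truncated integrals is integrability, by
  monotone convergence. So a one-sided bound upgrades conditional to absolute convergence.\<close>

lemma integrable_if_bounded_below:
  assumes conv: "laplace_converges S (of_real \<sigma>)" and \<sigma>: "\<sigma> > 1" and x0: "x0 \<ge> 0" and C: "C \<ge> 0"
    and below: "\<And>x. x \<ge> x0 \<Longrightarrow> S x \<ge> - C * exp x"
  shows "integrable lborel (\<lambda>x. exp (- (\<sigma> * x)) * f x)"
proof -
  define g where "g x = exp (- (\<sigma> * x)) * f x" for x
  have [measurable]: "g \<in> borel_measurable borel" unfolding g_def by measurable
  have g_loc: "integrable lborel (\<lambda>x. indicator {..y} x * g x)" for y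
    unfolding g_def using \<sigma> by (intro f_exp_loc_integrable) simp
  define E where "E x = indicator {x0..} x * exp (- ((\<sigma> - 1) * x))" for x
  have [measurable]: "E \<in> borel_measurable borel" unfolding E_def by measurable
  have E: "integrable lborel E"
    by (rule Bochner_Integration.integrable_bound[OF integrable_exp_halfline[of "\<sigma> - 1"]])
       (use \<sigma> x0 in \<open>auto simp: E_def indicator_def\<close>)
  have g_head: "integrable lborel (\<lambda>x. indicator {..<x0} x * g x)"
    by (rule Bochner_Integration.integrable_bound[OF g_loc[of x0]]) (auto simp: indicator_def)
  define u where "u x = indicator {x0..} x * g x + C * E x" for x
  have [measurable]: "u \<in> borel_measurable borel" unfolding u_def by measurable
  have E_loc: "integrable lborel (\<lambda>x. indicator {..y} x * E x)" for y
    by (rule Bochner_Integration.integrable_bound[OF E]) (auto simp: indicator_def)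
  \<comment> \<open>A truncation of \<open>u\<close> is the partial Laplace integrand minus a fixed
    head plus a truncated exponential, so its integral inherits convergence.\<close>
  have ueq: "u x * indicator {..y} x = (indicator {..y} x * g x - indicator {..<x0} x * g x) + C * (indicator {..y} x * E x)"
    if "y \<ge> x0" for x y using that by (auto simp: u_def indicator_def)
  obtain L where L: "(laplace_partial S (of_real \<sigma>) \<longlongrightarrow> L) at_top" using conv by (auto simp: laplace_converges_def)
  have "laplace_partial S (of_real \<sigma>) y = of_real (LINT x|lborel. indicator {..y} x * g x)" for y
    unfolding laplace_partial_eq
    by (simp add: g_def scaleR_conv_of_real exp_of_real[symmetric] flip: integral_complex_of_real)
  then have "((\<lambda>y. Re (of_real (LINT x|lborel. indicator {..y} x * g x))) \<longlongrightarrow> Re L) at_top"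
    using tendsto_Re[OF L] by simp
  then have A: "((\<lambda>y. LINT x|lborel. indicator {..y} x * g x) \<longlongrightarrow> Re L) at_top" by simp
  have B: "((\<lambda>y. LINT x|lborel. indicator {..y} x * E x) \<longlongrightarrow> (LINT x|lborel. E x)) at_top"
    using tendsto_integral_at_top[OF _ E] by simp
  have u: "integrable lborel u"
  proof (rule integrable_monotone_convergence_at_top)
    show "AE x in lborel. 0 \<le> u x"
      using f_ae
    proof eventually_elim
      case (elim x)
      show ?case
      proof (cases "x \<ge> x0")
        case True
        then have "exp (- (\<sigma> * x)) * (- C * exp x) \<le> exp (- (\<sigma> * x)) * f x"
          using below[of x] elim x0 by (intro mult_left_mono) auto
        moreover have "exp (- (\<sigma> * x)) * exp x = exp (- ((\<sigma> - 1) * x))"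
          by (simp add: algebra_simps flip: exp_add)
        ultimately show ?thesis using True by (simp add: u_def g_def E_def mult.left_commute)
      qed (simp add: u_def E_def)
    qed
    show "integrable lborel (\<lambda>x. u x * indicator {..y} x)" for y
    proof (cases "y \<ge> x0")
      case True
      show ?thesis unfolding ueq[OF True] using g_loc g_head E_loc by simp
    next
      case False
      then have "(\<lambda>x. u x * indicator {..y} x) = (\<lambda>_. 0)" by (auto simp: u_def E_def indicator_def)
      then show ?thesis by simp
    qed
    have "((\<lambda>y. (LINT x|lborel. indicator {..y} x * g x) - (LINT x|lborel. indicator {..<x0} x * g x) + C * (LINT x|lborel. indicator {..y} x * E x))
       \<longlongrightarrow> Re L - (LINT x|lborel. indicator {..<x0} x * g x) + C * (LINT x|lborel. E x)) at_top"
      by (intro tendsto_intros A B)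
    moreover have "\<forall>\<^sub>F y in at_top. (LINT x|lborel. indicator {..y} x * g x) - (LINT x|lborel. indicator {..<x0} x * g x) + C * (LINT x|lborel. indicator {..y} x * E x)
        = (LINT x|lborel. u x * indicator {..y} x)"
      using eventually_ge_at_top[of x0]
      by eventually_elim (simp add: ueq g_loc g_head E_loc)
    ultimately show "((\<lambda>y. LINT x|lborel. u x * indicator {..y} x)
       \<longlongrightarrow> Re L - (LINT x|lborel. indicator {..<x0} x * g x) + C * (LINT x|lborel. E x)) at_top"
      by (rule Lim_transform_eventually)
  qed auto
  have "g = (\<lambda>x. u x + indicator {..<x0} x * g x - C * E x)"
    by (auto simp: u_def indicator_def fun_eq_iff)
  moreover have "integrable lborel (\<lambda>x. u x + indicator {..<x0} x * g x - C * E x)"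
    using u g_head E by simp
  ultimately have "integrable lborel g" by (rule ssubst[where P="integrable lborel"])
  then show ?thesis by (simp add: g_def[abs_def])
qed

end

section \<open>One-sided and two-sided bounds from slow decrease\<close>

lemma log_linearly_slowly_decreasingD:
  assumes "log_linearly_slowly_decreasing S" "e > 0"
  obtains d x0 where "d > 0" "x0 \<ge> 0" "\<And>x h. x \<ge> x0 \<Longrightarrow> 0 \<le> h \<Longrightarrow> h \<le> d \<Longrightarrow> S (x + h) \<ge> S x - e * exp x"
proof -
  obtain d x0 where d: "d > 0" "x0 \<ge> 0" and *: "\<And>h x. 0 \<le> h \<and> h \<le> d \<and> x \<ge> x0 \<Longrightarrow> (S (x + h) - S x) * exp (- x) \<ge> - e"
    using assms unfolding log_linearly_slowly_decreasing_def by metis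
  show thesis
  proof (rule that[OF d])
    fix x h assume "x \<ge> x0" "0 \<le> h" "h \<le> d"
    then have "- e * exp x \<le> ((S (x + h) - S x) * exp (- x)) * exp x" using *[of h x] by (intro mult_right_mono) auto
    also have "\<dots> = S (x + h) - S x" by (simp add: mult.assoc flip: exp_add)
    finally show "S (x + h) \<ge> S x - e * exp x" by simp
  qed
qed

text \<open>Going back from x in steps of length d, the losses are at most exp (x - d), exp (x - 2
  d), and so on: a geometric series whose sum is a constant multiple of exp x.\<close>

lemma log_linearly_slowly_decreasing_bounded_below:
  assumes "log_linearly_slowly_decreasing S"
  obtains C x0 where "C \<ge> 0" "x0 \<ge> 0" "\<And>x. x \<ge> x0 \<Longrightarrow> S x \<ge> - C * exp x"
proof -
  obtain d x0 where d: "d > 0" "x0 \<ge> 0" and step: "\<And>x h. x \<ge> x0 \<Longrightarrow> 0 \<le> h \<Longrightarrow> h \<le> d \<Longrightarrow> S (x + h) \<ge> S x - 1 * exp x"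
    using log_linearly_slowly_decreasingD[OF assms, of 1] by auto
  \<comment> \<open>Chosen so that K exp d = K + exp d, which is at least K + 1: the loss of one
    further step is then absorbed and the induction closes. K is also at least 1, which covers the
    first, incomplete step.\<close>
  define K where "K = 1 + 1 / (exp d - 1)"
  have ed: "exp d > 1" using d by simp
  have K1: "K \<ge> 1" using ed by (simp add: K_def)
  have "(1 + 1 / t) * t = t + 1" if "t > 0" for t :: real using that by (simp add: field_simps)
  from this[of "exp d - 1"] have "K * (exp d - 1) = (exp d - 1) + 1" using ed by (simp add: K_def)
  then have "K * exp d - K = exp d" by (simp add: right_diff_distrib)
  then have K: "K + 1 \<le> K * exp d" using ed by linarith
  have *: "S x \<ge> S x0 - K * exp x" if "x0 \<le> x" "x \<le> x0 + (real n + 1) * d" for n x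
    using that
  proof (induction n arbitrary: x)
    case 0
    then have "S (x0 + (x - x0)) \<ge> S x0 - 1 * exp x0" by (intro step) auto
    moreover have "1 * exp x0 \<le> K * exp x" using K1 0 by (intro mult_mono) auto
    ultimately show ?case by simp
  next
    case (Suc n)
    show ?case
    proof (cases "x \<le> x0 + d")
      case True
      then have "S (x0 + (x - x0)) \<ge> S x0 - 1 * exp x0" using Suc.prems by (intro step) auto
      moreover have "1 * exp x0 \<le> K * exp x" using K1 Suc.prems by (intro mult_mono) auto
      ultimately show ?thesis by simp
    next
      case False
      have "S (x - d) \<ge> S x0 - K * exp (x - d)"
        using False Suc.prems by (intro Suc.IH) (auto simp: algebra_simps)
      moreover have "S (x - d + d) \<ge> S (x - d) - 1 * exp (x - d)" using False d by (intro step) auto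
      moreover have "(K + 1) * exp (x - d) \<le> (K * exp d) * exp (x - d)" using K by (intro mult_right_mono) auto
      moreover have "(K * exp d) * exp (x - d) = K * exp x" by (simp add: mult.assoc flip: exp_add)
      ultimately show ?thesis by (simp add: ring_distribs)
    qed
  qed
  show thesis
  \<comment> \<open>As x0 is non-negative, exp x is at least 1, so the constant S x0 can be absorbed
    into a multiple of exp x.\<close>
  proof (rule that[of "\<bar>S x0\<bar> + K" x0])
    fix x assume x: "x \<ge> x0"
    obtain n :: nat where "(x - x0) / d \<le> real n" using real_arch_simple by blast
    then have "x - x0 \<le> real n * d" using d by (simp add: field_simps)
    then have "x \<le> x0 + (real n + 1) * d" using d by (simp add: ring_distribs)
    then have "S x \<ge> S x0 - K * exp x" using * x by blast
    moreover have "\<bar>S x0\<bar> * 1 \<le> \<bar>S x0\<bar> * exp x" using x d by (intro mult_left_mono) auto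
    ultimately show "S x \<ge> - (\<bar>S x0\<bar> + K) * exp x" by (simp add: ring_distribs)
  qed (use K1 d in auto)
qed

text \<open>Testing the boundary behaviour against a non-negative kernel bounds the averages of \<open>S(x) exp (- x)\<close>
  over short intervals; as \<open>S\<close> cannot drop quickly, this bounds \<open>S\<close> itself.\<close>

lemma slowly_decreasing_bounded_above:
  fixes S f :: "real \<Rightarrow> real"
  assumes [measurable]: "f \<in> borel_measurable borel" and f_neg: "\<And>x. x < 0 \<Longrightarrow> f x = 0"
    and f_ae: "AE x in lborel. x \<ge> 0 \<longrightarrow> f x = S x"
    and f_loc: "\<And>b. integrable lborel (\<lambda>x. indicator {..b} x * f x)"
    and f_int: "\<And>\<sigma>. \<sigma> > 1 \<Longrightarrow> integrable lborel (\<lambda>x. exp (- (\<sigma> * x)) * f x)"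
    and slow: "log_linearly_slowly_decreasing S"
    and \<phi>: "\<phi> \<in> window_class" "\<phi> 0 \<noteq> 0" "\<And>x. fourier \<phi> x \<in> \<real>\<^sub>\<ge>\<^sub>0"
    and pf: "pseudofunction_boundary_behavior (\<lambda>s. laplace S s - of_real a / (s - 1)) 1 \<phi>"
  obtains M x1 where "\<And>x. x \<ge> x1 \<Longrightarrow> S x \<le> M * exp x"
proof -
  note D = window_classD[OF \<phi>(1)]
  define R where "R = excess f a"
  have R_meas [measurable]: "R \<in> borel_measurable borel" unfolding R_def by measurable
  have R_neg: "R x = 0" if "x < 0" for x using that by (simp add: R_def excess_neg)
  have R_int: "integrable lborel (\<lambda>x. exp (- (d * x)) * R x)" if "d > 0" for d
    unfolding R_def using f_neg f_ae f_loc f_int that by (intro excess_integrable[where S=S]) auto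
  have G: "laplace S s - of_real a / (s - 1) = (LINT x|lborel. exp (- ((s - 1) * of_real x)) * of_real (R x))" if "Re s > 1" for s
    unfolding R_def using f_neg f_ae f_loc f_int that by (intro laplace_minus_pole) auto
  obtain C x0 where C: "C \<ge> 0" "x0 \<ge> 0" and below: "\<And>x. x \<ge> x0 \<Longrightarrow> S x \<ge> - C * exp x"
    using log_linearly_slowly_decreasing_bounded_below[OF slow] by metis
  obtain d x0' where d: "d > 0" "x0' \<ge> 0" and step: "\<And>x h. x \<ge> x0' \<Longrightarrow> 0 \<le> h \<Longrightarrow> h \<le> d \<Longrightarrow> S (x + h) \<ge> S x - 1 * exp x"
    using log_linearly_slowly_decreasingD[OF slow, of 1] by auto
  define k where "k x = Re (fourier \<phi> x)" for x
  have k: "fourier \<phi> x = of_real (k x)" "k x \<ge> 0" for x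
    using \<phi>(3)[of x] by (auto simp: k_def complex_nonneg_Reals_iff complex_eq_iff)
  have k_int: "integrable lborel k" unfolding k_def[abs_def] using D(2) by auto
  have k_cont: "continuous_on UNIV k" unfolding k_def[abs_def] by (intro continuous_intros continuous_fourier D(4))
  have [measurable]: "k \<in> borel_measurable borel" using k_int by auto
  define B where "B = (LINT t|lborel. norm (\<phi> t))"
  have kB: "k x \<le> B" for x
    using norm_fourier_le[OF D(3), of x] complex_Re_le_cmod[of "fourier \<phi> x"] by (simp add: k_def B_def)
  have B0: "B \<ge> 0" by (simp add: B_def)
  \<comment> \<open>Otherwise the transform would vanish identically, and inversion at 0 would give
    \<phi> 0 = 0.\<close>
  have "\<exists>y0. k y0 > 0"
  proof (rule ccontr)
    assume "\<nexists>y0. k y0 > 0"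
    then have "fourier \<phi> x = 0" for x using k[of x] by (metis antisym_conv not_le of_real_0)
    moreover have "of_real (2 * pi) * \<phi> 0 = (LINT x|lborel. fourier \<phi> x * cis (x * 0))"
      using D(5) fourier_inversion[OF D(4,1) _ D(2)] by blast
    ultimately show False using \<phi>(2) by simp
  qed
  then obtain y0 where y0: "k y0 > 0" by blast
  define c where "c = k y0 / 2"
  have c: "c > 0" using y0 by (simp add: c_def)
  have "isCont k y0" using k_cont by (simp add: continuous_on_eq_continuous_at)
  then have "\<exists>s>0. \<forall>x. dist x y0 < s \<longrightarrow> dist (k x) (k y0) < c"
    using c unfolding continuous_at_eps_delta dist_real_def by blast
  then obtain s where s: "s > 0" "\<And>x. \<bar>x - y0\<bar> < s \<Longrightarrow> \<bar>k x - k y0\<bar> < c" by (auto simp: dist_real_def)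
  \<comment> \<open>Three demands on the window length: s / 2 keeps k at least c on
    [y0, y0 + \<eta>], d allows a single step of slow decrease, and 1 bounds exp (- \<eta>) below by
    exp (- 1).\<close>
  define \<eta> where "\<eta> = min (s / 2) (min d 1)"
  have \<eta>: "\<eta> > 0" "\<eta> \<le> 1" "\<eta> \<le> d" "\<eta> < s" using s d by (auto simp: \<eta>_def min_def)
  have kc: "k x \<ge> c" if "x \<in> {y0..y0 + \<eta>}" for x
  proof -
    have "\<bar>x - y0\<bar> < s" using that \<eta> by auto
    from s(2)[OF this] have "\<bar>k x - k y0\<bar> < c" .
    moreover have "k y0 = c + c" by (simp add: c_def)
    ultimately show ?thesis by linarith
  qed
  define C1 where "C1 = C + \<bar>a\<bar>"
  have C1: "C1 \<ge> 0" "C1 \<ge> \<bar>a\<bar>" using C by (auto simp: C1_def)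
  have R_below: "AE x in lborel. x \<ge> x0 \<longrightarrow> R x \<ge> - C1"
    using f_ae
  proof eventually_elim
    case (elim x)
    show ?case
    proof
      assume x: "x \<ge> x0"
      have "- C * exp x * exp (- x) \<le> S x * exp (- x)" using below[OF x] by (intro mult_right_mono) auto
      then have "- C \<le> S x * exp (- x)" by (simp add: mult.assoc flip: exp_add)
      then show "R x \<ge> - C1" using x elim C by (simp add: R_def excess_def C1_def)
    qed
  qed
  define H where "H = (LINT x|lborel. indicator {..<x0} x * \<bar>R x\<bar>)"
  have R_ind: "integrable lborel (\<lambda>x. indicator {..b} x * R x)" for b
  proof (rule Bochner_Integration.integrable_bound)
    show "integrable lborel (\<lambda>x. exp b * (exp (- (1 * x)) * R x))" by (intro integrable_mult_right R_int) simp
    have "\<bar>R x\<bar> \<le> exp (b - x) * \<bar>R x\<bar>" if "x \<le> b" for x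
      using mult_right_mono[of 1 "exp (b - x)" "\<bar>R x\<bar>"] that by simp
    then show "AE x in lborel. norm (indicator {..b} x * R x) \<le> norm (exp b * (exp (- (1 * x)) * R x))"
      by (auto simp: indicator_def abs_mult mult.assoc[symmetric] exp_add[symmetric])
  qed measurable
  have H_int: "integrable lborel (\<lambda>x. indicator {..<x0} x * \<bar>R x\<bar>)"
    by (rule Bochner_Integration.integrable_bound[OF R_ind[of x0]]) (auto simp: indicator_def)
  define Q where "Q \<alpha> = (LINT x|lborel. indicator {\<alpha>..\<alpha> + \<eta>} x * (R x + C1))" for \<alpha>
  have Q_int: "integrable lborel (\<lambda>x. indicator {\<alpha>..\<alpha> + \<eta>} x * (R x + C1))" for \<alpha>
  proof -
    have "integrable lborel (\<lambda>x. indicator {\<alpha>..\<alpha> + \<eta>} x * R x)"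
      by (rule Bochner_Integration.integrable_bound[OF R_ind[of "\<alpha> + \<eta>"]]) (auto simp: indicator_def)
    moreover have "integrable lborel (\<lambda>x. indicator {\<alpha>..\<alpha> + \<eta>} x * C1)"
      by (intro integrable_mult_left integrable_real_indicator) (use \<eta> in auto)
    ultimately have "integrable lborel (\<lambda>x. indicator {\<alpha>..\<alpha> + \<eta>} x * R x + indicator {\<alpha>..\<alpha> + \<eta>} x * C1)"
      by (rule Bochner_Integration.integrable_add)
    then show ?thesis by (simp add: ring_distribs)
  qed
  let ?G = "\<lambda>s. laplace S s - of_real a / (s - 1)"
  obtain N I where N: "\<And>h. h \<ge> N \<Longrightarrow> ((\<lambda>\<sigma>. LINT t|lebesgue. ?G (Complex \<sigma> t) * exp (\<i> * of_real (h * t)) * \<phi> t) \<longlongrightarrow> I h) (at_right 1)"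
    and I: "(I \<longlongrightarrow> 0) at_top"
    using pf unfolding pseudofunction_boundary_behavior_def by auto
  define B' where "B' = (1 + C1 * (LINT x|lborel. k x) + B * H) / c"
  \<comment> \<open>At fixed \<sigma> only the window where k is at least c is kept, with its
    smallest weight, the one at the right end. The added C1 costs at most C1 times the integral of
    k, and the part before x0 at most B H, because the weights are at most 1 on the
    half-line.\<close>
  have key: "c * exp (- ((\<sigma> - 1) * (h + y0 + \<eta>))) * Q (h + y0)
      \<le> Re (LINT t|lebesgue. ?G (Complex \<sigma> t) * exp (\<i> * of_real (h * t)) * \<phi> t) + C1 * (LINT x|lborel. k x) + B * H"
    if \<sigma>: "\<sigma> > 1" and h: "h + y0 \<ge> x0" for \<sigma> h
  proof -
    define w where "w x = exp (- ((\<sigma> - 1) * x))" for x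
    define \<beta> where "\<beta> = h + y0 + \<eta>"
    have w_int: "integrable lborel (\<lambda>x. w x * R x)" unfolding w_def using \<sigma> by (intro R_int) simp
    have int: "integrable lborel (\<lambda>x. w x * R x * k (x - h))"
    proof (rule Bochner_Integration.integrable_bound)
      show "integrable lborel (\<lambda>x. w x * R x * B)" using w_int by simp
      show "AE x in lborel. norm (w x * R x * k (x - h)) \<le> norm (w x * R x * B)"
        using kB k(2) B0 by (auto simp: abs_mult intro!: mult_left_mono)
    qed (auto simp: w_def)
    have k_shift: "integrable lborel (\<lambda>x. k (x + - h))" by (simp only: integrable_lborel_translate k_int)
    have "(LINT t|lebesgue. ?G (Complex \<sigma> t) * exp (\<i> * of_real (h * t)) * \<phi> t)
        = (LINT x|lborel. of_real (w x * R x) * fourier \<phi> (x - h))"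
      unfolding w_def by (rule boundary_integral_eq[OF R_meas R_neg R_int G \<phi>(1) \<sigma>])
    also have "\<dots> = of_real (LINT x|lborel. w x * R x * k (x - h))"
      by (simp add: k flip: of_real_mult integral_complex_of_real del: of_real_mult)
    finally have eq: "Re (LINT t|lebesgue. ?G (Complex \<sigma> t) * exp (\<i> * of_real (h * t)) * \<phi> t) = (LINT x|lborel. w x * R x * k (x - h))"
      by simp
    have "(LINT x|lborel. c * w \<beta> * (indicator {h + y0..h + y0 + \<eta>} x * (R x + C1)) - C1 * k (x + - h) - B * (indicator {..<x0} x * \<bar>R x\<bar>))
        \<le> (LINT x|lborel. w x * R x * k (x - h))"
    proof (rule integral_mono_AE)
      show "AE x in lborel. c * w \<beta> * (indicator {h + y0..h + y0 + \<eta>} x * (R x + C1)) - C1 * k (x + - h) - B * (indicator {..<x0} x * \<bar>R x\<bar>)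
          \<le> w x * R x * k (x - h)"
        using R_below
      proof eventually_elim
        case (elim x)
        consider "x < 0" | "0 \<le> x" "x < x0" | "x \<ge> x0" by linarith
        then show ?case
        proof cases
          case 1
          then show ?thesis using h C C1 k(2)[of "x - h"] by (simp add: R_neg)
        next
          case 2
          then have "w x \<le> 1" using \<sigma> by (simp add: w_def)
          moreover have w0: "w x \<ge> 0" by (simp add: w_def)
          ultimately have "(w x * \<bar>R x\<bar>) * k (x - h) \<le> (1 * \<bar>R x\<bar>) * B"
            using kB k(2) by (intro mult_mono) auto
          moreover have "- ((w x * \<bar>R x\<bar>) * k (x - h)) \<le> w x * R x * k (x - h)"
          proof -
            have "\<bar>w x * R x * k (x - h)\<bar> = (w x * \<bar>R x\<bar>) * k (x - h)"
              using w0 k(2)[of "x - h"] by (simp add: abs_mult)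
            then show ?thesis by linarith
          qed
          moreover have "C1 * k (x - h) \<ge> 0" using C1 k(2) by simp
          ultimately show ?thesis using 2 h by (simp add: mult.commute)
        next
          case 3
          then have R1: "R x + C1 \<ge> 0" using elim by simp
          have w1: "w x \<le> 1" "w x \<ge> 0" using 3 C \<sigma> by (auto simp: w_def)
          have a: "w x * C1 * k (x - h) \<le> 1 * C1 * k (x - h)" using w1 C1 k(2) by (intro mult_right_mono) auto
          have b: "c * w \<beta> * (indicator {h + y0..h + y0 + \<eta>} x * (R x + C1)) \<le> w x * k (x - h) * (R x + C1)"
          proof (cases "x \<in> {h + y0..h + y0 + \<eta>}")
            case True
            then have "w \<beta> \<le> w x" using \<sigma> by (auto simp: w_def \<beta>_def intro!: mult_left_mono)
            moreover have "c \<le> k (x - h)" using True by (intro kc) auto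
            moreover have "w \<beta> \<ge> 0" by (simp add: w_def)
            ultimately have "c * w \<beta> \<le> k (x - h) * w x" using c k(2) by (intro mult_mono) auto
            then have "c * w \<beta> * (R x + C1) \<le> k (x - h) * w x * (R x + C1)" using R1 by (rule mult_right_mono)
            then show ?thesis using True by (simp add: mult.commute)
          next
            case False
            then show ?thesis using w1 R1 k(2) by simp
          qed
          have "w x * k (x - h) * (R x + C1) = w x * R x * k (x - h) + w x * C1 * k (x - h)" by (simp add: algebra_simps)
          then show ?thesis using a b 3 by simp
        qed
      qed
    qed (use Q_int k_shift H_int int in auto)
    also have "(LINT x|lborel. c * w \<beta> * (indicator {h + y0..h + y0 + \<eta>} x * (R x + C1)) - C1 * k (x + - h) - B * (indicator {..<x0} x * \<bar>R x\<bar>))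
        = c * w \<beta> * Q (h + y0) - C1 * (LINT x|lborel. k (x + - h)) - B * H"
      using Q_int k_shift H_int by (simp add: Q_def H_def)
    also have "(LINT x|lborel. k (x + - h)) = (LINT x|lborel. k x)" by (rule integral_lborel_translate)
    finally show ?thesis using eq by (simp add: w_def \<beta>_def)
  qed
  \<comment> \<open>The limit \<sigma> -> 1 is taken in the inequality: the weight tends to 1, and
    the boundary integral tends to I h by hypothesis.\<close>
  have key2: "c * Q (h + y0) \<le> Re (I h) + C1 * (LINT x|lborel. k x) + B * H" if h: "h \<ge> N" "h + y0 \<ge> x0" for h
  proof (rule tendsto_le[of "at_right (1::real)"])
    show "((\<lambda>\<sigma>. Re (LINT t|lebesgue. ?G (Complex \<sigma> t) * exp (\<i> * of_real (h * t)) * \<phi> t) + C1 * (LINT x|lborel. k x) + B * H)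
      \<longlongrightarrow> Re (I h) + C1 * (LINT x|lborel. k x) + B * H) (at_right 1)"
      by (intro tendsto_intros N h)
    have "((\<lambda>\<sigma>. c * exp (- ((\<sigma> - 1) * (h + y0 + \<eta>))) * Q (h + y0)) \<longlongrightarrow> c * exp (- ((1 - 1) * (h + y0 + \<eta>))) * Q (h + y0)) (at_right 1)"
      by (intro tendsto_intros)
    then show "((\<lambda>\<sigma>. c * exp (- ((\<sigma> - 1) * (h + y0 + \<eta>))) * Q (h + y0)) \<longlongrightarrow> c * Q (h + y0)) (at_right 1)" by simp
    show "\<forall>\<^sub>F \<sigma> in at_right 1. c * exp (- ((\<sigma> - 1) * (h + y0 + \<eta>))) * Q (h + y0)
      \<le> Re (LINT t|lebesgue. ?G (Complex \<sigma> t) * exp (\<i> * of_real (h * t)) * \<phi> t) + C1 * (LINT x|lborel. k x) + B * H"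
      using key[OF _ h(2)] by (auto simp: eventually_at_right_field intro!: exI[of _ 2])
  qed simp
  have "\<forall>\<^sub>F h in at_top. norm (I h) < 1" using tendstoD[OF I, of 1] by (simp add: dist_norm)
  then obtain h1 where h1: "\<And>h. h \<ge> h1 \<Longrightarrow> norm (I h) < 1" by (auto simp: eventually_at_top_linorder)
  have Q_le: "Q \<alpha> \<le> B'" if \<alpha>: "\<alpha> \<ge> max (max N h1 + y0) x0" for \<alpha>
  proof -
    have "max N h1 \<le> \<alpha> - y0" using \<alpha> by (simp only: le_diff_eq max.bounded_iff)
    then have Nh: "N \<le> \<alpha> - y0" "h1 \<le> \<alpha> - y0" by simp_all
    have "Re (I (\<alpha> - y0)) < 1"
      using h1[OF Nh(2)] complex_Re_le_cmod[of "I (\<alpha> - y0)"] by (rule le_less_trans[rotated])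
    moreover have "c * Q (\<alpha> - y0 + y0) \<le> Re (I (\<alpha> - y0)) + C1 * (LINT x|lborel. k x) + B * H"
      using Nh \<alpha> by (intro key2) auto
    ultimately have "c * Q \<alpha> \<le> 1 + C1 * (LINT x|lborel. k x) + B * H" by simp
    then show ?thesis unfolding B'_def using c by (simp add: field_simps)
  qed
  define x1 where "x1 = max (max (max N h1 + y0) x0) x0'"
  have "S \<alpha> \<le> (1 + max 0 (B' / (\<eta> * exp (- 1)))) * exp \<alpha>" if \<alpha>: "\<alpha> \<ge> x1" for \<alpha>
  proof -
    \<comment> \<open>Slow decrease with loss exp \<alpha> leaves S x at least v exp \<alpha> on the
      whole window, where exp (\<alpha> - x) is at least exp (- 1). So a large \<open>v\<close>
      would force a large \<open>Q \<alpha>\<close>.\<close>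
    define v where "v = S \<alpha> * exp (- \<alpha>) - 1"
    have Sv: "S \<alpha> = (1 + v) * exp \<alpha>" by (simp add: v_def mult.assoc flip: exp_add)
    have "v \<le> max 0 (B' / (\<eta> * exp (- 1)))"
    proof (cases "v \<le> 0")
      case False
      then have v: "v > 0" by simp
      have a0: "\<alpha> \<ge> 0" "\<alpha> \<ge> x0'" using \<alpha> d by (auto simp: x1_def)
      have "(LINT x|lborel. indicator {\<alpha>..\<alpha> + \<eta>} x * (exp (- 1) * v)) \<le> Q \<alpha>"
        unfolding Q_def
      proof (rule integral_mono_AE)
        show "AE x in lborel. indicator {\<alpha>..\<alpha> + \<eta>} x * (exp (- 1) * v) \<le> indicator {\<alpha>..\<alpha> + \<eta>} x * (R x + C1)"
          using f_ae
        proof eventually_elim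
          case (elim x)
          show ?case
          proof (cases "x \<in> {\<alpha>..\<alpha> + \<eta>}")
            case True
            then have "S (\<alpha> + (x - \<alpha>)) \<ge> S \<alpha> - 1 * exp \<alpha>" using \<eta> a0 by (intro step) auto
            then have "S x \<ge> v * exp \<alpha>" by (simp add: Sv ring_distribs)
            then have "v * exp \<alpha> * exp (- x) \<le> S x * exp (- x)" by (rule mult_right_mono) simp
            then have "v * exp (\<alpha> - x) \<le> S x * exp (- x)" by (simp add: mult.assoc flip: exp_add)
            moreover have "v * exp (- 1) \<le> v * exp (\<alpha> - x)" using True \<eta> v by (intro mult_left_mono) auto
            ultimately have "exp (- 1) * v \<le> S x * exp (- x)" by (simp add: mult.commute)
            then have "exp (- 1) * v \<le> R x + C1"
              using True elim a0 C1 by (simp add: R_def excess_def)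
            then show ?thesis using True by simp
          qed simp
        qed
        show "integrable lborel (\<lambda>x. indicator {\<alpha>..\<alpha> + \<eta>} x * (exp (- 1) * v))"
          by (intro integrable_mult_left integrable_real_indicator) (use \<eta> in auto)
      qed (rule Q_int)
      also have "(LINT x|lborel. indicator {\<alpha>..\<alpha> + \<eta>} x * (exp (- 1) * v)) = \<eta> * (exp (- 1) * v)"
        using \<eta> by simp
      also have "Q \<alpha> \<le> B'" using \<alpha> by (intro Q_le) (simp add: x1_def)
      finally have "v \<le> B' / (\<eta> * exp (- 1))" using \<eta> by (simp add: pos_le_divide_eq mult_ac)
      then show ?thesis by simp
    qed simp
    then show ?thesis unfolding Sv by (intro mult_right_mono) auto
  qed
  then show thesis by (rule that)
qed

section \<open>Slow decrease and integrability for functions of order exp x\<close>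

lemma asymp_exp_imp_slowly_decreasing:
  fixes S :: "real \<Rightarrow> real"
  assumes lim: "((\<lambda>x. S x / exp x) \<longlongrightarrow> a) at_top"
  shows "log_linearly_slowly_decreasing S"
  unfolding log_linearly_slowly_decreasing_def
proof (intro allI impI)
  fix e :: real assume e: "e > 0"
  have "\<forall>\<^sub>F x in at_top. \<bar>S x / exp x - a\<bar> < e / 8"
    using tendstoD[OF lim, of "e / 8"] e by (simp add: dist_real_def)
  then obtain x0 where x0: "\<And>x. x \<ge> x0 \<Longrightarrow> \<bar>S x / exp x - a\<bar> < e / 8" by (auto simp: eventually_at_top_linorder)
  \<comment> \<open>As exp h is at most 3 for h at most 1, the error \<open>p\<close> contributes 3
    e / 8, the drift a (exp h - 1) contributes 3 |a| d, at most e / 2, and \<open>q\<close>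
    contributes e / 8: together e.\<close>
  define d where "d = min 1 (e / (6 * (\<bar>a\<bar> + 1)))"
  have d: "d > 0" "d \<le> 1" using e by (auto simp: d_def)
  have da: "\<bar>a\<bar> * d \<le> e / 6"
  proof -
    have "\<bar>a\<bar> * d \<le> (\<bar>a\<bar> + 1) * (e / (6 * (\<bar>a\<bar> + 1)))" using e by (intro mult_mono) (auto simp: d_def)
    also have "\<dots> = e / 6" by (simp add: field_simps)
    finally show ?thesis .
  qed
  have *: "(S (x + h) - S x) * exp (- x) \<ge> - e" if "0 \<le> h" "h \<le> d" "x \<ge> x0" for x h
  proof -
    define p where "p = S (x + h) / exp (x + h) - a"
    define q where "q = S x / exp x - a"
    have p: "\<bar>p\<bar> < e / 8" and q: "\<bar>q\<bar> < e / 8" using x0[of "x + h"] x0[of x] that by (auto simp: p_def q_def)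
    have "S (x + h) = (p + a) * exp (x + h)" "S x = (q + a) * exp x" by (simp_all add: p_def q_def)
    then have eq: "(S (x + h) - S x) * exp (- x) = p * exp h + a * (exp h - 1) - q"
      by (simp add: exp_add exp_minus field_simps)
    have h1: "exp h \<le> 3"
    proof -
      have "exp h \<le> exp 1" using that d by simp
      then show ?thesis using exp_le by linarith
    qed
    have "exp h - 1 \<le> 3 * h"
    proof -
      have "1 + - h \<le> exp (- h)" by (rule exp_ge_add_one_self)
      then have "(1 - h) * exp h \<le> exp (- h) * exp h" by (intro mult_right_mono) auto
      then have "exp h - h * exp h \<le> 1" by (simp add: left_diff_distrib flip: exp_add)
      moreover have "h * exp h \<le> h * 3" using h1 that by (intro mult_left_mono) auto
      ultimately show ?thesis by linarith
    qed
    then have "\<bar>a\<bar> * (exp h - 1) \<le> \<bar>a\<bar> * (3 * d)" using that by (intro mult_left_mono) auto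
    then have a1: "\<bar>a * (exp h - 1)\<bar> \<le> e / 2" using da that by (simp add: abs_mult)
    have "\<bar>p\<bar> * exp h \<le> e / 8 * 3" using p h1 by (intro mult_mono) auto
    then have "\<bar>p * exp h\<bar> \<le> e / 8 * 3" by (simp add: abs_mult)
    then show ?thesis unfolding eq using a1 q by linarith
  qed
  show "\<exists>\<delta>>0. \<exists>x0\<ge>0. \<forall>h x. 0 \<le> h \<and> h \<le> \<delta> \<and> x0 \<le> x \<longrightarrow> - e \<le> (S (x + h) - S x) * exp (- x)"
    using * d by (intro exI[of _ d] conjI exI[of _ "max x0 0"]) auto
qed

lemma exp_bound_imp_integrable:
  fixes S f :: "real \<Rightarrow> real"
  assumes [measurable]: "f \<in> borel_measurable borel" and f_neg: "\<And>x. x < 0 \<Longrightarrow> f x = 0"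
    and f_ae: "AE x in lborel. x \<ge> 0 \<longrightarrow> f x = S x"
    and f_loc: "\<And>b. integrable lborel (\<lambda>x. indicator {..b} x * f x)"
    and bound: "\<And>x. x \<ge> x1 \<Longrightarrow> \<bar>S x\<bar> \<le> M * exp x" and \<sigma>: "\<sigma> > 1"
  shows "integrable lborel (\<lambda>x. exp (- (\<sigma> * x)) * f x)"
proof (rule Bochner_Integration.integrable_bound)
  show "integrable lborel (\<lambda>x. \<bar>indicator {..x1} x * f x\<bar> + \<bar>M * (indicator {0..} x * exp (- ((\<sigma> - 1) * x)))\<bar>)"
    using \<sigma> by (intro Bochner_Integration.integrable_add integrable_abs f_loc integrable_mult_right integrable_exp_halfline) simp
  show "AE x in lborel. norm (exp (- (\<sigma> * x)) * f x)
     \<le> norm (\<bar>indicator {..x1} x * f x\<bar> + \<bar>M * (indicator {0..} x * exp (- ((\<sigma> - 1) * x)))\<bar>)"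
    using f_ae
  proof eventually_elim
    case (elim x)
    consider "x < 0" | "x \<ge> 0" "x \<le> x1" | "x \<ge> 0" "x \<ge> x1" by linarith
    then show ?case
    proof cases
      case 1
      then show ?thesis using f_neg by simp
    next
      case 2
      then have "exp (- (\<sigma> * x)) * \<bar>f x\<bar> \<le> 1 * \<bar>f x\<bar>" using \<sigma> by (intro mult_right_mono) auto
      then show ?thesis using 2 by (simp add: abs_mult add_increasing2)
    next
      case 3
      then have "exp (- (\<sigma> * x)) * \<bar>f x\<bar> \<le> exp (- (\<sigma> * x)) * (M * exp x)"
        using bound[of x] elim by (intro mult_left_mono) auto
      also have "\<dots> = M * exp (- ((\<sigma> - 1) * x))" by (simp add: algebra_simps flip: exp_add)
      also have "\<dots> \<le> \<bar>M * exp (- ((\<sigma> - 1) * x))\<bar>" by (rule abs_ge_self)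
      finally show ?thesis using 3 by (simp add: abs_mult add_increasing)
    qed
  qed
qed measurable

text \<open>The hypothesis compares both values at the scale exp x, the conclusion divides the
  second by exp (x + h). The change of scale costs a multiple of the quotient itself, which is why a
  bound on the quotient enters.\<close>

lemma slowly_decreasing_normalised:
  assumes slow: "log_linearly_slowly_decreasing S" and M: "\<And>x. x \<ge> x1 \<Longrightarrow> \<bar>S x / exp x\<bar> \<le> M" and e: "e > 0"
  shows "\<exists>d>0. \<exists>x0. \<forall>x\<ge>x0. \<forall>h\<in>{0..d}. S x / exp x - e \<le> S (x + h) / exp (x + h)"
proof -
  have M0: "M \<ge> 0" using order_trans[OF abs_ge_zero M[of x1]] by simp
  obtain d x0 where d: "d > 0" and step: "\<And>x h. x \<ge> x0 \<Longrightarrow> 0 \<le> h \<Longrightarrow> h \<le> d \<Longrightarrow> S (x + h) \<ge> S x - e / 2 * exp x"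
    using log_linearly_slowly_decreasingD[OF slow, of "e / 2"] e by (metis half_gt_zero)
  \<comment> \<open>The change of scale costs at most (M + e) h; this cap keeps it within e /
    2.\<close>
  define d' where "d' = min d (e / (2 * (M + e)))"
  have d': "d' > 0" "d' \<le> d" using d e M0 by (auto simp: d'_def)
  have "S x / exp x - e \<le> S (x + h) / exp (x + h)" if x: "x \<ge> max x0 x1" and h: "h \<in> {0..d'}" for x h
  proof -
    define t where "t = S x / exp x"
    have t: "\<bar>t\<bar> \<le> M" using M[of x] x by (simp add: t_def)
    have "S (x + h) \<ge> (t - e / 2) * exp x"
      using step[of x h] x h d' by (simp add: t_def left_diff_distrib)
    then have "(t - e / 2) * exp x / exp (x + h) \<le> S (x + h) / exp (x + h)" by (intro divide_right_mono) auto
    moreover have "(t - e / 2) * exp x / exp (x + h) = (t - e / 2) * exp (- h)"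
    proof -
      have "exp x / exp (x + h) = exp (- h)" by (simp flip: exp_diff)
      then show ?thesis by (metis times_divide_eq_right)
    qed
    moreover have "t - e / 2 - (t - e / 2) * exp (- h) \<le> e / 2"
    proof -
      have h1: "0 \<le> 1 - exp (- h)" "1 - exp (- h) \<le> h" using h exp_ge_add_one_self[of "- h"] by auto
      have "t - e / 2 - (t - e / 2) * exp (- h) = (t - e / 2) * (1 - exp (- h))" by (simp only: right_diff_distrib mult_1_right)
      also have "\<dots> \<le> (M + e) * (1 - exp (- h))" using t e h1 by (intro mult_right_mono) auto
      also have "\<dots> \<le> (M + e) * (e / (2 * (M + e)))"
        using h1 h M0 e by (intro mult_left_mono) (auto simp: d'_def)
      also have "\<dots> = e / 2" using M0 e by (simp add: field_simps)
      finally show ?thesis .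
    qed
    ultimately show ?thesis unfolding t_def[symmetric] by linarith
  qed
  then show ?thesis using d' by blast
qed

theorem theorem3p8:
  fixes S :: "real \<Rightarrow> real" and a :: real
    and J :: "'j set" and \<phi> :: "'j \<Rightarrow> real \<Rightarrow> complex"
  assumes "locally_integrable_halfline S"
    and "\<And>l. l \<in> J \<Longrightarrow> \<phi> l \<in> wiener_algebra_c"
    and "\<And>t. \<exists>l\<in>J. \<phi> l t \<noteq> 0"
    and "\<exists>l\<in>J. \<phi> l 0 \<noteq> 0 \<and> (\<forall>x. fourier (\<phi> l) x \<in> \<real>\<^sub>\<ge>\<^sub>0)"
  shows "((\<lambda>x. S x / exp x) \<longlongrightarrow> a) at_top \<longleftrightarrow>
      log_linearly_slowly_decreasing S \<and>
      (\<forall>s. Re s > 1 \<longrightarrow> laplace_converges S s) \<and>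
      (\<forall>l\<in>J. pseudofunction_boundary_behavior
                 (\<lambda>s. laplace S s - of_real a / (s - 1)) 1 (\<phi> l))"
proof -
  obtain f where f_meas [measurable]: "f \<in> borel_measurable borel" and f_neg: "\<And>x. x < 0 \<Longrightarrow> f x = 0"
    and f_ae: "AE x in lborel. x \<ge> 0 \<longrightarrow> f x = S x"
    and f_loc: "\<And>b. integrable lborel (\<lambda>x. indicator {..b} x * f x)"
    using locally_integrable_borel_version[OF assms(1)] by metis
  have \<phi>: "\<phi> l \<in> window_class" if "l \<in> J" for l
    using assms(2)[OF that] wiener_algebra_c_subset by blast
  define R where "R = excess f a"
  have R_meas [measurable]: "R \<in> borel_measurable borel" unfolding R_def by measurable
  have R_neg: "R x = 0" if "x < 0" for x using that by (simp add: R_def excess_neg)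
  have R_ae: "AE x in lborel. x \<ge> 0 \<longrightarrow> R x = S x / exp x - a"
    using f_ae by eventually_elim (simp add: R_def excess_def divide_inverse exp_minus)
  let ?F = "\<lambda>s. laplace S s - of_real a / (s - 1)"
  have R_int: "integrable lborel (\<lambda>x. exp (- (d * x)) * R x)"
    if "\<And>\<sigma>. \<sigma> > 1 \<Longrightarrow> integrable lborel (\<lambda>x. exp (- (\<sigma> * x)) * f x)" "d > 0" for d
    unfolding R_def by (intro excess_integrable[OF f_meas _ f_ae f_loc] that f_neg)
  have F: "?F s = (LINT x|lborel. exp (- ((s - 1) * of_real x)) * of_real (R x))"
    if "\<And>\<sigma>. \<sigma> > 1 \<Longrightarrow> integrable lborel (\<lambda>x. exp (- (\<sigma> * x)) * f x)" "Re s > 1" for s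
    unfolding R_def by (intro laplace_minus_pole[OF f_meas _ f_ae f_loc] that f_neg)
  show ?thesis
  proof
    assume lim: "((\<lambda>x. S x / exp x) \<longlongrightarrow> a) at_top"
    have lim0: "\<exists>x1\<ge>0. \<forall>x\<ge>x1. \<bar>S x / exp x - a\<bar> \<le> e" if "e > 0" for e
    proof -
      have "\<forall>\<^sub>F x in at_top. \<bar>S x / exp x - a\<bar> < e"
        using tendstoD[OF lim that] by (simp add: dist_real_def)
      then obtain x1 where "\<And>x. x \<ge> x1 \<Longrightarrow> \<bar>S x / exp x - a\<bar> < e" by (auto simp: eventually_at_top_linorder)
      then show ?thesis by (intro exI[of _ "max x1 0"]) (auto intro: less_imp_le)
    qed
    obtain x1 where x1: "\<And>x. x \<ge> x1 \<Longrightarrow> \<bar>S x / exp x - a\<bar> \<le> 1" using lim0[of 1] by auto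
    \<comment> \<open>A bounded quotient makes the Laplace integrals absolutely convergent for Re s
      > 1, which the integral formula for \<open>?F\<close> presupposes.\<close>
    have bound: "\<bar>S x\<bar> \<le> (\<bar>a\<bar> + 1) * exp x" if "x \<ge> x1" for x
    proof -
      have "\<bar>S x / exp x\<bar> \<le> \<bar>a\<bar> + 1" using x1[OF that] by linarith
      then show ?thesis by (simp add: abs_divide pos_divide_le_eq)
    qed
    have f_int: "integrable lborel (\<lambda>x. exp (- (\<sigma> * x)) * f x)" if "\<sigma> > 1" for \<sigma>
      using exp_bound_imp_integrable[OF f_meas _ f_ae f_loc bound that] f_neg by blast
    have "laplace_converges S s" if "Re s > 1" for s
      by (rule laplace_converges_halfplane[OF f_meas _ f_ae f_loc f_int that]) (rule f_neg)
    moreover have "pseudofunction_boundary_behavior ?F 1 (\<phi> l)" if "l \<in> J" for l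
    proof (rule tendsto_0_imp_pseudofunction[OF R_meas R_neg R_int[OF f_int] F[OF f_int] \<phi>[OF that]])
      fix e :: real assume "e > 0"
      then obtain x1 where x1: "x1 \<ge> 0" "\<And>x. x \<ge> x1 \<Longrightarrow> \<bar>S x / exp x - a\<bar> \<le> e" using lim0 by blast
      have "AE x in lborel. x \<ge> x1 \<longrightarrow> \<bar>R x\<bar> \<le> e" using R_ae by eventually_elim (use x1 in auto)
      then show "\<exists>x1\<ge>0. AE x in lborel. x \<ge> x1 \<longrightarrow> \<bar>R x\<bar> \<le> e" using x1(1) by blast
    qed
    ultimately show "log_linearly_slowly_decreasing S \<and> (\<forall>s. Re s > 1 \<longrightarrow> laplace_converges S s) \<and>
      (\<forall>l\<in>J. pseudofunction_boundary_behavior ?F 1 (\<phi> l))"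
      using asymp_exp_imp_slowly_decreasing[OF lim] by blast
  next
    assume "log_linearly_slowly_decreasing S \<and> (\<forall>s. Re s > 1 \<longrightarrow> laplace_converges S s) \<and>
      (\<forall>l\<in>J. pseudofunction_boundary_behavior ?F 1 (\<phi> l))"
    then have slow: "log_linearly_slowly_decreasing S" and conv: "\<And>s. Re s > 1 \<Longrightarrow> laplace_converges S s"
      and pf: "\<And>l. l \<in> J \<Longrightarrow> pseudofunction_boundary_behavior ?F 1 (\<phi> l)" by auto
    obtain C x0 where C: "C \<ge> 0" "x0 \<ge> 0" and below: "\<And>x. x \<ge> x0 \<Longrightarrow> S x \<ge> - C * exp x"
      using log_linearly_slowly_decreasing_bounded_below[OF slow] by metis
    have f_int: "integrable lborel (\<lambda>x. exp (- (\<sigma> * x)) * f x)" if \<sigma>: "\<sigma> > 1" for \<sigma>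
    proof (rule integrable_if_bounded_below[OF f_meas _ f_ae f_loc _ \<sigma> C(2,1) below])
      show "laplace_converges S (of_real \<sigma>)" using \<sigma> by (intro conv) simp
    qed (rule f_neg)
    obtain l0 where l0: "l0 \<in> J" "\<phi> l0 0 \<noteq> 0" "\<And>x. fourier (\<phi> l0) x \<in> \<real>\<^sub>\<ge>\<^sub>0" using assms(4) by blast
    obtain M' x1' where above: "\<And>x. x \<ge> x1' \<Longrightarrow> S x \<le> M' * exp x"
      using slowly_decreasing_bounded_above[OF f_meas f_neg f_ae f_loc f_int slow \<phi>[OF l0(1)] l0(2,3) pf[OF l0(1)]] by metis
    define x1 where "x1 = max x0 x1'"
    define M where "M = max C \<bar>M'\<bar> + \<bar>a\<bar>"
    have M0: "M \<ge> 0" using C by (simp add: M_def add_nonneg_nonneg)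
    have x1: "x1 \<ge> 0" using C by (simp add: x1_def)
    have T: "\<bar>S x / exp x\<bar> \<le> max C \<bar>M'\<bar>" if "x \<ge> x1" for x
    proof -
      have "S x / exp x \<le> M'" "- C \<le> S x / exp x"
        using above[of x] below[of x] that by (auto simp: x1_def pos_divide_le_eq pos_le_divide_eq)
      then show ?thesis by (auto simp: abs_le_iff le_max_iff_disj)
    qed
    \<comment> \<open>Two versions of the error from here on: \<open>r\<close> is given by
      \<open>S\<close> at every point and carries slow decrease, while \<open>R2\<close> is Borel
      and bounded everywhere but agrees with \<open>r\<close> only almost everywhere beyond
      \<open>x1\<close>.\<close>
    define r where "r x = S x / exp x - a" for x
    have r: "\<bar>r x\<bar> \<le> M" if "x \<ge> x1" for x
    proof -
      have "\<bar>r x\<bar> \<le> \<bar>S x / exp x\<bar> + \<bar>a\<bar>" unfolding r_def by (rule abs_triangle_ineq4)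
      then show ?thesis using T[OF that] by (simp add: M_def)
    qed
    have R_bound: "AE x in lborel. x \<ge> x1 \<longrightarrow> \<bar>R x\<bar> \<le> M"
      using R_ae by eventually_elim (use r x1 in \<open>auto simp: r_def\<close>)
    note ctx = R_meas R_neg R_int[OF f_int] F[OF f_int] x1 M0 R_bound
    define R2 where "R2 = tail_part x1 M R"
    have R2 [measurable]: "R2 \<in> borel_measurable borel" and R2_bound: "\<bar>R2 x\<bar> \<le> M" for x
      using M0 by (auto simp: R2_def tail_part_def[abs_def])
    have R2_ae: "AE x in lborel. x \<ge> x1 \<longrightarrow> R2 x = r x"
      using R_ae by eventually_elim (use r x1 in \<open>auto simp: r_def R2_def tail_part_def\<close>)
    have van_\<phi>: "vanishes (\<lambda>x. of_real (R2 x)) (\<phi> l)" if "l \<in> J" for l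
      unfolding R2_def by (rule pseudofunction_imp_vanishes[OF ctx \<phi>[OF that] pf[OF that]])
    have van: "vanishes (\<lambda>x. of_real (R2 x)) u" if "u \<in> window_class" for u
    proof (rule vanishes_all[where M=M and \<Phi>="\<phi> ` J"])
      show "norm (complex_of_real (R2 x)) \<le> M" for x using R2_bound by simp
    qed (use \<phi> van_\<phi> assms(3) that in auto)
    have "(r \<longlongrightarrow> 0) at_top"
    proof (rule slowly_decreasing_tendsto_0[OF R2 R2_bound r R2_ae _ van])
      show "\<exists>d>0. \<exists>x0. \<forall>x\<ge>x0. \<forall>h\<in>{0..d}. r x - e \<le> r (x + h)" if "e > 0" for e
      proof -
        obtain d x0 where "d > 0" and *: "\<And>x h. x \<ge> x0 \<Longrightarrow> h \<in> {0..d} \<Longrightarrow> S x / exp x - e \<le> S (x + h) / exp (x + h)"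
          using slowly_decreasing_normalised[OF slow T \<open>e > 0\<close>] by metis
        moreover have "r x - e \<le> r (x + h)" if "x \<ge> x0" "h \<in> {0..d}" for x h
          using *[OF that] unfolding r_def by linarith
        ultimately show ?thesis by blast
      qed
    qed
    then have "((\<lambda>x. r x + a) \<longlongrightarrow> 0 + a) at_top" by (intro tendsto_intros)
    then show "((\<lambda>x. S x / exp x) \<longlongrightarrow> a) at_top" by (simp add: r_def)
  qed
qed

end
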